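(* Let $\tau\in(2,3)$ and let the degree sequences satisfy the degree assumption stated in the context. Let $H=(V_H,\mathcal{E}_H)$ be a connected graph on $k$ vertices labelled $1,\dots,k$, with minimal degree 2, such that the optimization problem defining $B(H)$ has a unique maximizing partition and $B(H)=0$. Then $$\frac{N(H)}{n^{\frac k2(3-\tau)}}\longrightarrow A(H)<\infty\quad\text{in probability},$$ where $$A(H)=\Big(\frac{C(\tau-1)}{\mu^{(\tau-1)/2}}\Big)^k\int_0^\infty\!\!\cdots\!\int_0^\infty (x_1\cdots x_k)^{-\tau}\prod_{\{i,j\}\in\mathcal{E}_H}\frac{x_ix_j}{1+x_ix_j}\prod_{\{u,v\}\notin\mathcal{E}_H}\frac{1}{1+x_ux_v}\,{\rm d}x_1\cdots{\rm d}x_k,$$ the second product ranging over unordered pairs $u\ne v$ in $[k]$ that are not edges of $H$.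
   Context: For each $n\ge1$, $\boldsymbol d=(d_1,\dots,d_n)$ is a graphical sequence of positive integers, $L_n=\sum_i d_i$, $d_{\max}=\max_i d_i$, $F_n(j)=\frac1n\sum_{i\in[n]}\mathbb 1\{d_i\le j\}$. ${\rm URG}^{(n)}(\boldsymbol d)$ is a graph drawn uniformly at random among all simple graphs on $[n]$ with degree sequence $\boldsymbol d$. Degree assumption: there exist $\tau\in(2,3)$ and constants $K_1,K_2>0$ with $K_1j^{1-\tau}\le 1-F_n(j)\le K_2 j^{1-\tau}$ for all $n\ge1$, $0\le j\le d_{\max}$; and a constant $C>0$ with $1-F_n(j)=Cj^{1-\tau}(1+o(1))$ for all $j=O(\sqrt n)$. Moreover $\mu=\lim_{n}L_n/n\in(0,\infty)$. $N(H)$ is the number of ordered $k$-tuples $(v_1,\dots,v_k)$ of distinct vertices of ${\rm URG}^{(n)}(\boldsymbol d)$ such that for all $i\ne j$, $\{v_i,v_j\}$ is an edge iff $\{i,j\}\in\mathcal{E}_H$. Optimization: $V_1$ is the set of degree-one vertices of $H$, $k_1=|V_1|$; for a partition $\mathcal P=(S_1,S_2,S_3)$ of $V_H\setminus V_1$, $E_{S_i}$ = number of edges of $H$ inside $S_i$, $E_{S_i,S_j}$ = number between $S_i$ and $S_j$, $E_{S_i,V_1}$ = number between $S_i$ and $V_1$, and $$B(H)=\max_{\mathcal P}\Big[|S_1|+\tfrac{1}{\tau-1}|S_2|(2-\tau-k+|S_1|+k_1)-\tfrac{2E_{S_1}-2E_{S_2}+E_{S_1,S_3}-E_{S_2,S_3}+E_{S_1,V_1}-E_{S_2,V_1}}{\tau-1}\Big].$$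 *)

theory Defs
  imports
    "HOL-Probability.Probability"
    "HOL-Library.Ramsey"
    "HOL-Library.Landau_Symbols"
begin

(* A simple graph on a finite vertex set V is given by its edge set, a subset of [V]^2. *)

definition simple_graph :: "'a set \<Rightarrow> 'a set set \<Rightarrow> bool" where
  "simple_graph V E \<longleftrightarrow> finite V \<and> E \<subseteq> [V]\<^bsup>2\<^esup>"

definition degree_in :: "'a set set \<Rightarrow> 'a \<Rightarrow> nat" where
  "degree_in E v = card {e \<in> E. v \<in> e}"

definition connected_graph :: "'a set \<Rightarrow> 'a set set \<Rightarrow> bool" where
  "connected_graph V E \<longleftrightarrow>
     V \<noteq> {} \<and> (\<forall>u\<in>V. \<forall>v\<in>V. (u, v) \<in> {(a, b). {a, b} \<in> E}\<^sup>*)"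


section \<open>Degree sequences and the uniform random graph\<close>

(* Throughout, the degree sequence (d_1, ..., d_n) is a function d :: nat => nat of which
   only the values on {1..n} matter. *)

definition graphs_with_degrees :: "nat \<Rightarrow> (nat \<Rightarrow> nat) \<Rightarrow> nat set set set" where
  "graphs_with_degrees n d =
     {G. simple_graph {1..n} G \<and> (\<forall>i\<in>{1..n}. degree_in G i = d i)}"

definition graphical :: "nat \<Rightarrow> (nat \<Rightarrow> nat) \<Rightarrow> bool" where
  "graphical n d \<longleftrightarrow> graphs_with_degrees n d \<noteq> {}"

(* Only meaningful if the sequence is graphical (pmf_of_set needs a nonempty set). *)
definition URG :: "nat \<Rightarrow> (nat \<Rightarrow> nat) \<Rightarrow> nat set set pmf" where
  "URG n d = pmf_of_set (graphs_with_degrees n d)"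

definition total_degree :: "nat \<Rightarrow> (nat \<Rightarrow> nat) \<Rightarrow> nat" where
  "total_degree n d = (\<Sum>i=1..n. d i)"

definition d_max :: "nat \<Rightarrow> (nat \<Rightarrow> nat) \<Rightarrow> nat" where
  "d_max n d = Max (d ` {1..n})"

definition degree_cdf :: "nat \<Rightarrow> (nat \<Rightarrow> nat) \<Rightarrow> nat \<Rightarrow> real" where
  "degree_cdf n d j = (1 / real n) * (\<Sum>i=1..n. of_bool (d i \<le> j))"

(* d n is the degree sequence of the n-th graph.  Three conventions:
   - n starts at 2, because no graphical sequence of positive integers has length 1;
   - the two-sided tail bound is imposed for 1 <= j < d_max: at j = d_max the tail
     1 - F_n(j) is 0, so a positive lower bound is impossible, and j^(1 - tau) is undefined
     at j = 0;
   - "1 - F_n(j) = C j^(1 - tau) (1 + o(1)) for all j = O(sqrt n)" is imposed along every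
     sequence j = j_n of positive integers with j_n = O(sqrt n), as n tends to infinity. *)
definition degree_assumption ::
  "real \<Rightarrow> real \<Rightarrow> real \<Rightarrow> (nat \<Rightarrow> nat \<Rightarrow> nat) \<Rightarrow> bool" where
  "degree_assumption \<tau> C \<mu> d \<longleftrightarrow>
     2 < \<tau> \<and> \<tau> < 3 \<and> 0 < C \<and> 0 < \<mu> \<and>
     (\<forall>n\<ge>2. graphical n (d n) \<and> (\<forall>i\<in>{1..n}. 0 < d n i)) \<and>
     (\<exists>K\<^sub>1 > 0. \<exists>K\<^sub>2 > 0. \<forall>n\<ge>2. \<forall>j. 1 \<le> j \<and> j < d_max n (d n) \<longrightarrow>
        K\<^sub>1 * real j powr (1 - \<tau>) \<le> 1 - degree_cdf n (d n) j \<and>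
        1 - degree_cdf n (d n) j \<le> K\<^sub>2 * real j powr (1 - \<tau>)) \<and>
     (\<forall>j :: nat \<Rightarrow> nat. (\<forall>n. 1 \<le> j n) \<and> (\<lambda>n. real (j n)) \<in> O(\<lambda>n. sqrt (real n)) \<longrightarrow>
        (\<lambda>n. 1 - degree_cdf n (d n) (j n)) \<sim>[at_top] (\<lambda>n. C * real (j n) powr (1 - \<tau>))) \<and>
     (\<lambda>n. real (total_degree n (d n)) / real n) \<longlonglongrightarrow> \<mu>"


section \<open>Induced subgraph counts\<close>

(* H has vertex set {1..k} and edge set E; ordered k-tuples of vertices in {1..n} are
   extensional functions on {1..k}. *)
definition induced_count :: "nat \<Rightarrow> nat set set \<Rightarrow> nat \<Rightarrow> nat set set \<Rightarrow> nat" where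
  "induced_count k E n G =
     card {v \<in> {1..k} \<rightarrow>\<^sub>E {1..n}. inj_on v {1..k} \<and>
       (\<forall>i\<in>{1..k}. \<forall>j\<in>{1..k}. i \<noteq> j \<longrightarrow> ({v i, v j} \<in> G \<longleftrightarrow> {i, j} \<in> E))}"


section \<open>The optimization problem\<close>

definition edges_within :: "'a set set \<Rightarrow> 'a set \<Rightarrow> nat" where
  "edges_within E S = card {e \<in> E. e \<subseteq> S}"

definition edges_between :: "'a set set \<Rightarrow> 'a set \<Rightarrow> 'a set \<Rightarrow> nat" where
  "edges_between E S T = card {e \<in> E. \<exists>u\<in>S. \<exists>v\<in>T. e = {u, v}}"

definition degree_one_vertices :: "'a set \<Rightarrow> 'a set set \<Rightarrow> 'a set" where
  "degree_one_vertices V E = {v \<in> V. degree_in E v = 1}"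

(* Ordered partitions of W into three parts, possibly empty. *)
definition partitions3 :: "'a set \<Rightarrow> ('a set \<times> 'a set \<times> 'a set) set" where
  "partitions3 W = {(S\<^sub>1, S\<^sub>2, S\<^sub>3). S\<^sub>1 \<union> S\<^sub>2 \<union> S\<^sub>3 = W \<and>
     S\<^sub>1 \<inter> S\<^sub>2 = {} \<and> S\<^sub>1 \<inter> S\<^sub>3 = {} \<and> S\<^sub>2 \<inter> S\<^sub>3 = {}}"

definition B_objective ::
  "real \<Rightarrow> 'a set \<Rightarrow> 'a set set \<Rightarrow> 'a set \<times> 'a set \<times> 'a set \<Rightarrow> real" where
  "B_objective \<tau> V E = (\<lambda>(S\<^sub>1, S\<^sub>2, S\<^sub>3).
     let V\<^sub>1 = degree_one_vertices V E in
       real (card S\<^sub>1)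
       + 1 / (\<tau> - 1) * real (card S\<^sub>2)
           * (2 - \<tau> - real (card V) + real (card S\<^sub>1) + real (card V\<^sub>1))
       - (2 * real (edges_within E S\<^sub>1) - 2 * real (edges_within E S\<^sub>2)
          + real (edges_between E S\<^sub>1 S\<^sub>3) - real (edges_between E S\<^sub>2 S\<^sub>3)
          + real (edges_between E S\<^sub>1 V\<^sub>1) - real (edges_between E S\<^sub>2 V\<^sub>1)) / (\<tau> - 1))"

definition B_value :: "real \<Rightarrow> 'a set \<Rightarrow> 'a set set \<Rightarrow> real" where
  "B_value \<tau> V E = Max (B_objective \<tau> V E ` partitions3 (V - degree_one_vertices V E))"

definition B_unique_maximizer :: "real \<Rightarrow> 'a set \<Rightarrow> 'a set set \<Rightarrow> bool" where
  "B_unique_maximizer \<tau> V E \<longleftrightarrow>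
     (\<exists>!P. P \<in> partitions3 (V - degree_one_vertices V E) \<and> B_objective \<tau> V E P = B_value \<tau> V E)"


section \<open>The limiting constant\<close>

definition A_integrand :: "real \<Rightarrow> nat \<Rightarrow> nat set set \<Rightarrow> (nat \<Rightarrow> real) \<Rightarrow> real" where
  "A_integrand \<tau> k E x =
     (\<Prod>i=1..k. x i) powr (- \<tau>)
     * (\<Prod>e\<in>E. (\<Prod>i\<in>e. x i) / (1 + (\<Prod>i\<in>e. x i)))
     * (\<Prod>e\<in>[{1..k}]\<^bsup>2\<^esup> - E. 1 / (1 + (\<Prod>i\<in>e. x i)))"

(* Extended-real valued, so that finiteness of the integral is a genuine claim. *)
definition A_const :: "real \<Rightarrow> real \<Rightarrow> real \<Rightarrow> nat \<Rightarrow> nat set set \<Rightarrow> ennreal" where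
  "A_const \<tau> C \<mu> k E =
     ennreal ((C * (\<tau> - 1) / \<mu> powr ((\<tau> - 1) / 2)) ^ k)
     * (\<integral>\<^sup>+ x. ennreal (A_integrand \<tau> k E x) * indicator ({1..k} \<rightarrow>\<^sub>E {0<..}) x
          \<partial>(Pi\<^sub>M {1..k} (\<lambda>_. lborel)))"

end

theory Submission
  imports Defs "HOL-Real_Asymp.Real_Asymp"
begin

text \<open>Write \<open>x\<^sub>v = d\<^sub>v / sqrt L\<^sub>n\<close>. A switching argument shows that, uniformly in \<open>u\<close> and \<open>v\<close> and
  conditionally on a bounded number of prescribed edges and non-edges, the odds of \<open>{u, v}\<close> being an edge
  are \<open>(1 + o(1)) x\<^sub>u x\<^sub>v\<close>, with the degrees reduced by the number of prescribed edges. This needs only that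
  every vertex starts \<open>o(n)\<close> paths of length two. Hence the expected number of induced copies of \<open>H\<close> is
  asymptotically a sum of \<open>g(x\<^sub>v\<^sub>1, \<dots>, x\<^sub>v\<^sub>k)\<close> over tuples of vertices, where \<open>g\<close> is the product of
  \<open>x\<^sub>i x\<^sub>j / (1 + x\<^sub>i x\<^sub>j)\<close> over edges and \<open>1 / (1 + x\<^sub>i x\<^sub>j)\<close> over non-edges.

  In logarithmic coordinates, \<open>g\<close> times the number of vertices at each scale is governed by a piecewise
  linear function whose values at vectors with entries in \<open>{-1, 0, 1}\<close> are the objective values of the optimization
  problem. If the trivial partition is the unique maximizer, that function decays linearly, so \<open>g\<close> is
  dominated by a product of functions of one variable, which gives the finiteness of \<open>A(H)\<close> and
  shows that vertices of degree far from \<open>sqrt n\<close> contribute negligibly. On degrees of order \<open>sqrt n\<close>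
  the sum converges to the integral by weak convergence (Skorohod representation), and the second
  moment method applies, because the pairs of tuples sharing a vertex are a vanishing fraction.\<close>

section \<open>Neighbourhoods and switchings\<close>

text \<open>Vertices of degree of order sqrt n are adjacent with probability bounded away from 0 and
  1, so no sparse approximation of edge probabilities is available; what a switching controls with
  small relative error is the odds. That error has to be small in every graph with the given
  degrees, even when u and v have degree 1. Trading only two edges fails here: undoing such a move
  needs non-adjacent neighbours of u and of v, and there may be none. The third edge {a, b} ranges
  over the whole graph, so for each choice of x and y nearly all of its positions are admissible.

  The one-sided estimates differ in range. Prescribed edges only lower the remaining degrees and
  hence the odds, so the upper bound on the probability of a copy holds for tuples of arbitrary
  degrees and can be used far from sqrt n; the lower bound needs large degrees and is used at order
  sqrt n only.

  The normalisation counts candidates: about n^((3 - \<tau>) / 2) vertices have degree of order sqrt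
  n, and a k-tuple of them is a copy with probability of constant order.\<close>

definition nbrs :: "'a set set \<Rightarrow> 'a \<Rightarrow> 'a set" where
  "nbrs G v = {w. {v, w} \<in> G}"

text \<open>Edges with an orientation: a switching has to know which end of a chosen edge is joined
  to u. Their number is the sum of the degrees, the same for all graphs under consideration.\<close>

definition darts :: "'a set set \<Rightarrow> ('a \<times> 'a) set" where
  "darts G = {(v, w). {v, w} \<in> G}"

lemma simple_graph_edgeD:
  assumes "simple_graph V G" "{v, w} \<in> G"
  shows "v \<in> V" "w \<in> V" "v \<noteq> w"
  using assms by (auto simp: simple_graph_def nsets_def)

lemma simple_graph_finite: "simple_graph V G \<Longrightarrow> finite G"
  by (meson simple_graph_def finite_imp_finite_nsets finite_subset)

lemma nbrs_subset: "simple_graph V G \<Longrightarrow> nbrs G v \<subseteq> V"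
  by (auto simp: nbrs_def dest: simple_graph_edgeD)

lemma finite_nbrs: "simple_graph V G \<Longrightarrow> finite (nbrs G v)"
  using nbrs_subset[of V G v] by (auto simp: simple_graph_def intro: finite_subset)

lemma card_nbrs:
  assumes "simple_graph V G"
  shows "card (nbrs G v) = degree_in G v"
proof -
  have "bij_betw (\<lambda>w. {v, w}) (nbrs G v) {e \<in> G. v \<in> e}"
    unfolding bij_betw_def
  proof
    show "inj_on (\<lambda>w. {v, w}) (nbrs G v)"
      by (auto simp: inj_on_def doubleton_eq_iff)
    show "(\<lambda>w. {v, w}) ` nbrs G v = {e \<in> G. v \<in> e}"
    proof (intro equalityI subsetI)
      fix e assume e: "e \<in> {e \<in> G. v \<in> e}"
      then have "e \<in> [V]\<^bsup>2\<^esup>" using assms by (auto simp: simple_graph_def)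
      then obtain x y where "e = {x, y}" by (auto simp: nsets_def card_2_iff)
      with e have "e = {v, x} \<or> e = {v, y}" by auto
      with e show "e \<in> (\<lambda>w. {v, w}) ` nbrs G v" by (auto simp: nbrs_def)
    qed (auto simp: nbrs_def)
  qed
  then show ?thesis unfolding degree_in_def by (rule bij_betw_same_card)
qed

lemma darts_Sigma:
  assumes "simple_graph V G"
  shows "darts G = Sigma V (nbrs G)"
  using assms by (auto simp: darts_def nbrs_def dest: simple_graph_edgeD)

lemma finite_darts: "simple_graph V G \<Longrightarrow> finite (darts G)"
  by (simp add: darts_Sigma finite_SigmaI finite_nbrs simple_graph_def)

lemma card_darts:
  assumes "simple_graph V G"
  shows "card (darts G) = (\<Sum>v\<in>V. degree_in G v)"
  using assms
  by (simp add: darts_Sigma card_nbrs[symmetric] finite_nbrs simple_graph_def)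

lemma card_darts_from:
  assumes "simple_graph V G" "finite Y"
  shows "card {p \<in> darts G. fst p \<in> Y} = (\<Sum>y\<in>Y. degree_in G y)"
proof -
  have "{p \<in> darts G. fst p \<in> Y} = Sigma Y (nbrs G)"
    by (auto simp: darts_def nbrs_def)
  then show ?thesis using assms by (simp add: card_nbrs[symmetric] finite_nbrs)
qed

lemma card_darts_to:
  assumes "simple_graph V G" "finite Y"
  shows "card {p \<in> darts G. snd p \<in> Y} = (\<Sum>y\<in>Y. degree_in G y)"
proof -
  have "{p \<in> darts G. snd p \<in> Y} = prod.swap ` {p \<in> darts G. fst p \<in> Y}"
    by (force simp: darts_def insert_commute image_iff)
  then have "card {p \<in> darts G. snd p \<in> Y} = card {p \<in> darts G. fst p \<in> Y}"
    by (simp add: card_image)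
  then show ?thesis using card_darts_from[OF assms] by simp
qed

lemma degree_in_exchange:
  assumes "finite G" "finite Q" "R \<subseteq> G" "Q \<inter> G = {}"
    and "(\<Sum>e\<in>R. of_bool (w \<in> e)) = (\<Sum>e\<in>Q. of_bool (w \<in> e) :: nat)"
  shows "degree_in ((G - R) \<union> Q) w = degree_in G w"
proof -
  have deg: "degree_in F w = (\<Sum>e\<in>F. of_bool (w \<in> e))" if "finite F" for F
    using that by (simp add: degree_in_def Int_def sum.If_cases of_bool_def)
  have "degree_in ((G - R) \<union> Q) w = (\<Sum>e\<in>(G - R) \<union> Q. of_bool (w \<in> e))"
    using assms by (intro deg) auto
  also have "\<dots> = (\<Sum>e\<in>G - R. of_bool (w \<in> e)) + (\<Sum>e\<in>R. of_bool (w \<in> e))"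
    unfolding assms(5) by (subst sum.union_disjoint) (use assms in auto)
  also have "\<dots> = (\<Sum>e\<in>G. of_bool (w \<in> e))"
    using sum.subset_diff[OF assms(3,1)] by metis
  also have "\<dots> = degree_in G w"
    using assms by (intro deg[symmetric])
  finally show ?thesis .
qed

section \<open>Switchings and their inverses\<close>

definition graphs_between :: "nat \<Rightarrow> (nat \<Rightarrow> nat) \<Rightarrow> nat set set \<Rightarrow> nat set set \<Rightarrow> nat set set set" where
  "graphs_between n d E F = {G \<in> graphs_with_degrees n d. E \<subseteq> G \<and> G \<inter> F = {}}"

lemma finite_graphs_with_degrees: "finite (graphs_with_degrees n d)"
proof (rule finite_subset)
  show "graphs_with_degrees n d \<subseteq> Pow ([{1..n}]\<^bsup>2\<^esup>)"
    by (auto simp: graphs_with_degrees_def simple_graph_def)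
qed (simp add: finite_imp_finite_nsets)

lemma finite_graphs_between [simp]: "finite (graphs_between n d E F)"
  by (simp add: graphs_between_def finite_graphs_with_degrees)

text \<open>A switching trades the edges \<open>{u, v}, {x, a}, {y, b}\<close> for \<open>{u, x}, {v, y}, {a, b}\<close>.
  The vertices \<open>x\<close> and \<open>y\<close> may coincide: otherwise pairs \<open>u, v\<close> of low degree whose neighbours are
  all common would admit no backward switching.\<close>

locale switching =
  fixes n :: nat and d :: "nat \<Rightarrow> nat" and E F :: "nat set set" and u v :: nat
  assumes uv: "u \<in> {1..n}" "v \<in> {1..n}" "u \<noteq> v" "{u, v} \<notin> E" "{u, v} \<notin> F"
begin

definition rem :: "(nat \<times> nat) \<times> (nat \<times> nat) \<Rightarrow> nat set set" where
  "rem = (\<lambda>((x, a), (y, b)). {{u, v}, {x, a}, {y, b}})"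

definition add :: "(nat \<times> nat) \<times> (nat \<times> nat) \<Rightarrow> nat set set" where
  "add = (\<lambda>((x, a), (y, b)). {{u, x}, {v, y}, {a, b}})"

definition apart :: "(nat \<times> nat) \<times> (nat \<times> nat) \<Rightarrow> bool" where
  "apart = (\<lambda>((x, a), (y, b)). x \<notin> {u, v} \<and> y \<notin> {u, v} \<and> a \<notin> {u, v, x, y, b} \<and> b \<notin> {u, v, x, y})"

definition forward :: "nat set set \<Rightarrow> ((nat \<times> nat) \<times> (nat \<times> nat)) set" where
  "forward G = {p. apart p \<and> rem p \<subseteq> G \<and> rem p \<inter> E = {} \<and> add p \<inter> (G \<union> F) = {}}"

definition backward :: "nat set set \<Rightarrow> ((nat \<times> nat) \<times> (nat \<times> nat)) set" where
  "backward G = {p. apart p \<and> add p \<subseteq> G \<and> add p \<inter> E = {} \<and> rem p \<inter> (G \<union> F) = {}}"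

abbreviation "with_uv \<equiv> graphs_between n d (insert {u, v} E) F"
abbreviation "without_uv \<equiv> graphs_between n d E (insert {u, v} F)"

text \<open>Both triples of pairs cover u, v, x, a, y, b once each. The pairs of a triple remain
  distinct even if x = y, because a \<noteq> b and u \<noteq> v, so no incidence is lost in passing
  to sets.\<close>

lemma rem_add_degree:
  assumes "apart p"
  shows "(\<Sum>e\<in>rem p. of_bool (w \<in> e)) = (\<Sum>e\<in>add p. of_bool (w \<in> e) :: nat)"
proof -
  obtain x a y b where p: "p = ((x, a), (y, b))" by (metis prod.collapse)
  have "(\<Sum>e\<in>rem p. of_bool (w \<in> e)) =
      (of_bool (w \<in> {u, v}) + of_bool (w \<in> {x, a}) + of_bool (w \<in> {y, b}) :: nat)"
    using assms uv(3) by (auto simp: p rem_def apart_def doubleton_eq_iff)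
  also have "\<dots> = of_bool (w \<in> {u, x}) + of_bool (w \<in> {v, y}) + of_bool (w \<in> {a, b})"
    using assms uv(3) by (auto simp: p apart_def)
  also have "\<dots> = (\<Sum>e\<in>add p. of_bool (w \<in> e))"
    using assms uv(3) by (auto simp: p add_def apart_def doubleton_eq_iff)
  finally show ?thesis .
qed

lemma rem_add_disjoint: "apart p \<Longrightarrow> rem p \<inter> add p = {}"
  using uv(3) by (auto simp: rem_def add_def apart_def doubleton_eq_iff split: prod.splits)

lemma add_nsets: "apart p \<Longrightarrow> rem p \<subseteq> [{1..n}]\<^bsup>2\<^esup> \<Longrightarrow> add p \<subseteq> [{1..n}]\<^bsup>2\<^esup>"
  by (auto simp: rem_def add_def apart_def split: prod.splits)

lemma rem_nsets: "apart p \<Longrightarrow> add p \<subseteq> [{1..n}]\<^bsup>2\<^esup> \<Longrightarrow> rem p \<subseteq> [{1..n}]\<^bsup>2\<^esup>"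
  using uv by (auto simp: rem_def add_def apart_def split: prod.splits)

lemma finite_rem [simp]: "finite (rem p)" and finite_add [simp]: "finite (add p)"
  by (auto simp: rem_def add_def split: prod.splits)

lemma uv_in_rem: "{u, v} \<in> rem p"
  by (auto simp: rem_def split: prod.splits)

lemma forward_switch:
  assumes G: "G \<in> with_uv" and p: "p \<in> forward G"
  shows "(G - rem p) \<union> add p \<in> without_uv" "p \<in> backward ((G - rem p) \<union> add p)"
    "(((G - rem p) \<union> add p) - add p) \<union> rem p = G"
proof -
  from G have sg: "simple_graph {1..n} G" and EF: "E \<subseteq> G" "G \<inter> F = {}" "{u, v} \<in> G"
    and deg: "\<And>i. i \<in> {1..n} \<Longrightarrow> degree_in G i = d i"
    by (auto simp: graphs_between_def graphs_with_degrees_def)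
  from p have ap: "apart p" and q: "rem p \<subseteq> G" "rem p \<inter> E = {}" "add p \<inter> (G \<union> F) = {}"
    by (auto simp: forward_def)
  note fG = simple_graph_finite[OF sg]
  have "add p \<subseteq> [{1..n}]\<^bsup>2\<^esup>" using add_nsets[OF ap] sg q by (auto simp: simple_graph_def)
  then have sg': "simple_graph {1..n} ((G - rem p) \<union> add p)"
    using sg by (auto simp: simple_graph_def)
  have "degree_in ((G - rem p) \<union> add p) i = degree_in G i" for i
    by (rule degree_in_exchange[OF fG _ q(1) _ rem_add_degree[OF ap]]) (use q in auto)
  then have deg': "degree_in ((G - rem p) \<union> add p) i = d i" if "i \<in> {1..n}" for i
    using deg that by simp
  show "(G - rem p) \<union> add p \<in> without_uv"
    using sg' deg' EF q uv_in_rem[of p] rem_add_disjoint[OF ap]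
    by (auto simp: graphs_between_def graphs_with_degrees_def)
  show "p \<in> backward ((G - rem p) \<union> add p)"
    using ap q EF rem_add_disjoint[OF ap] by (auto simp: backward_def)
  show "(((G - rem p) \<union> add p) - add p) \<union> rem p = G" using q by auto
qed

lemma backward_switch:
  assumes G: "G \<in> without_uv" and p: "p \<in> backward G"
  shows "(G - add p) \<union> rem p \<in> with_uv" "p \<in> forward ((G - add p) \<union> rem p)"
    "(((G - add p) \<union> rem p) - rem p) \<union> add p = G"
proof -
  from G have sg: "simple_graph {1..n} G" and EF: "E \<subseteq> G" "G \<inter> F = {}" "{u, v} \<notin> G"
    and deg: "\<And>i. i \<in> {1..n} \<Longrightarrow> degree_in G i = d i"
    by (auto simp: graphs_between_def graphs_with_degrees_def)
  from p have ap: "apart p" and q: "add p \<subseteq> G" "add p \<inter> E = {}" "rem p \<inter> (G \<union> F) = {}"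
    by (auto simp: backward_def)
  note fG = simple_graph_finite[OF sg]
  have "rem p \<subseteq> [{1..n}]\<^bsup>2\<^esup>" using rem_nsets[OF ap] sg q by (auto simp: simple_graph_def)
  then have sg': "simple_graph {1..n} ((G - add p) \<union> rem p)"
    using sg by (auto simp: simple_graph_def)
  have "degree_in ((G - add p) \<union> rem p) i = degree_in G i" for i
    by (rule degree_in_exchange[OF fG _ q(1) _ rem_add_degree[OF ap, symmetric]]) (use q in auto)
  then have deg': "degree_in ((G - add p) \<union> rem p) i = d i" if "i \<in> {1..n}" for i
    using deg that by simp
  show "(G - add p) \<union> rem p \<in> with_uv"
    using sg' deg' EF q uv_in_rem[of p] rem_add_disjoint[OF ap]
    by (auto simp: graphs_between_def graphs_with_degrees_def)
  have "rem p \<inter> E = {}" using q EF by auto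
  then show "p \<in> forward ((G - add p) \<union> rem p)"
    using ap q EF rem_add_disjoint[OF ap] by (auto simp: forward_def)
  show "(((G - add p) \<union> rem p) - rem p) \<union> add p = G" using q by auto
qed

text \<open>A move and its inverse carry the same label p, so pairs (graph, label) can be counted
  from either side.\<close>

lemma card_switchings:
  "card (Sigma with_uv forward) = card (Sigma without_uv backward)"
proof (rule bij_betw_same_card)
  show "bij_betw (\<lambda>(G, p). ((G - rem p) \<union> add p, p)) (Sigma with_uv forward) (Sigma without_uv backward)"
    by (rule bij_betw_byWitness[where f' = "\<lambda>(G, p). ((G - add p) \<union> rem p, p)"])
      (auto simp: forward_switch backward_switch)
qed

end

lemma graphs_with_degreesD:
  assumes "G \<in> graphs_with_degrees n d"
  shows "simple_graph {1..n} G" "i \<in> {1..n} \<Longrightarrow> degree_in G i = d i"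
  using assms by (auto simp: graphs_with_degrees_def)

lemma card_darts_total:
  assumes "G \<in> graphs_with_degrees n d"
  shows "card (darts G) = total_degree n d"
  using card_darts[OF graphs_with_degreesD(1)[OF assms]] graphs_with_degreesD(2)[OF assms]
  by (simp add: total_degree_def)

text \<open>The bound \<open>S\<close> on the number of paths of length two from a vertex controls all choices that
  invalidate a switching.\<close>

locale two_path_bound =
  fixes n :: nat and d :: "nat \<Rightarrow> nat" and \<Delta> S :: nat
  assumes d_le: "\<And>i. i \<in> {1..n} \<Longrightarrow> d i \<le> \<Delta>"
    and two_paths: "\<And>G w. G \<in> graphs_with_degrees n d \<Longrightarrow> (\<Sum>x\<in>nbrs G w. d x) \<le> S"
begin

lemma sum_degree_in_le:
  assumes G: "G \<in> graphs_with_degrees n d" and "finite W"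
  shows "(\<Sum>y\<in>nbrs G w \<union> W. degree_in G y) \<le> S + card W * \<Delta>"
proof -
  note sg = graphs_with_degreesD(1)[OF G]
  have deg: "degree_in G y \<le> \<Delta>" for y
  proof (cases "y \<in> {1..n}")
    case True then show ?thesis using d_le graphs_with_degreesD(2)[OF G] by simp
  next
    case False
    then have "nbrs G y = {}" using sg by (auto simp: nbrs_def dest: simple_graph_edgeD)
    then show ?thesis using card_nbrs[OF sg, of y] by simp
  qed
  have "(\<Sum>y\<in>nbrs G w \<union> W. degree_in G y) \<le> (\<Sum>y\<in>nbrs G w. degree_in G y) + (\<Sum>y\<in>W. degree_in G y)"
    using sum.union_inter[OF finite_nbrs[OF sg, of w] assms(2), of "degree_in G"] by linarith
  also have "(\<Sum>y\<in>nbrs G w. degree_in G y) = (\<Sum>y\<in>nbrs G w. d y)"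
    using nbrs_subset[OF sg, of w] graphs_with_degreesD(2)[OF G] by (intro sum.cong) auto
  also have "\<dots> \<le> S" by (rule two_paths[OF G])
  also have "(\<Sum>y\<in>W. degree_in G y) \<le> card W * \<Delta>"
    using sum_bounded_above[of W "degree_in G" \<Delta>] deg by simp
  finally show ?thesis by simp
qed

lemma card_bad_darts:
  assumes G: "G \<in> graphs_with_degrees n d" and "finite W"
  shows "card {p \<in> darts G. fst p \<in> nbrs G w \<union> W \<or> snd p \<in> nbrs G w' \<union> W} \<le> 2 * S + 2 * card W * \<Delta>"
proof -
  note sg = graphs_with_degreesD(1)[OF G]
  have "{p \<in> darts G. fst p \<in> nbrs G w \<union> W \<or> snd p \<in> nbrs G w' \<union> W} =
      {p \<in> darts G. fst p \<in> nbrs G w \<union> W} \<union> {p \<in> darts G. snd p \<in> nbrs G w' \<union> W}" by auto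
  then have "card {p \<in> darts G. fst p \<in> nbrs G w \<union> W \<or> snd p \<in> nbrs G w' \<union> W} \<le>
      card {p \<in> darts G. fst p \<in> nbrs G w \<union> W} + card {p \<in> darts G. snd p \<in> nbrs G w' \<union> W}"
    by (simp add: card_Un_le)
  also have "\<dots> = (\<Sum>y\<in>nbrs G w \<union> W. degree_in G y) + (\<Sum>y\<in>nbrs G w' \<union> W. degree_in G y)"
    by (subst card_darts_from[OF sg], use assms(2) finite_nbrs[OF sg] in simp,
        subst card_darts_to[OF sg], use assms(2) finite_nbrs[OF sg] in auto)
  also have "\<dots> \<le> (S + card W * \<Delta>) + (S + card W * \<Delta>)"
    by (intro add_mono sum_degree_in_le assms)
  finally show ?thesis by simp
qed

lemma card_good_darts:
  assumes G: "G \<in> graphs_with_degrees n d" and "finite W" "card W \<le> q"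
  shows "real (total_degree n d) - real (2 * S + 2 * q * \<Delta>)
    \<le> real (card (darts G - {p \<in> darts G. fst p \<in> nbrs G w \<union> W \<or> snd p \<in> nbrs G w' \<union> W}))"
proof -
  let ?Z = "{p \<in> darts G. fst p \<in> nbrs G w \<union> W \<or> snd p \<in> nbrs G w' \<union> W}"
  have f: "finite (darts G)" by (rule finite_darts[OF graphs_with_degreesD(1)[OF G]])
  have "card (darts G - ?Z) = card (darts G) - card ?Z" by (rule card_Diff_subset) (use f in auto)
  moreover have "card ?Z \<le> 2 * S + 2 * card W * \<Delta>" by (rule card_bad_darts[OF G assms(2)])
  moreover have "2 * card W * \<Delta> \<le> 2 * q * \<Delta>" using assms(3) by simp
  ultimately show ?thesis unfolding card_darts_total[OF G] by linarith
qed

end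

section \<open>Counting the admissible switchings\<close>

lemma card_Union_pairs:
  assumes "E \<subseteq> [V]\<^bsup>2\<^esup>" "card E \<le> m" "finite E"
  shows "card (\<Union>E) \<le> 2 * m" "finite (\<Union>E)"
proof -
  have "card (\<Union>E) \<le> (\<Sum>e\<in>E. card e)" by (rule card_Union_le_sum_card)
  also have "\<dots> = (\<Sum>e\<in>E. 2)" using assms(1) by (intro sum.cong) (auto simp: nsets_def)
  finally show "card (\<Union>E) \<le> 2 * m" using assms(2) by simp
  show "finite (\<Union>E)" using assms by (auto simp: nsets_def)
qed

lemma card_Sigma_ge:
  assumes "finite A" "\<And>a. a \<in> A \<Longrightarrow> finite (B a)" "\<And>a. a \<in> A \<Longrightarrow> c \<le> real (card (B a))"
  shows "real (card A) * c \<le> real (card (Sigma A B))"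
proof -
  have "real (card A) * c = (\<Sum>a\<in>A. c)" by simp
  also have "\<dots> \<le> (\<Sum>a\<in>A. real (card (B a)))" by (intro sum_mono assms(3))
  also have "\<dots> = real (card (Sigma A B))" using assms by simp
  finally show ?thesis .
qed

lemma card_Sigma_le:
  assumes "finite A" "\<And>a. a \<in> A \<Longrightarrow> finite (B a)" "\<And>a. a \<in> A \<Longrightarrow> real (card (B a)) \<le> c"
  shows "real (card (Sigma A B)) \<le> real (card A) * c"
proof -
  have "real (card (Sigma A B)) = (\<Sum>a\<in>A. real (card (B a)))" using assms by simp
  also have "\<dots> \<le> (\<Sum>a\<in>A. c)" by (intro sum_mono assms(3))
  finally show ?thesis by simp
qed

locale bounded_switching = switching n d E F u v + two_path_bound n d \<Delta> S
  for n d E F u v \<Delta> S +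
  fixes m :: nat
  assumes EF: "E \<subseteq> [{1..n}]\<^bsup>2\<^esup>" "F \<subseteq> [{1..n}]\<^bsup>2\<^esup>" "card E \<le> m" "card F \<le> m"
begin

abbreviation "L \<equiv> total_degree n d"
text \<open>One S for darts that start next to a given vertex, one for darts that end next to
  another. The number 4 + 4 * m bounds the vertices to be avoided at either end: u, v, two vertices
  already chosen, and the ends of at most m pairs in each of E and F.\<close>

definition loss :: nat where "loss = 2 * S + 2 * (4 + 4 * m) * \<Delta>"
text \<open>A pair with an end outside \<open>W\<close> lies in neither E nor F.\<close>

definition "W = {u, v} \<union> \<Union>E \<union> \<Union>F"

lemma finite_EF: "finite E" "finite F"
  using EF by (auto intro: finite_subset simp: finite_imp_finite_nsets)

lemma W: "finite W" "card (W \<union> {x, y}) \<le> 4 + 4 * m" "finite (W \<union> {x, y})"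
proof -
  note a = card_Union_pairs[OF EF(1,3) finite_EF(1)] card_Union_pairs[OF EF(2,4) finite_EF(2)]
  show "finite W" "finite (W \<union> {x, y})" using a by (auto simp: W_def)
  have "card (W \<union> {x, y}) \<le> card W + card {x, y}" by (rule card_Un_le)
  also have "card W \<le> card ({u, v} \<union> \<Union>E) + card (\<Union>F)" unfolding W_def by (rule card_Un_le)
  also have "card ({u, v} \<union> \<Union>E) \<le> card {u, v} + card (\<Union>E)" by (rule card_Un_le)
  also have "card {u, v} = 2" using uv by simp
  finally show "card (W \<union> {x, y}) \<le> 4 + 4 * m"
    using a card_insert_le_m1[of 2 "{y}" x] by auto
qed

lemma forward_le:
  assumes "G \<in> with_uv" shows "finite (forward G)" "real (card (forward G)) \<le> real L * real L"
proof -
  from assms have G: "G \<in> graphs_with_degrees n d" by (simp add: graphs_between_def)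
  note f = finite_darts[OF graphs_with_degreesD(1)[OF G]]
  have sub: "forward G \<subseteq> darts G \<times> darts G"
    by (auto simp: forward_def rem_def darts_def)
  then show "finite (forward G)" by (rule finite_subset) (use f in simp)
  have "card (forward G) \<le> card (darts G \<times> darts G)" by (rule card_mono[OF _ sub]) (use f in simp)
  then show "real (card (forward G)) \<le> real L * real L"
    by (simp add: card_cartesian_product card_darts_total[OF G] flip: of_nat_mult)
qed

lemma forward_ge:
  assumes "G \<in> with_uv" shows "real L * (real L - 2 * real loss) \<le> real (card (forward G))"
proof (cases "2 * loss \<le> L")
  case True
  from assms have G: "G \<in> graphs_with_degrees n d" and GEF: "{u, v} \<in> G" "E \<subseteq> G" "G \<inter> F = {}"
    by (auto simp: graphs_between_def)
  note sg = graphs_with_degreesD(1)[OF G]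
  note f = finite_darts[OF sg]
  \<comment> \<open>With x not adjacent to u, y not adjacent to v and b not adjacent to a, the three
    pairs to be added are new. Excluding y = x costs O(\<Delta>) choices out of L here, which is
    affordable in this direction.\<close>
  define D1 where "D1 = darts G - {p \<in> darts G. fst p \<in> nbrs G u \<union> W \<or> snd p \<in> nbrs G v \<union> W}"
  define D2 where "D2 = (\<lambda>p. darts G - {q \<in> darts G. fst q \<in> nbrs G v \<union> (W \<union> {fst p, snd p})
      \<or> snd q \<in> nbrs G (snd p) \<union> (W \<union> {fst p, snd p})})"
  have fD: "finite D1" "finite (D2 p)" for p using f by (auto simp: D1_def D2_def)
  have cW: "card W \<le> 4 + 4 * m" using W(2)[of u v] by (simp add: W_def insert_absorb)
  have c1: "real L - real loss \<le> real (card D1)"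
    unfolding D1_def loss_def by (rule card_good_darts[OF G W(1) cW])
  have c2: "real L - real loss \<le> real (card (D2 p))" for p
    unfolding D2_def loss_def by (rule card_good_darts[OF G W(3,2)])
  have sub: "Sigma D1 D2 \<subseteq> forward G"
  proof
    fix p assume "p \<in> Sigma D1 D2"
    then obtain x a y b where p: "p = ((x, a), (y, b))" "(x, a) \<in> D1" "(y, b) \<in> D2 (x, a)"
      by (metis SigmaE prod.collapse)
    then have e: "{x, a} \<in> G" "{y, b} \<in> G" by (auto simp: D1_def D2_def darts_def)
    then have "x \<noteq> a" "y \<noteq> b" using simple_graph_edgeD(3)[OF sg] by auto
    with p e GEF uv show "p \<in> forward G"
      by (auto simp: forward_def D1_def D2_def apart_def rem_def add_def nbrs_def W_def darts_def
          insert_commute)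
  qed
  have "real L * (real L - 2 * real loss) \<le> (real L - real loss) * (real L - real loss)"
    by (simp add: algebra_simps)
  also have "\<dots> \<le> real (card D1) * (real L - real loss)"
    using True by (intro mult_right_mono c1) auto
  also have "\<dots> \<le> real (card (Sigma D1 D2))" by (intro card_Sigma_ge fD c2)
  also have "\<dots> \<le> real (card (forward G))"
    using card_mono[OF forward_le(1)[OF assms] sub] by simp
  finally show ?thesis .
next
  case False
  then have "real L * (real L - 2 * real loss) \<le> 0"
    by (intro mult_nonneg_nonpos) auto
  then show ?thesis by linarith
qed

text \<open>The number of choices of (x, y) in a backward switching: {u, x} and {v, y} get deleted,
  so they must not be prescribed edges.\<close>

definition "back_weight = real (d u - degree_in E u) * real (d v - degree_in E v)"

lemma free_nbrs:
  assumes "G \<in> without_uv" "w \<in> {1..n}"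
  shows "card (nbrs G w - nbrs E w) = d w - degree_in E w" "finite (nbrs G w - nbrs E w)"
proof -
  from assms have G: "G \<in> graphs_with_degrees n d" and "E \<subseteq> G" by (auto simp: graphs_between_def)
  note sg = graphs_with_degreesD(1)[OF G]
  have sE: "simple_graph {1..n} E" using EF by (simp add: simple_graph_def)
  have "nbrs E w \<subseteq> nbrs G w" using \<open>E \<subseteq> G\<close> by (auto simp: nbrs_def)
  then have "card (nbrs G w - nbrs E w) = card (nbrs G w) - card (nbrs E w)"
    by (intro card_Diff_subset finite_nbrs[OF sE])
  then show "card (nbrs G w - nbrs E w) = d w - degree_in E w"
    using graphs_with_degreesD(2)[OF G assms(2)] by (simp add: card_nbrs[OF sg] card_nbrs[OF sE])
  show "finite (nbrs G w - nbrs E w)" using finite_nbrs[OF sg] by simp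
qed

definition regroup :: "(nat \<times> nat) \<times> (nat \<times> nat) \<Rightarrow> (nat \<times> nat) \<times> (nat \<times> nat)" where
  "regroup = (\<lambda>((x, y), (a, b)). ((x, a), (y, b)))"

lemma inj_regroup: "inj_on regroup A"
  by (auto simp: inj_on_def regroup_def)

lemma backward_le:
  assumes "G \<in> without_uv"
  shows "finite (backward G)" "real (card (backward G)) \<le> back_weight * real L"
proof -
  from assms have G: "G \<in> graphs_with_degrees n d" by (simp add: graphs_between_def)
  let ?X = "((nbrs G u - nbrs E u) \<times> (nbrs G v - nbrs E v)) \<times> darts G"
  have f: "finite ?X"
    using finite_darts[OF graphs_with_degreesD(1)[OF G]] free_nbrs(2)[OF assms] uv by blast
  have sub: "backward G \<subseteq> regroup ` ?X"
  proof
    fix p assume p: "p \<in> backward G"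
    obtain x a y b where "p = ((x, a), (y, b))" by (metis prod.collapse)
    with p have "p = regroup ((x, y), (a, b))" "((x, y), (a, b)) \<in> ?X"
      by (auto simp: backward_def add_def darts_def nbrs_def regroup_def)
    then show "p \<in> regroup ` ?X" by blast
  qed
  show "finite (backward G)" by (rule finite_subset[OF sub]) (use f in blast)
  have "card (backward G) \<le> card (regroup ` ?X)" by (rule card_mono[OF _ sub]) (use f in blast)
  also have "\<dots> = card ?X" by (rule card_image[OF inj_regroup])
  also have "\<dots> = (d u - degree_in E u) * (d v - degree_in E v) * L"
    using uv by (simp only: card_cartesian_product card_darts_total[OF G] free_nbrs(1)[OF assms])
  finally show "real (card (backward G)) \<le> back_weight * real L"
    unfolding back_weight_def by (metis of_nat_mult of_nat_le_iff)
qed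

lemma backward_ge:
  assumes "G \<in> without_uv"
  shows "back_weight * (real L - real loss) \<le> real (card (backward G))"
proof -
  from assms have G: "G \<in> graphs_with_degrees n d" and GEF: "{u, v} \<notin> G" "E \<subseteq> G" "G \<inter> F = {}"
    by (auto simp: graphs_between_def)
  note sg = graphs_with_degreesD(1)[OF G]
  note f = finite_darts[OF sg]
  define D where "D = (\<lambda>p. darts G - {q \<in> darts G. fst q \<in> nbrs G (fst p) \<union> (W \<union> {fst p, snd p})
      \<or> snd q \<in> nbrs G (snd p) \<union> (W \<union> {fst p, snd p})})"
  let ?X = "(nbrs G u - nbrs E u) \<times> (nbrs G v - nbrs E v)"
  have fD: "finite (D p)" for p using f by (auto simp: D_def)
  have fX: "finite ?X" using free_nbrs(2)[OF assms] uv by blast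
  have c: "real L - real loss \<le> real (card (D p))" for p
    unfolding D_def loss_def by (rule card_good_darts[OF G W(3,2)])
  have sub: "regroup ` Sigma ?X D \<subseteq> backward G"
  proof
    fix p assume "p \<in> regroup ` Sigma ?X D"
    then obtain x y a b where p: "p = ((x, a), (y, b))" "(x, y) \<in> ?X" "(a, b) \<in> D (x, y)"
      by (auto simp: regroup_def)
    then have e: "{u, x} \<in> G" "{v, y} \<in> G" "{a, b} \<in> G" by (auto simp: D_def darts_def nbrs_def)
    then have "u \<noteq> x" "v \<noteq> y" "a \<noteq> b" using simple_graph_edgeD(3)[OF sg] by auto
    moreover have "x \<noteq> v" "y \<noteq> u" using e GEF by (auto simp: insert_commute)
    ultimately show "p \<in> backward G" using p e GEF uv
      by (auto simp: backward_def D_def apart_def rem_def add_def nbrs_def W_def darts_def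
          insert_commute)
  qed
  have "back_weight * (real L - real loss) = real (card ?X) * (real L - real loss)"
    using uv by (simp add: back_weight_def card_cartesian_product free_nbrs(1)[OF assms])
  also have "\<dots> \<le> real (card (Sigma ?X D))" by (intro card_Sigma_ge fD fX c)
  also have "\<dots> = real (card (regroup ` Sigma ?X D))" by (simp add: card_image[OF inj_regroup])
  also have "\<dots> \<le> real (card (backward G))"
    using card_mono[OF backward_le(1)[OF assms] sub] by simp
  finally show ?thesis .
qed

text \<open>Double counting. Each graph with {u, v} has about L * L forward moves, each graph
  without it about \<open>back_weight * L\<close> backward moves, so the odds of {u, v} are close to
  \<open>back_weight / L\<close>.\<close>

lemma switching_bounds:
  "real (card with_uv) * real L * (real L - 2 * real loss) \<le> real (card without_uv) * back_weight * real L"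
  "real (card without_uv) * back_weight * (real L - 2 * real loss) \<le> real (card with_uv) * real L * real L"
proof -
  let ?f = "real (card (Sigma with_uv forward))" and ?b = "real (card (Sigma without_uv backward))"
  have fb: "?f = ?b" by (simp add: card_switchings)
  have "real (card with_uv) * (real L * (real L - 2 * real loss)) \<le> ?f"
    by (intro card_Sigma_ge forward_ge forward_le) auto
  also note fb
  also have "?b \<le> real (card without_uv) * (back_weight * real L)"
    by (intro card_Sigma_le backward_le) auto
  finally show "real (card with_uv) * real L * (real L - 2 * real loss) \<le> real (card without_uv) * back_weight * real L"
    by (simp add: mult.assoc)
  have "back_weight * (real L - 2 * real loss) \<le> back_weight * (real L - real loss)"
    by (rule mult_left_mono) (simp_all add: back_weight_def)
  then have "real (card without_uv) * (back_weight * (real L - 2 * real loss)) \<le>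
      real (card without_uv) * (back_weight * (real L - real loss))"
    by (rule mult_left_mono) simp
  also have "\<dots> \<le> ?b"
    by (intro card_Sigma_ge backward_ge backward_le) auto
  also note fb[symmetric]
  also have "?f \<le> real (card with_uv) * (real L * real L)"
    by (intro card_Sigma_le forward_le) auto
  finally show "real (card without_uv) * back_weight * (real L - 2 * real loss) \<le> real (card with_uv) * real L * real L"
    by (simp add: mult.assoc)
qed

end

section \<open>Connection probabilities\<close>

definition edge_weight :: "(nat \<Rightarrow> real) \<Rightarrow> nat set \<Rightarrow> real" where
  "edge_weight x e = (\<Prod>i\<in>e. x i)"

definition profile :: "(nat \<Rightarrow> real) \<Rightarrow> nat set set \<Rightarrow> nat set set \<Rightarrow> real" where
  "profile x E F = (\<Prod>e\<in>E. edge_weight x e / (1 + edge_weight x e)) * (\<Prod>e\<in>F. 1 / (1 + edge_weight x e))"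

definition scaled_degree :: "nat \<Rightarrow> (nat \<Rightarrow> nat) \<Rightarrow> nat \<Rightarrow> real" where
  "scaled_degree n d i = real (d i) / sqrt (real (total_degree n d))"

text \<open>Since \<open>d\<^sub>u d\<^sub>v / L = x\<^sub>u x\<^sub>v\<close> for scaled degrees \<open>x\<close>, the limiting probability that a set of
  pairs \<open>E\<close> is present and a set \<open>F\<close> absent is a function \<open>profile x E F\<close> that does not involve \<open>n\<close>.\<close>

lemma edge_weight_nonneg: "(\<And>i. 0 \<le> x i) \<Longrightarrow> 0 \<le> edge_weight x e"
  by (simp add: edge_weight_def prod_nonneg)

lemma profile_nonneg: "(\<And>i. 0 \<le> x i) \<Longrightarrow> 0 \<le> profile x E F"
  by (auto simp: profile_def intro!: mult_nonneg_nonneg prod_nonneg divide_nonneg_nonneg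
      add_nonneg_nonneg edge_weight_nonneg)

lemma scaled_degree_nonneg [simp]: "0 \<le> scaled_degree n d i"
  by (simp add: scaled_degree_def)

lemma edge_weight_scaled_degree:
  assumes "u \<noteq> v"
  shows "edge_weight (scaled_degree n d) {u, v} = real (d u) * real (d v) / real (total_degree n d)"
  using assms by (simp add: edge_weight_def scaled_degree_def)

text \<open>A and B count the graphs with and without the pair, r is the odds computed from full
  degrees and r' from reduced ones. Since r' \<le> r, presence is bounded above and absence below
  without correction; bounding presence below costs the factor \<theta>, and bounding absence above
  is done for r' = r.\<close>

lemma switching_ratio_bounds:
  fixes A B r r' \<delta> \<theta> :: real
  assumes nn: "0 \<le> A" "0 \<le> B" "0 \<le> r'" "r' \<le> r" "0 \<le> \<delta>" "\<delta> < 1" "0 \<le> \<theta>" "\<theta> \<le> 1"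
    and up: "A * (1 - \<delta>) \<le> B * r'" and lo: "B * r' * (1 - \<delta>) \<le> A"
    and th: "\<theta> * r \<le> r'"
  shows "(1 - \<delta>) * A \<le> r / (1 + r) * (A + B)"
    and "(1 - \<delta>) * \<theta> * (r / (1 + r)) * (A + B) \<le> A"
    and "(1 - \<delta>) * (1 / (1 + r)) * (A + B) \<le> B"
    and "r' = r \<Longrightarrow> (1 - \<delta>) * B \<le> 1 / (1 + r) * (A + B)"
proof -
  have r: "0 \<le> r" using nn by linarith
  have Br: "B * r' \<le> B * r" using nn by (intro mult_left_mono)
  have dA: "(1 - \<delta>) * A \<le> A" using nn by (intro mult_left_le_one_le) auto
  have rdA: "r * ((1 - \<delta>) * A) \<le> r * A" by (rule mult_left_mono[OF dA r])
  have "(1 - \<delta>) * A * (1 + r) \<le> r * (A + B)"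
    using up Br rdA by (simp add: algebra_simps)
  then show "(1 - \<delta>) * A \<le> r / (1 + r) * (A + B)" using r by (simp add: field_simps)
  have "(1 - \<delta>) * (\<theta> * r * B) \<le> (1 - \<delta>) * (r' * B)"
    using nn th by (intro mult_left_mono mult_right_mono) auto
  also have "\<dots> \<le> A" using lo by (simp add: mult_ac)
  finally have 1: "(1 - \<delta>) * (\<theta> * r * B) \<le> A" .
  have "(1 - \<delta>) * \<theta> \<le> 1" using nn by (intro mult_le_one) auto
  then have 2: "(1 - \<delta>) * \<theta> * (r * A) \<le> r * A" using r nn by (intro mult_left_le_one_le) auto
  have "(1 - \<delta>) * \<theta> * r * (A + B) \<le> A * (1 + r)" using 1 2 by (simp add: algebra_simps)
  then show "(1 - \<delta>) * \<theta> * (r / (1 + r)) * (A + B) \<le> A" using r by (simp add: field_simps)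
  have dB: "(1 - \<delta>) * B \<le> B" using nn by (intro mult_left_le_one_le) auto
  have "(1 - \<delta>) * (A + B) \<le> B * (1 + r)" using up Br dB by (simp add: algebra_simps)
  then show "(1 - \<delta>) * (1 / (1 + r)) * (A + B) \<le> B" using r by (simp add: field_simps)
  assume "r' = r"
  have "(1 - \<delta>) * B * (1 + r) \<le> A + B" using lo dB \<open>r' = r\<close> by (simp add: algebra_simps)
  then show "(1 - \<delta>) * B \<le> 1 / (1 + r) * (A + B)" using r by (simp add: field_simps)
qed

lemma degree_in_empty [simp]: "degree_in {} v = 0"
  by (simp add: degree_in_def)

lemma degree_in_le_card: "finite E \<Longrightarrow> degree_in E v \<le> card E"
  unfolding degree_in_def by (rule card_mono) auto

context bounded_switching
begin

lemma card_split: "card (graphs_between n d E F) = card with_uv + card without_uv"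
proof -
  have "graphs_between n d E F = with_uv \<union> without_uv" by (auto simp: graphs_between_def)
  moreover have "with_uv \<inter> without_uv = {}" by (auto simp: graphs_between_def)
  ultimately show ?thesis by (simp add: card_Un_disjoint)
qed

lemma step_bounds:
  assumes L: "0 < L" and del: "2 * real loss \<le> \<delta> * real L" "0 \<le> \<delta>" "\<delta> < 1"
  defines "w \<equiv> edge_weight (scaled_degree n d) {u, v}"
  shows "(1 - \<delta>) * real (card with_uv) \<le> w / (1 + w) * real (card (graphs_between n d E F))"
    and "(1 - \<delta>) * (1 / (1 + w)) * real (card (graphs_between n d E F)) \<le> real (card without_uv)"
    and "E = {} \<Longrightarrow> (1 - \<delta>) * real (card without_uv) \<le> 1 / (1 + w) * real (card (graphs_between n d E F))"
    and "\<lbrakk>0 \<le> \<eta>; \<eta> \<le> 1; real m \<le> \<eta> * real (d u); real m \<le> \<eta> * real (d v)\<rbrakk> \<Longrightarrow>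
      (1 - \<eta>)\<^sup>2 * (1 - \<delta>) * (w / (1 + w)) * real (card (graphs_between n d E F)) \<le> real (card with_uv)"
proof -
  let ?A = "real (card with_uv)" and ?B = "real (card without_uv)"
  define r' where "r' = back_weight / real L"
  have w: "w = real (d u) * real (d v) / real L"
    unfolding w_def by (rule edge_weight_scaled_degree[OF uv(3)])
  have Lpos: "0 < real L" using L by simp
  have bw: "0 \<le> back_weight" "back_weight \<le> real (d u) * real (d v)"
    by (auto simp: back_weight_def intro!: mult_mono)
  have r': "0 \<le> r'" "r' \<le> w" using bw Lpos by (auto simp: r'_def w intro!: divide_right_mono)
  have del': "real L * (1 - \<delta>) \<le> real L - 2 * real loss" using del by (simp add: algebra_simps)
  have "?A * (real L * (1 - \<delta>)) \<le> ?A * (real L - 2 * real loss)"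
    using del' by (intro mult_left_mono) auto
  also have "\<dots> \<le> ?B * back_weight"
    using switching_bounds(1) Lpos by (simp add: mult_ac)
  finally have up: "?A * (1 - \<delta>) \<le> ?B * r'" using Lpos by (simp add: r'_def field_simps)
  have "?B * back_weight * (real L * (1 - \<delta>)) \<le> ?B * back_weight * (real L - 2 * real loss)"
    using del' bw by (intro mult_left_mono) auto
  also note switching_bounds(2)
  finally have "(?B * r' * (1 - \<delta>)) * (real L * real L) \<le> ?A * (real L * real L)"
    using Lpos by (simp add: r'_def mult_ac)
  then have lo: "?B * r' * (1 - \<delta>) \<le> ?A" by (rule mult_right_le_imp_le) (use Lpos in simp)
  have G: "real (card (graphs_between n d E F)) = ?A + ?B" by (simp add: card_split)
  note B0 = switching_ratio_bounds[OF _ _ r' del(2,3) _ _ up lo]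
  \<comment> \<open>With \<theta> = 0 the hypothesis \<theta> * r \<le> r' is just the nonnegativity
    of r'.\<close>
  show "(1 - \<delta>) * ?A \<le> w / (1 + w) * real (card (graphs_between n d E F))"
    unfolding G by (rule B0(1)[of 0]) (use r' in auto)
  show "(1 - \<delta>) * (1 / (1 + w)) * real (card (graphs_between n d E F)) \<le> ?B"
    unfolding G by (rule B0(3)[of 0]) (use r' in auto)
  show "(1 - \<delta>) * ?B \<le> 1 / (1 + w) * real (card (graphs_between n d E F))" if "E = {}"
  proof -
    have "r' = w" unfolding r'_def w back_weight_def using that by simp
    then show ?thesis unfolding G by (intro B0(4)[of 0]) (use r' in auto)
  qed
  assume \<eta>: "0 \<le> \<eta>" "\<eta> \<le> 1" "real m \<le> \<eta> * real (d u)" "real m \<le> \<eta> * real (d v)"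
  \<comment> \<open>At most m edges at i are prescribed, a fraction at most \<eta> of its degree;
    two such factors give \<theta> = (1 - \<eta>)^2.\<close>
  have free: "(1 - \<eta>) * real (d i) \<le> real (d i - degree_in E i)" if "real m \<le> \<eta> * real (d i)" for i
  proof -
    have "degree_in E i \<le> m" using degree_in_le_card[OF finite_EF(1), of i] EF(3) by linarith
    then have "real (d i) - real m \<le> real (d i - degree_in E i)" by linarith
    with that show ?thesis by (simp add: algebra_simps)
  qed
  have "((1 - \<eta>) * real (d u)) * ((1 - \<eta>) * real (d v)) \<le> back_weight"
    unfolding back_weight_def using \<eta> by (intro mult_mono free) auto
  then have "((1 - \<eta>) * real (d u)) * ((1 - \<eta>) * real (d v)) / real L \<le> r'"
    unfolding r'_def by (rule divide_right_mono) simp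
  then have "(1 - \<eta>)\<^sup>2 * w \<le> r'"
    by (simp add: w power2_eq_square mult_ac)
  then have "(1 - \<delta>) * (1 - \<eta>)\<^sup>2 * (w / (1 + w)) * (?A + ?B) \<le> ?A"
    using \<eta> by (intro B0(2)) (auto simp: power_le_one)
  then show "(1 - \<eta>)\<^sup>2 * (1 - \<delta>) * (w / (1 + w)) * real (card (graphs_between n d E F)) \<le> ?A"
    unfolding G by (simp add: mult_ac)
qed

end

context two_path_bound
begin

text \<open>The chain rule for conditional probabilities: pairs are exposed one at a time, each
  multiplies by its limiting conditional probability and costs a factor 1 - \<delta>. There are at
  most m pairs of either kind, hence the exponent 2 * m; in the lower bound each edge costs a
  further (1 - \<eta>)^2.\<close>

lemma graphs_between_bounds:
  assumes L: "0 < total_degree n d"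
    and del: "2 * real (2 * S + 2 * (4 + 4 * m) * \<Delta>) \<le> \<delta> * real (total_degree n d)" "0 \<le> \<delta>" "\<delta> < 1"
    and sub: "E \<subseteq> [{1..n}]\<^bsup>2\<^esup>" "F \<subseteq> [{1..n}]\<^bsup>2\<^esup>" "E \<inter> F = {}" "card E \<le> m" "card F \<le> m"
  defines "X \<equiv> scaled_degree n d"
  defines "N \<equiv> real (card (graphs_with_degrees n d))"
  shows "(1 - \<delta>) ^ (2 * m) * real (card (graphs_between n d E F)) \<le> profile X E F * N" (is ?up)
    and "\<lbrakk>0 \<le> \<eta>; \<eta> \<le> 1; \<And>i. i \<in> \<Union>E \<Longrightarrow> real m \<le> \<eta> * real (d i)\<rbrakk> \<Longrightarrow>
      (1 - \<delta>) ^ (2 * m) * (1 - \<eta>) ^ (2 * m) * (profile X E F * N) \<le> real (card (graphs_between n d E F))"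
proof -
  have fin: "finite E" "finite F"
    using sub by (auto intro: finite_subset simp: finite_imp_finite_nsets)
  have d01: "0 \<le> 1 - \<delta>" "1 - \<delta> \<le> 1" using del by auto
  have wn: "0 \<le> edge_weight X e" for e by (simp add: X_def edge_weight_nonneg)
  have pn: "0 \<le> profile X A B" for A B by (simp add: X_def profile_nonneg)
  define gb where "gb = (\<lambda>A B. real (card (graphs_between n d A B)))"
  have step: "bounded_switching n d A B u v \<Delta> S m"
    if "A \<subseteq> [{1..n}]\<^bsup>2\<^esup>" "B \<subseteq> [{1..n}]\<^bsup>2\<^esup>" "card A \<le> m" "card B \<le> m"
      "{u, v} \<in> [{1..n}]\<^bsup>2\<^esup>" "{u, v} \<notin> A" "{u, v} \<notin> B" for A B u v
    using that by unfold_locales (auto simp: nsets_def)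
  txt \<open>The pairs of \<open>F\<close> are exposed first: as long as no edge is prescribed, the number of backward
    switchings involves the full degrees, so the upper bound for absent pairs has no correction.\<close>
  have nonedges: "(1 - \<delta>) ^ card B * gb {} B \<le> profile X {} B * N \<and> (1 - \<delta>) ^ card B * (profile X {} B * N) \<le> gb {} B"
    if "finite B" "B \<subseteq> F" for B
    using that
  proof (induction B rule: finite_induct)
    case empty
    then show ?case by (simp add: gb_def N_def profile_def graphs_between_def)
  next
    case (insert e B)
    have e: "e \<in> [{1..n}]\<^bsup>2\<^esup>" using insert sub by auto
    then obtain u v where uv: "e = {u, v}" "u \<noteq> v" by (auto simp: nsets_def card_2_iff)
    have "card B \<le> m" using card_mono[OF fin(2), of B] insert sub by auto
    then interpret s: bounded_switching n d "{}" B u v \<Delta> S m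
      using insert e sub uv by (intro step) auto
    let ?w = "edge_weight X e"
    have ld: "2 * real s.loss \<le> \<delta> * real s.L" using del(1) by (simp add: s.loss_def)
    note sb = s.step_bounds[OF L ld del(2,3), folded X_def uv(1)]
    have b1: "(1 - \<delta>) * gb {} (insert e B) \<le> 1 / (1 + ?w) * gb {} B"
      unfolding gb_def using sb(3) by simp
    have b2: "(1 - \<delta>) * (1 / (1 + ?w)) * gb {} B \<le> gb {} (insert e B)"
      unfolding gb_def using sb(2) by simp
    have pr: "profile X {} (insert e B) = 1 / (1 + ?w) * profile X {} B"
      using insert by (simp add: profile_def)
    have IH: "(1 - \<delta>) ^ card B * gb {} B \<le> profile X {} B * N" "(1 - \<delta>) ^ card B * (profile X {} B * N) \<le> gb {} B"
      using insert by auto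
    have "(1 - \<delta>) ^ card (insert e B) * gb {} (insert e B) = (1 - \<delta>) ^ card B * ((1 - \<delta>) * gb {} (insert e B))"
      using insert by simp
    also have "\<dots> \<le> (1 - \<delta>) ^ card B * (1 / (1 + ?w) * gb {} B)"
      using d01 by (intro mult_left_mono b1) auto
    also have "\<dots> = 1 / (1 + ?w) * ((1 - \<delta>) ^ card B * gb {} B)" by simp
    also have "\<dots> \<le> 1 / (1 + ?w) * (profile X {} B * N)"
      using wn[of e] by (intro mult_left_mono IH) auto
    finally have 1: "(1 - \<delta>) ^ card (insert e B) * gb {} (insert e B) \<le> profile X {} (insert e B) * N"
      by (simp add: pr)
    have "(1 - \<delta>) ^ card (insert e B) * (profile X {} (insert e B) * N)
        = (1 - \<delta>) * (1 / (1 + ?w)) * ((1 - \<delta>) ^ card B * (profile X {} B * N))"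
      using insert by (simp add: pr)
    also have "\<dots> \<le> (1 - \<delta>) * (1 / (1 + ?w)) * gb {} B"
      using wn[of e] d01 by (intro mult_left_mono IH) auto
    also note b2
    finally show ?case using 1 by simp
  qed
  have F0: "(1 - \<delta>) ^ card F * gb {} F \<le> profile X {} F * N" "(1 - \<delta>) ^ card F * (profile X {} F * N) \<le> gb {} F"
    using nonedges[OF fin(2)] by auto
  have edges: "(1 - \<delta>) ^ (card A + card F) * gb A F \<le> profile X A F * N
      \<and> (\<forall>\<eta>. 0 \<le> \<eta> \<and> \<eta> \<le> 1 \<and> (\<forall>i\<in>\<Union>E. real m \<le> \<eta> * real (d i)) \<longrightarrow>
          (1 - \<delta>) ^ (card A + card F) * (1 - \<eta>) ^ (2 * card A) * (profile X A F * N) \<le> gb A F)"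
    if "finite A" "A \<subseteq> E" for A
    using that
  proof (induction A rule: finite_induct)
    case empty
    then show ?case using F0 by simp
  next
    case (insert e A)
    have e: "e \<in> [{1..n}]\<^bsup>2\<^esup>" using insert sub by auto
    then obtain u v where uv: "e = {u, v}" "u \<noteq> v" by (auto simp: nsets_def card_2_iff)
    have "card A \<le> m" using card_mono[OF fin(1), of A] insert sub by auto
    then interpret s: bounded_switching n d A F u v \<Delta> S m
      using insert e sub uv by (intro step) auto
    let ?w = "edge_weight X e"
    have ld: "2 * real s.loss \<le> \<delta> * real s.L" using del(1) by (simp add: s.loss_def)
    have pr: "profile X (insert e A) F = ?w / (1 + ?w) * profile X A F"
      using insert by (simp add: profile_def)
    have b1: "(1 - \<delta>) * gb (insert e A) F \<le> ?w / (1 + ?w) * gb A F"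
      unfolding gb_def using s.step_bounds(1)[OF L ld del(2,3), folded X_def uv(1)] by simp
    have IH1: "(1 - \<delta>) ^ (card A + card F) * gb A F \<le> profile X A F * N" using insert by auto
    have "(1 - \<delta>) ^ (card (insert e A) + card F) * gb (insert e A) F
        = (1 - \<delta>) ^ (card A + card F) * ((1 - \<delta>) * gb (insert e A) F)"
      using insert by simp
    also have "\<dots> \<le> (1 - \<delta>) ^ (card A + card F) * (?w / (1 + ?w) * gb A F)"
      using d01 by (intro mult_left_mono b1) auto
    also have "\<dots> = ?w / (1 + ?w) * ((1 - \<delta>) ^ (card A + card F) * gb A F)" by simp
    also have "\<dots> \<le> ?w / (1 + ?w) * (profile X A F * N)"
      using wn[of e] by (intro mult_left_mono IH1) auto
    finally have 1: "(1 - \<delta>) ^ (card (insert e A) + card F) * gb (insert e A) F \<le> profile X (insert e A) F * N"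
      by (simp add: pr)
    have 2: "(1 - \<delta>) ^ (card (insert e A) + card F) * (1 - \<eta>) ^ (2 * card (insert e A)) * (profile X (insert e A) F * N)
        \<le> gb (insert e A) F" if \<eta>: "0 \<le> \<eta>" "\<eta> \<le> 1" "\<forall>i\<in>\<Union>E. real m \<le> \<eta> * real (d i)" for \<eta>
    proof -
      have "u \<in> \<Union>E" "v \<in> \<Union>E" using uv insert by auto
      then have mu: "real m \<le> \<eta> * real (d u)" "real m \<le> \<eta> * real (d v)" using \<eta> by auto
      have IH2: "(1 - \<delta>) ^ (card A + card F) * (1 - \<eta>) ^ (2 * card A) * (profile X A F * N) \<le> gb A F"
        using insert \<eta> by auto
      have "(1 - \<delta>) ^ (card (insert e A) + card F) * (1 - \<eta>) ^ (2 * card (insert e A)) * (profile X (insert e A) F * N)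
        = (1 - \<eta>)\<^sup>2 * (1 - \<delta>) * (?w / (1 + ?w)) *
           ((1 - \<delta>) ^ (card A + card F) * (1 - \<eta>) ^ (2 * card A) * (profile X A F * N))"
        using insert by (simp add: pr power2_eq_square)
      also have "\<dots> \<le> (1 - \<eta>)\<^sup>2 * (1 - \<delta>) * (?w / (1 + ?w)) * gb A F"
        using wn[of e] d01 by (intro mult_left_mono IH2) auto
      also have "\<dots> \<le> gb (insert e A) F"
        using s.step_bounds(4)[OF L ld del(2,3) \<eta>(1,2) mu] unfolding gb_def X_def uv(1) by simp
      finally show ?thesis .
    qed
    show ?case using 1 2 by blast
  qed
  have pow: "(1 - \<delta>) ^ (2 * m) \<le> (1 - \<delta>) ^ (card E + card F)"
    using d01 sub by (intro power_decreasing) auto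
  have "(1 - \<delta>) ^ (2 * m) * gb E F \<le> (1 - \<delta>) ^ (card E + card F) * gb E F"
    by (rule mult_right_mono[OF pow]) (simp add: gb_def)
  then show ?up using edges[OF fin(1)] unfolding gb_def by fastforce
  assume \<eta>: "0 \<le> \<eta>" "\<eta> \<le> 1" "\<And>i. i \<in> \<Union>E \<Longrightarrow> real m \<le> \<eta> * real (d i)"
  have pow2: "(1 - \<eta>) ^ (2 * m) \<le> (1 - \<eta>) ^ (2 * card E)"
    using \<eta> sub by (intro power_decreasing) auto
  have "(1 - \<delta>) ^ (2 * m) * (1 - \<eta>) ^ (2 * m) * (profile X E F * N)
      \<le> (1 - \<delta>) ^ (card E + card F) * (1 - \<eta>) ^ (2 * card E) * (profile X E F * N)"
    using d01 \<eta> pn by (intro mult_right_mono mult_mono pow pow2) (auto simp: N_def)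
  also have "\<dots> \<le> gb E F" using edges[OF fin(1)] \<eta> by blast
  finally show "(1 - \<delta>) ^ (2 * m) * (1 - \<eta>) ^ (2 * m) * (profile X E F * N) \<le> real (card (graphs_between n d E F))"
    by (simp add: gb_def)
qed

end

section \<open>The optimization problem\<close>

definition exponent :: "real \<Rightarrow> 'a set \<Rightarrow> 'a set set \<Rightarrow> ('a \<Rightarrow> real) \<Rightarrow> real" where
  "exponent \<tau> V E y = - (\<tau> - 1) * (\<Sum>i\<in>V. y i) + (\<Sum>e\<in>E. min 0 (\<Sum>i\<in>e. y i))
     - (\<Sum>e\<in>[V]\<^bsup>2\<^esup> - E. max 0 (\<Sum>i\<in>e. y i))"

text \<open>The contribution of tuples with \<open>x\<^sub>i = exp y\<^sub>i\<close> is of order \<open>exp (exponent \<tau> V E y)\<close>. Although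
  \<open>exponent\<close> is only piecewise linear, it is additive when the outermost layer of \<open>y\<close> is peeled off, so
  that its sign is decided by the vectors with entries in \<open>{-1, 0, 1}\<close>, that is, by partitions.\<close>

lemma min_peel:
  fixes a b m :: real
  assumes "0 \<le> m" "a \<noteq> 0 \<Longrightarrow> m \<le> \<bar>a\<bar>" "b \<noteq> 0 \<Longrightarrow> m \<le> \<bar>b\<bar>"
  shows "min 0 (a + b) = min 0 ((a - m * sgn a) + (b - m * sgn b)) + m * min 0 (sgn a + sgn b)"
    and "max 0 (a + b) = max 0 ((a - m * sgn a) + (b - m * sgn b)) + m * max 0 (sgn a + sgn b)"
  using assms by (auto simp: sgn_if min_def max_def split: if_splits)

text \<open>If every nonzero entry is moved towards 0 by an m not exceeding any of their absolute
  values, then for each pair the old sum, the remaining sum and the sum of signs lie weakly on the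
  same side of 0. On one side of 0 both min 0 and max 0 are linear.\<close>

lemma exponent_peel:
  fixes y :: "'a \<Rightarrow> real"
  assumes "E \<subseteq> [V]\<^bsup>2\<^esup>" "0 \<le> m" "\<And>i. i \<in> V \<Longrightarrow> y i \<noteq> 0 \<Longrightarrow> m \<le> \<bar>y i\<bar>"
  shows "exponent \<tau> V E y
    = exponent \<tau> V E (\<lambda>i. y i - m * sgn (y i)) + m * exponent \<tau> V E (\<lambda>i. sgn (y i))"
proof -
  have pair: "min 0 (\<Sum>i\<in>e. y i) = min 0 (\<Sum>i\<in>e. y i - m * sgn (y i)) + m * min 0 (\<Sum>i\<in>e. sgn (y i))"
    "max 0 (\<Sum>i\<in>e. y i) = max 0 (\<Sum>i\<in>e. y i - m * sgn (y i)) + m * max 0 (\<Sum>i\<in>e. sgn (y i))"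
    if e: "e \<in> [V]\<^bsup>2\<^esup>" for e
  proof -
    obtain a b where "e = {a, b}" "a \<noteq> b" "a \<in> V" "b \<in> V"
      using e by (auto simp: nsets_def card_2_iff)
    then show "min 0 (\<Sum>i\<in>e. y i) = min 0 (\<Sum>i\<in>e. y i - m * sgn (y i)) + m * min 0 (\<Sum>i\<in>e. sgn (y i))"
      "max 0 (\<Sum>i\<in>e. y i) = max 0 (\<Sum>i\<in>e. y i - m * sgn (y i)) + m * max 0 (\<Sum>i\<in>e. sgn (y i))"
      using min_peel[OF assms(2), of "y a" "y b"] assms(3) by (simp_all del: min_def max_def)
  qed
  have "(\<Sum>e\<in>E. min 0 (\<Sum>i\<in>e. y i)) = (\<Sum>e\<in>E. min 0 (\<Sum>i\<in>e. y i - m * sgn (y i)))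
      + m * (\<Sum>e\<in>E. min 0 (\<Sum>i\<in>e. sgn (y i)))"
    unfolding sum_distrib_left sum.distrib[symmetric] using assms(1) by (intro sum.cong pair) auto
  moreover have "(\<Sum>e\<in>[V]\<^bsup>2\<^esup> - E. max 0 (\<Sum>i\<in>e. y i)) = (\<Sum>e\<in>[V]\<^bsup>2\<^esup> - E. max 0 (\<Sum>i\<in>e. y i - m * sgn (y i)))
      + m * (\<Sum>e\<in>[V]\<^bsup>2\<^esup> - E. max 0 (\<Sum>i\<in>e. sgn (y i)))"
    unfolding sum_distrib_left sum.distrib[symmetric] by (intro sum.cong pair) auto
  moreover have "(\<Sum>i\<in>V. y i) = (\<Sum>i\<in>V. y i - m * sgn (y i)) + m * (\<Sum>i\<in>V. sgn (y i))"
    unfolding sum_distrib_left sum.distrib[symmetric] by simp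
  ultimately show ?thesis by (simp add: exponent_def algebra_simps)
qed

text \<open>The l1 norm splits under peeling exactly as \<open>exponent\<close> does, so a bound at
  sign vectors propagates by induction on the number of nonzero entries.\<close>

lemma exponent_le:
  fixes y :: "'a \<Rightarrow> real"
  assumes V: "finite V" and E: "E \<subseteq> [V]\<^bsup>2\<^esup>"
    and c: "\<And>s. (\<And>i. s i \<in> {-1, 0, 1}) \<Longrightarrow> exponent \<tau> V E s \<le> - c * (\<Sum>i\<in>V. \<bar>s i\<bar>)"
  shows "exponent \<tau> V E y \<le> - c * (\<Sum>i\<in>V. \<bar>y i\<bar>)"
proof (induction "card {i \<in> V. y i \<noteq> 0}" arbitrary: y rule: less_induct)
  case less
  show ?case
  proof (cases "{i \<in> V. y i \<noteq> 0} = {}")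
    case True
    have s: "(\<Sum>i\<in>e. y i) = 0" if "e \<in> [V]\<^bsup>2\<^esup>" for e
      using that True by (intro sum.neutral) (auto simp: nsets_def)
    have "(\<Sum>i\<in>V. y i) = 0" "(\<Sum>i\<in>V. \<bar>y i\<bar>) = 0" using True by (auto intro: sum.neutral)
    moreover have "(\<Sum>e\<in>E. min 0 (\<Sum>i\<in>e. y i)) = 0" "(\<Sum>e\<in>[V]\<^bsup>2\<^esup> - E. max 0 (\<Sum>i\<in>e. y i)) = 0"
      using s E by (auto intro!: sum.neutral)
    ultimately show ?thesis by (simp add: exponent_def)
  next
    case False
    let ?T = "{i \<in> V. y i \<noteq> 0}"
    \<comment> \<open>The least nonzero absolute value: the largest admissible layer, whose removal
      annihilates an entry.\<close>
    define m where "m = Min ((\<lambda>i. \<bar>y i\<bar>) ` ?T)"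
    have fT: "finite ((\<lambda>i. \<bar>y i\<bar>) ` ?T)" "(\<lambda>i. \<bar>y i\<bar>) ` ?T \<noteq> {}" using V False by auto
    have mle: "m \<le> \<bar>y i\<bar>" if "i \<in> V" "y i \<noteq> 0" for i
      unfolding m_def using fT that by (intro Min_le) auto
    from Min_in[OF fT] obtain j where j: "j \<in> V" "y j \<noteq> 0" "m = \<bar>y j\<bar>" by (auto simp: m_def)
    then have m0: "0 \<le> m" by simp
    let ?y' = "\<lambda>i. y i - m * sgn (y i)"
    have "{i \<in> V. ?y' i \<noteq> 0} \<subset> ?T"
    proof
      show "{i \<in> V. ?y' i \<noteq> 0} \<subseteq> ?T" by auto
      have "?y' j = 0" using j by (simp add: sgn_if)
      then show "{i \<in> V. ?y' i \<noteq> 0} \<noteq> ?T" using j by blast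
    qed
    then have "exponent \<tau> V E ?y' \<le> - c * (\<Sum>i\<in>V. \<bar>?y' i\<bar>)"
      using V by (intro less psubset_card_mono) auto
    moreover have "m * exponent \<tau> V E (\<lambda>i. sgn (y i)) \<le> m * (- c * (\<Sum>i\<in>V. \<bar>sgn (y i)\<bar>))"
      using m0 by (intro mult_left_mono c) (auto simp: sgn_if)
    moreover have "(\<Sum>i\<in>V. \<bar>y i\<bar>) = (\<Sum>i\<in>V. \<bar>?y' i\<bar>) + m * (\<Sum>i\<in>V. \<bar>sgn (y i)\<bar>)"
      unfolding sum_distrib_left sum.distrib[symmetric]
    proof (intro sum.cong refl)
      fix i assume "i \<in> V"
      then show "\<bar>y i\<bar> = \<bar>?y' i\<bar> + m * \<bar>sgn (y i)\<bar>"
        using mle[of i] m0 by (auto simp: sgn_if abs_if)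
    qed
    ultimately show ?thesis
      using exponent_peel[where y = y and \<tau> = \<tau>, OF E m0 mle] by (simp add: algebra_simps)
  qed
qed

text \<open>The entries -1, 1, 0 mark S1 (small degrees), S2 (large degrees) and S3. An edge
  contributes -2 inside S1, -1 between S1 and S3, and nothing between S1 and S2, where the signs
  cancel. Non-edges are penalised in the same way through S2; counting them as all pairs minus edges
  gives |S2| (|S2| - 1 + |S3|), and k = |S1| + |S2| + |S3| turns this into the factor 2 - \<tau> - k
  + |S1|. Without vertices of degree one the V1 terms vanish.\<close>

lemma exponent_eq_B_objective:
  fixes V :: "'a set" and s :: "'a \<Rightarrow> real"
  assumes V: "finite V" and E: "E \<subseteq> [V]\<^bsup>2\<^esup>" and one: "degree_one_vertices V E = {}" and \<tau>: "1 < \<tau>"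
    and s: "\<And>i. s i \<in> {-1, 0, 1}"
  shows "exponent \<tau> V E s = (\<tau> - 1) * B_objective \<tau> V E ({i \<in> V. s i = -1}, {i \<in> V. s i = 1}, {i \<in> V. s i = 0})"
proof -
  let ?S1 = "{i \<in> V. s i = -1}" and ?S2 = "{i \<in> V. s i = 1}" and ?S3 = "{i \<in> V. s i = 0}"
  have fE: "finite E" using E V by (auto intro: finite_subset simp: finite_imp_finite_nsets)
  have f2: "finite ([V]\<^bsup>2\<^esup>)" using V by (simp add: finite_imp_finite_nsets)
  define P where "P = (\<lambda>S e. e \<subseteq> (S :: 'a set))"
  define Q where "Q = (\<lambda>S T e. \<exists>u\<in>(S :: 'a set). \<exists>v\<in>T. e = {u, v})"
  have pm: "min 0 (\<Sum>i\<in>e. s i) = - 2 * of_bool (P ?S1 e) - of_bool (Q ?S1 ?S3 e)"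
    "max 0 (\<Sum>i\<in>e. s i) = 2 * of_bool (P ?S2 e) + of_bool (Q ?S2 ?S3 e)" if e: "e \<in> [V]\<^bsup>2\<^esup>" for e
  proof -
    obtain a b where ab: "e = {a, b}" "a \<noteq> b" "a \<in> V" "b \<in> V"
      using e by (auto simp: nsets_def card_2_iff)
    have Q: "Q S T e \<longleftrightarrow> a \<in> S \<and> b \<in> T \<or> b \<in> S \<and> a \<in> T" for S T
      unfolding Q_def ab(1) by (auto simp: doubleton_eq_iff)
    have P: "P S e \<longleftrightarrow> a \<in> S \<and> b \<in> S" for S by (simp add: P_def ab(1))
    have sum: "(\<Sum>i\<in>e. s i) = s a + s b" using ab by simp
    have sa: "s a = -1 \<or> s a = 0 \<or> s a = 1" and sb: "s b = -1 \<or> s b = 0 \<or> s b = 1"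
      using s[of a] s[of b] by auto
    show "min 0 (\<Sum>i\<in>e. s i) = - 2 * of_bool (P ?S1 e) - of_bool (Q ?S1 ?S3 e)"
      unfolding sum P Q using sa sb ab(3,4) by (elim disjE) simp_all
    show "max 0 (\<Sum>i\<in>e. s i) = 2 * of_bool (P ?S2 e) + of_bool (Q ?S2 ?S3 e)"
      unfolding sum P Q using sa sb ab(3,4) by (elim disjE) simp_all
  qed
  have cnt: "(\<Sum>e\<in>E. of_bool (R e) :: real) = real (card {e \<in> E. R e})" if "finite E" for E and R :: "'a set \<Rightarrow> bool"
    using that by (simp add: Int_def)
  have sE: "(\<Sum>e\<in>E. min 0 (\<Sum>i\<in>e. s i)) = - 2 * real (edges_within E ?S1) - real (edges_between E ?S1 ?S3)"
  proof -
    have "(\<Sum>e\<in>E. min 0 (\<Sum>i\<in>e. s i)) = (\<Sum>e\<in>E. - 2 * of_bool (P ?S1 e) - of_bool (Q ?S1 ?S3 e))"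
      using E by (intro sum.cong pm) auto
    also have "\<dots> = - 2 * (\<Sum>e\<in>E. of_bool (P ?S1 e)) - (\<Sum>e\<in>E. of_bool (Q ?S1 ?S3 e))"
      unfolding sum_subtractf sum_distrib_left ..
    finally show ?thesis unfolding cnt[OF fE] by (simp add: edges_within_def edges_between_def P_def Q_def)
  qed
  have mE: "(\<Sum>e\<in>A. max 0 (\<Sum>i\<in>e. s i)) = 2 * real (card {e \<in> A. P ?S2 e}) + real (card {e \<in> A. Q ?S2 ?S3 e})"
    if A: "A \<subseteq> [V]\<^bsup>2\<^esup>" for A
  proof -
    have fA: "finite A" using A f2 by (rule finite_subset)
    have "(\<Sum>e\<in>A. max 0 (\<Sum>i\<in>e. s i)) = (\<Sum>e\<in>A. 2 * of_bool (P ?S2 e) + of_bool (Q ?S2 ?S3 e))"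
      using A by (intro sum.cong pm) auto
    also have "\<dots> = 2 * (\<Sum>e\<in>A. of_bool (P ?S2 e)) + (\<Sum>e\<in>A. of_bool (Q ?S2 ?S3 e))"
      unfolding sum.distrib sum_distrib_left ..
    finally show ?thesis unfolding cnt[OF fA] .
  qed
  have nsets_S2: "{e \<in> [V]\<^bsup>2\<^esup>. P ?S2 e} = [?S2]\<^bsup>2\<^esup>" by (auto simp: P_def nsets_def)
  have c2: "2 * real (card {e \<in> [V]\<^bsup>2\<^esup>. P ?S2 e}) = real (card ?S2) * (real (card ?S2) - 1)"
  proof -
    have eq: "2 * (q choose 2) = q * (q - 1)" for q :: nat
    proof -
      have "even (q * (q - 1))" by (cases q) auto
      then show ?thesis by (simp add: choose_two)
    qed
    have "2 * real (q choose 2) = real q * (real q - 1)" for q :: nat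
    proof -
      have "2 * real (q choose 2) = real (q * (q - 1))"
        unfolding eq[symmetric] by (simp only: of_nat_mult of_nat_numeral)
      also have "\<dots> = real q * (real q - 1)" by (cases q) (simp_all add: algebra_simps)
      finally show ?thesis .
    qed
    then show ?thesis unfolding nsets_S2 card_nsets .
  qed
  have c3: "card {e \<in> [V]\<^bsup>2\<^esup>. Q ?S2 ?S3 e} = card ?S2 * card ?S3"
  proof -
    have "{e \<in> [V]\<^bsup>2\<^esup>. Q ?S2 ?S3 e} = (\<lambda>(u, v). {u, v}) ` (?S2 \<times> ?S3)"
      by (auto simp: Q_def)
    moreover have "inj_on (\<lambda>(u, v). {u, v}) (?S2 \<times> ?S3)"
      by (auto simp: inj_on_def doubleton_eq_iff)
    ultimately show ?thesis by (simp add: card_image card_cartesian_product)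
  qed
  have sN: "(\<Sum>e\<in>[V]\<^bsup>2\<^esup> - E. max 0 (\<Sum>i\<in>e. s i)) = real (card ?S2) * (real (card ?S2) - 1) + real (card ?S2) * real (card ?S3)
     - (2 * real (edges_within E ?S2) + real (edges_between E ?S2 ?S3))"
    unfolding sum_diff[OF f2 E] mE[OF subset_refl] mE[OF E] c2 c3
    by (simp add: edges_within_def edges_between_def P_def Q_def)
  have cV: "card V = card ?S1 + card ?S2 + card ?S3"
  proof -
    have "V = (?S1 \<union> ?S2) \<union> ?S3" using s by auto
    then have "card V = card ((?S1 \<union> ?S2) \<union> ?S3)" by simp
    also have "\<dots> = card (?S1 \<union> ?S2) + card ?S3" using V by (intro card_Un_disjoint) auto
    also have "card (?S1 \<union> ?S2) = card ?S1 + card ?S2" using V by (intro card_Un_disjoint) auto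
    finally show ?thesis .
  qed
  have sV: "(\<Sum>i\<in>V. s i) = real (card ?S2) - real (card ?S1)"
  proof -
    have "(\<Sum>i\<in>V. s i) = (\<Sum>i\<in>V. of_bool (s i = 1) - of_bool (s i = -1))"
    proof (intro sum.cong refl)
      fix i show "s i = of_bool (s i = 1) - of_bool (s i = -1)" using s[of i] by auto
    qed
    also have "\<dots> = real (card ?S2) - real (card ?S1)"
      using V by (simp add: sum_subtractf Int_def)
    finally show ?thesis .
  qed
  have e0: "edges_between E S {} = 0" for S by (simp add: edges_between_def)
  have gen: "(\<tau> - 1) * (A + 1 / (\<tau> - 1) * B * D - F / (\<tau> - 1)) = (\<tau> - 1) * A + B * D - F" for A B D F :: real
    using \<tau> by (simp add: right_diff_distrib distrib_left)
  have "(\<tau> - 1) * B_objective \<tau> V E (?S1, ?S2, ?S3) =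
     (\<tau> - 1) * real (card ?S1) + real (card ?S2) * (2 - \<tau> - real (card V) + real (card ?S1))
     - (2 * real (edges_within E ?S1) - 2 * real (edges_within E ?S2)
          + real (edges_between E ?S1 ?S3) - real (edges_between E ?S2 ?S3))"
    unfolding B_objective_def by (simp add: gen one e0 Let_def del: times_divide_eq_left)
  then show ?thesis unfolding exponent_def sE sN sV cV by (simp add: algebra_simps)
qed

lemma finite_partitions3: "finite W \<Longrightarrow> finite (partitions3 W)"
  by (rule finite_subset[of _ "Pow W \<times> Pow W \<times> Pow W"]) (auto simp: partitions3_def)

text \<open>The partition with everything in S3 has value 0 = B, so by uniqueness all others are
  negative, and there are finitely many of them: the gap below 0 is uniform.\<close>

lemma exponent_decay:
  assumes V: "finite V" "V \<noteq> {}" and E: "E \<subseteq> [V]\<^bsup>2\<^esup>" and one: "degree_one_vertices V E = {}" and \<tau>: "1 < \<tau>"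
    and uniq: "B_unique_maximizer \<tau> V E" and B0: "B_value \<tau> V E = 0"
  obtains c where "0 < c" "\<And>y. exponent \<tau> V E y \<le> - c * (\<Sum>i\<in>V. \<bar>y i\<bar>)"
proof -
  let ?P = "partitions3 V" and ?triv = "({}, {}, V)"
  have fP: "finite ?P" using V by (simp add: finite_partitions3)
  have p0: "?triv \<in> ?P" by (simp add: partitions3_def)
  have b0: "B_objective \<tau> V E ?triv = 0"
    using exponent_eq_B_objective[OF V(1) E one \<tau>, of "\<lambda>_. 0"] \<tau> by (simp add: exponent_def)
  have neg: "B_objective \<tau> V E p < 0" if "p \<in> ?P" "p \<noteq> ?triv" for p
  proof -
    have "B_objective \<tau> V E p \<le> 0"
      using Max_ge[OF finite_imageI[OF fP] imageI[OF that(1)], of "B_objective \<tau> V E"] B0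
      by (simp add: B_value_def one)
    moreover have "B_objective \<tau> V E p \<noteq> 0"
      using uniq that p0 b0 unfolding B_unique_maximizer_def B0 one by (metis Diff_empty)
    ultimately show ?thesis by simp
  qed
  \<comment> \<open>The gap between the best and the second best partition; the element 1 makes the
    minimum defined in any case.\<close>
  define b where "b = Min (insert 1 ((\<lambda>p. - B_objective \<tau> V E p) ` (?P - {?triv})))"
  have b: "0 < b" unfolding b_def using fP neg by (subst Min_gr_iff) auto
  have ble: "B_objective \<tau> V E p \<le> - b" if "p \<in> ?P" "p \<noteq> ?triv" for p
  proof -
    have "b \<le> - B_objective \<tau> V E p" unfolding b_def using fP that by (intro Min_le) auto
    then show ?thesis by simp
  qed
  \<comment> \<open>A sign vector has l1 norm at most \<open>card V\<close>, so the gap is shared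
    out over that many entries.\<close>
  define c where "c = (\<tau> - 1) * b / real (card V)"
  have cV: "0 < card V" using V by (simp add: card_gt_0_iff)
  show thesis
  proof (rule that)
    show "0 < c" using b \<tau> cV by (simp add: c_def)
    fix y
    show "exponent \<tau> V E y \<le> - c * (\<Sum>i\<in>V. \<bar>y i\<bar>)"
    proof (rule exponent_le[OF V(1) E])
      fix s :: "'a \<Rightarrow> real" assume s: "\<And>i. s i \<in> {-1, 0, 1}"
      let ?p = "({i \<in> V. s i = -1}, {i \<in> V. s i = 1}, {i \<in> V. s i = 0})"
      have pP: "?p \<in> ?P" using s by (auto simp: partitions3_def)
      have eq: "exponent \<tau> V E s = (\<tau> - 1) * B_objective \<tau> V E ?p"
        by (rule exponent_eq_B_objective[OF V(1) E one \<tau> s])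
      show "exponent \<tau> V E s \<le> - c * (\<Sum>i\<in>V. \<bar>s i\<bar>)"
      proof (cases "?p = ?triv")
        case True
        then have "{i \<in> V. s i = 0} = V" by (simp only: prod.inject)
        then have "s i = 0" if "i \<in> V" for i
          using that \<open>{i \<in> V. s i = 0} = V\<close> by blast
        then have "(\<Sum>i\<in>V. \<bar>s i\<bar>) = 0" by simp
        then show ?thesis unfolding eq True b0 by simp
      next
        case False
        have "(\<Sum>i\<in>V. \<bar>s i\<bar>) \<le> (\<Sum>i\<in>V. 1)"
        proof (rule sum_mono)
          fix i show "\<bar>s i\<bar> \<le> 1" using s[of i] by auto
        qed
        then have "c * (\<Sum>i\<in>V. \<bar>s i\<bar>) \<le> c * real (card V)"
          using \<open>0 < c\<close> by (intro mult_left_mono) auto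
        also have "\<dots> = (\<tau> - 1) * b" using cV by (simp add: c_def)
        also have "\<dots> \<le> (\<tau> - 1) * - B_objective \<tau> V E ?p"
          using ble[OF pP False] \<tau> by (intro mult_left_mono) auto
        finally show ?thesis using eq by simp
      qed
    qed
  qed
qed

text \<open>With t = exp y this is exp ((\<tau> - 1) y - c |y|). The power \<tau> - 1 exactly
  offsets the tail count t^(1 - \<tau>) of vertices, and the remaining t^c below 1 and t^(-c) above
  1 gives summability at both ends.\<close>

definition dominator :: "real \<Rightarrow> real \<Rightarrow> real \<Rightarrow> real" where
  "dominator \<tau> c t = t powr (\<tau> - 1) * exp (- c * \<bar>ln t\<bar>)"

text \<open>In y = ln x each factor is at most the exponential of its piecewise linear envelope: exp
  t / (1 + exp t) \<le> exp (min 0 t) and 1 / (1 + exp t) \<le> exp (- max 0 t). The product of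
  these is exp of \<open>exponent\<close> without its vertex-count term; adding that term back
  yields the power \<tau> - 1 in \<open>dominator\<close>.\<close>

lemma profile_le_dominator:
  assumes V: "finite V" and E: "E \<subseteq> [V]\<^bsup>2\<^esup>"
    and c: "\<And>y. exponent \<tau> V E y \<le> - c * (\<Sum>i\<in>V. \<bar>y i\<bar>)" and x: "\<And>i. i \<in> V \<Longrightarrow> 0 < x i"
  shows "profile x E ([V]\<^bsup>2\<^esup> - E) \<le> (\<Prod>i\<in>V. dominator \<tau> c (x i))"
proof -
  define y where "y = (\<lambda>i. ln (x i))"
  have fE: "finite E" "finite ([V]\<^bsup>2\<^esup> - E)" using E V by (auto intro: finite_subset simp: finite_imp_finite_nsets)
  have w: "edge_weight x e = exp (\<Sum>i\<in>e. y i)" if "e \<in> [V]\<^bsup>2\<^esup>" for e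
  proof -
    have "finite e" "e \<subseteq> V" using that by (auto simp: nsets_def)
    then show ?thesis using x by (auto simp: edge_weight_def y_def exp_sum subset_iff intro!: prod.cong)
  qed
  have f1: "exp t / (1 + exp t) \<le> exp (min 0 t)" for t :: real
    by (auto simp: min_def divide_simps add_pos_pos)
  have f2: "1 / (1 + exp t) \<le> exp (- max 0 t)" for t :: real
  proof (cases "0 \<le> t")
    case True
    have "1 / (1 + exp t) \<le> 1 / exp t" by (intro frac_le) auto
    then show ?thesis using True by (simp add: exp_minus inverse_eq_divide)
  qed (simp add: add_pos_pos)
  have "profile x E ([V]\<^bsup>2\<^esup> - E) \<le> (\<Prod>e\<in>E. exp (min 0 (\<Sum>i\<in>e. y i))) * (\<Prod>e\<in>[V]\<^bsup>2\<^esup> - E. exp (- max 0 (\<Sum>i\<in>e. y i)))"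
    unfolding profile_def
  proof (intro mult_mono prod_mono conjI)
    fix e assume "e \<in> E"
    then have "e \<in> [V]\<^bsup>2\<^esup>" using E by auto
    then show "0 \<le> edge_weight x e / (1 + edge_weight x e)" "edge_weight x e / (1 + edge_weight x e) \<le> exp (min 0 (\<Sum>i\<in>e. y i))"
      by (auto simp only: w f1) (simp add: add_pos_pos less_imp_le)
  next
    fix e assume "e \<in> [V]\<^bsup>2\<^esup> - E"
    then show "0 \<le> 1 / (1 + edge_weight x e)" "1 / (1 + edge_weight x e) \<le> exp (- max 0 (\<Sum>i\<in>e. y i))"
      by (auto simp only: w f2 Diff_iff) (simp add: add_pos_pos less_imp_le)
  next
    show "0 \<le> (\<Prod>e\<in>E. exp (min 0 (\<Sum>i\<in>e. y i)))" by (simp add: prod_nonneg)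
    show "0 \<le> (\<Prod>e\<in>[V]\<^bsup>2\<^esup> - E. 1 / (1 + edge_weight x e))"
      by (intro prod_nonneg) (simp add: w add_pos_pos less_imp_le)
  qed
  also have "\<dots> = exp (exponent \<tau> V E y + (\<tau> - 1) * (\<Sum>i\<in>V. y i))"
    using fE by (simp add: exponent_def exp_add[symmetric] exp_sum[symmetric] sum_negf algebra_simps)
  also have "\<dots> \<le> exp (- c * (\<Sum>i\<in>V. \<bar>y i\<bar>) + (\<tau> - 1) * (\<Sum>i\<in>V. y i))"
    using c[of y] by simp
  also have "\<dots> = (\<Prod>i\<in>V. exp ((\<tau> - 1) * y i + - c * \<bar>y i\<bar>))"
    using V by (subst exp_sum[symmetric]) (simp_all add: sum.distrib sum_distrib_left sum_subtractf sum_negf)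
  also have "\<dots> = (\<Prod>i\<in>V. dominator \<tau> c (x i))"
  proof (intro prod.cong refl)
    fix i assume "i \<in> V"
    then have "0 < x i" by (rule x)
    then show "exp ((\<tau> - 1) * y i + - c * \<bar>y i\<bar>) = dominator \<tau> c (x i)"
      by (simp add: dominator_def y_def powr_def exp_add[symmetric])
  qed
  finally show ?thesis .
qed

section \<open>Power-law degree sequences\<close>

lemma power_powr_swap:
  fixes a :: real
  assumes "0 < a"
  shows "(a ^ J) powr e = (a powr e) ^ J"
  using assms by (induction J) (auto simp: powr_mult)

text \<open>Dyadic blocks: the terms between t and 2 t number at most K t^(-a) and are at most (2
  t)^p each, and since p < a the blocks t = 2^j R form a geometric series of ratio 2^(p -
  a).\<close>

lemma tail_sum_powr:
  fixes x :: "'a \<Rightarrow> real"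
  assumes fin: "finite I" and pos: "\<And>i. i \<in> I \<Longrightarrow> 0 < x i" and K: "0 \<le> K"
    and tail: "\<And>t. 0 < t \<Longrightarrow> real (card {i \<in> I. t < x i}) \<le> K * t powr (- a)"
    and p: "0 \<le> p" "p < a" and R: "0 < R"
  shows "(\<Sum>i\<in>{i \<in> I. R < x i}. x i powr p) \<le> K * 2 powr p * R powr (p - a) / (1 - 2 powr (p - a))"
proof -
  define q :: real where "q = 2 powr (p - a)"
  have q: "0 < q" "q < 1" using p by (auto simp: q_def powr_less_one)
  have step: "(\<Sum>i\<in>{i \<in> I. R < x i \<and> x i \<le> 2 ^ J * R}. x i powr p) \<le> K * 2 powr p * R powr (p - a) * (\<Sum>j<J. q ^ j)" for J
  proof (induction J)
    case 0
    have "{i \<in> I. R < x i \<and> x i \<le> 2 ^ 0 * R} = {}" by auto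
    then show ?case by (metis lessThan_0 mult_zero_right order_refl sum.empty)
  next
    case (Suc J)
    let ?t = "2 ^ J * R"
    let ?A = "{i \<in> I. R < x i \<and> x i \<le> ?t}" and ?B = "{i \<in> I. ?t < x i \<and> x i \<le> 2 * ?t}"
    have t: "0 < ?t" "R \<le> ?t" using R by (auto simp: mult_le_cancel_right1)
    have "{i \<in> I. R < x i \<and> x i \<le> 2 ^ Suc J * R} = ?A \<union> ?B" using t by auto
    then have "(\<Sum>i\<in>{i \<in> I. R < x i \<and> x i \<le> 2 ^ Suc J * R}. x i powr p) = (\<Sum>i\<in>?A. x i powr p) + (\<Sum>i\<in>?B. x i powr p)"
      using fin by (simp only:) (intro sum.union_disjoint; auto)
    moreover have "(\<Sum>i\<in>?B. x i powr p) \<le> K * 2 powr p * R powr (p - a) * q ^ J"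
    proof -
      have cB: "real (card ?B) \<le> real (card {i \<in> I. ?t < x i})"
        using fin by (intro of_nat_mono card_mono) auto
      have "(\<Sum>i\<in>?B. x i powr p) \<le> (\<Sum>i\<in>?B. (2 * ?t) powr p)"
        using pos p by (intro sum_mono powr_mono2) (auto simp: less_imp_le)
      also have "\<dots> = real (card ?B) * (2 * ?t) powr p" by simp
      also have "\<dots> \<le> K * ?t powr (- a) * (2 * ?t) powr p"
        by (rule mult_right_mono[OF order_trans[OF cB tail[OF t(1)]]]) simp
      also have "K * ?t powr (- a) * (2 * ?t) powr p = K * 2 powr p * R powr (p - a) * q ^ J"
      proof -
        have "?t powr (- a) * ?t powr p = ?t powr (p - a)"
          unfolding powr_add[symmetric] by (simp add: algebra_simps)
        also have "\<dots> = (2 ^ J) powr (p - a) * R powr (p - a)" using R by (simp add: powr_mult)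
        also have "(2 ^ J) powr (p - a) = q ^ J"
          unfolding q_def by (simp add: power_powr_swap)
        finally have "?t powr (- a) * ?t powr p = q ^ J * R powr (p - a)" .
        moreover have "(2 * ?t) powr p = 2 powr p * ?t powr p" using R by (simp only: powr_mult)
        ultimately show ?thesis by (simp only: mult_ac)
      qed
      finally show ?thesis .
    qed
    ultimately show ?case using Suc by (simp add: algebra_simps)
  qed
  obtain J where J: "\<And>i. i \<in> I \<Longrightarrow> x i \<le> 2 ^ J * R"
  proof -
    obtain B where B: "\<And>i. i \<in> I \<Longrightarrow> x i \<le> B"
      using fin by (metis Max_ge finite_imageI imageI)
    obtain J where "B / R < 2 ^ J" using real_arch_pow[of 2 "B / R"] by auto
    then have "B \<le> 2 ^ J * R" using R by (simp add: field_simps)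
    with B that show thesis by (meson order_trans)
  qed
  have "{i \<in> I. R < x i} = {i \<in> I. R < x i \<and> x i \<le> 2 ^ J * R}" using J by auto
  then have "(\<Sum>i\<in>{i \<in> I. R < x i}. x i powr p) \<le> K * 2 powr p * R powr (p - a) * (\<Sum>j<J. q ^ j)"
    using step[of J] by simp
  also have "\<dots> \<le> K * 2 powr p * R powr (p - a) * (1 / (1 - q))"
    using q K by (intro mult_left_mono) (auto simp: sum_gp_strict divide_right_mono)
  finally show ?thesis by (simp add: q_def)
qed

text \<open>The mirror image: for p > a the halving blocks below R form a geometric series of ratio
  2^(a - p).\<close>

lemma head_sum_powr:
  fixes x :: "'a \<Rightarrow> real"
  assumes fin: "finite I" and pos: "\<And>i. i \<in> I \<Longrightarrow> 0 < x i" and K: "0 \<le> K"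
    and tail: "\<And>t. 0 < t \<Longrightarrow> real (card {i \<in> I. t < x i}) \<le> K * t powr (- a)"
    and p: "0 \<le> p" "a < p" and R: "0 < R"
  shows "(\<Sum>i\<in>{i \<in> I. x i \<le> R}. x i powr p) \<le> K * 2 powr a * R powr (p - a) / (1 - 2 powr (a - p))"
proof -
  define q :: real where "q = 2 powr (a - p)"
  have q: "0 < q" "q < 1" using p by (auto simp: q_def powr_less_one)
  have step: "(\<Sum>i\<in>{i \<in> I. R / 2 ^ J < x i \<and> x i \<le> R}. x i powr p) \<le> K * 2 powr a * R powr (p - a) * (\<Sum>j<J. q ^ j)" for J
  proof (induction J)
    case 0
    have "{i \<in> I. R / 2 ^ 0 < x i \<and> x i \<le> R} = {}" by auto
    then show ?case by (metis lessThan_0 mult_zero_right order_refl sum.empty)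
  next
    case (Suc J)
    let ?t = "R / 2 ^ J"
    let ?A = "{i \<in> I. ?t < x i \<and> x i \<le> R}" and ?B = "{i \<in> I. ?t / 2 < x i \<and> x i \<le> ?t}"
    have t: "0 < ?t" "?t \<le> R" using R by (auto simp: divide_le_eq mult_le_cancel_left1)
    have "{i \<in> I. R / 2 ^ Suc J < x i \<and> x i \<le> R} = ?A \<union> ?B" using t by (auto simp: mult.commute)
    then have "(\<Sum>i\<in>{i \<in> I. R / 2 ^ Suc J < x i \<and> x i \<le> R}. x i powr p) = (\<Sum>i\<in>?A. x i powr p) + (\<Sum>i\<in>?B. x i powr p)"
      using fin by (simp only:) (intro sum.union_disjoint; auto)
    moreover have "(\<Sum>i\<in>?B. x i powr p) \<le> K * 2 powr a * R powr (p - a) * q ^ J"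
    proof -
      have t2: "0 < ?t / 2" using t by simp
      have cB: "real (card ?B) \<le> real (card {i \<in> I. ?t / 2 < x i})"
        using fin by (intro of_nat_mono card_mono) auto
      have "(\<Sum>i\<in>?B. x i powr p) \<le> (\<Sum>i\<in>?B. ?t powr p)"
        using pos p by (intro sum_mono powr_mono2) (auto simp: less_imp_le)
      also have "\<dots> = real (card ?B) * ?t powr p" by simp
      also have "\<dots> \<le> K * (?t / 2) powr (- a) * ?t powr p"
        by (rule mult_right_mono[OF order_trans[OF cB tail[OF t2]]]) simp
      also have "K * (?t / 2) powr (- a) * ?t powr p = K * 2 powr a * R powr (p - a) * q ^ J"
      proof -
        have "(?t / 2) powr (- a) = ?t powr (- a) * 2 powr a"
          using powr_divide[of ?t 2 "- a"] powr_minus_divide[of 2 a] t by simp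
        moreover have "?t powr (- a) * ?t powr p = ?t powr (p - a)"
          unfolding powr_add[symmetric] by (simp add: algebra_simps)
        moreover have "?t powr (p - a) = R powr (p - a) * q ^ J"
        proof -
          have "q ^ J = (2 ^ J) powr (a - p)"
            unfolding q_def by (simp add: power_powr_swap)
          also have "\<dots> = 1 / (2 ^ J) powr (p - a)"
            using powr_minus_divide[of "2 ^ J :: real" "p - a"] by simp
          finally show ?thesis using R by (simp add: powr_divide)
        qed
        ultimately show ?thesis by (simp only: mult_ac)
      qed
      finally show ?thesis .
    qed
    ultimately show ?case using Suc by (simp add: algebra_simps)
  qed
  obtain J where J: "\<And>i. i \<in> I \<Longrightarrow> R / 2 ^ J < x i"
  proof -
    obtain B where B: "0 < B" "\<And>i. i \<in> I \<Longrightarrow> B \<le> x i"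
    proof (cases "I = {}")
      case False
      show thesis
      proof (rule that[of "Min (x ` I)"])
        show "0 < Min (x ` I)" using fin False pos by (subst Min_gr_iff) auto
      qed (use fin in auto)
    qed (use that[of 1] in auto)
    obtain J where "R / B < 2 ^ J" using real_arch_pow[of 2 "R / B"] by auto
    then have "R / 2 ^ J < B" using B by (simp add: field_simps)
    with B that show thesis by (meson order_less_le_trans)
  qed
  have "{i \<in> I. x i \<le> R} = {i \<in> I. R / 2 ^ J < x i \<and> x i \<le> R}" using J by auto
  then have "(\<Sum>i\<in>{i \<in> I. x i \<le> R}. x i powr p) \<le> K * 2 powr a * R powr (p - a) * (\<Sum>j<J. q ^ j)"
    using step[of J] by simp
  also have "\<dots> \<le> K * 2 powr a * R powr (p - a) * (1 / (1 - q))"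
    using q K by (intro mult_left_mono) (auto simp: sum_gp_strict divide_right_mono)
  finally show ?thesis by (simp add: q_def)
qed

section \<open>Consequences of the degree assumption\<close>

locale power_law_degrees =
  fixes \<tau> C \<mu> :: real and d :: "nat \<Rightarrow> nat \<Rightarrow> nat"
  assumes degrees: "degree_assumption \<tau> C \<mu> d"
begin

abbreviation "L n \<equiv> total_degree n (d n)"
abbreviation "X n \<equiv> scaled_degree n (d n)"

lemma params: "2 < \<tau>" "\<tau> < 3" "0 < C" "0 < \<mu>"
  using degrees by (auto simp: degree_assumption_def)

lemma degree_pos: "2 \<le> n \<Longrightarrow> i \<in> {1..n} \<Longrightarrow> 0 < d n i"
  using degrees by (auto simp: degree_assumption_def)

lemma graphs_nonempty: "2 \<le> n \<Longrightarrow> graphs_with_degrees n (d n) \<noteq> {}"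
  using degrees by (auto simp: degree_assumption_def graphical_def)

lemma L_lim: "(\<lambda>n. real (L n) / real n) \<longlonglongrightarrow> \<mu>"
  using degrees by (auto simp: degree_assumption_def)

lemma L_ge: "2 \<le> n \<Longrightarrow> n \<le> L n"
proof -
  assume n: "2 \<le> n"
  have "(\<Sum>i=1..n. 1) \<le> L n" unfolding total_degree_def
    using degree_pos[OF n] by (intro sum_mono) (auto simp: Suc_le_eq)
  then show ?thesis by simp
qed

lemma L_pos: "2 \<le> n \<Longrightarrow> 0 < L n"
  using L_ge[of n] by simp

lemma X_pos: "2 \<le> n \<Longrightarrow> i \<in> {1..n} \<Longrightarrow> 0 < X n i"
  using degree_pos[of n i] L_pos[of n] by (simp add: scaled_degree_def)

lemma tail_card: "0 < n \<Longrightarrow> real (card {i\<in>{1..n}. j < d n i}) = real n * (1 - degree_cdf n (d n) j)"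
proof -
  assume n: "0 < n"
  have "(\<Sum>i=1..n. of_bool (d n i \<le> j) :: real) = (\<Sum>i=1..n. 1 - of_bool (j < d n i))"
    by (intro sum.cong) auto
  also have "\<dots> = real n - real (card {i\<in>{1..n}. j < d n i})"
    by (simp add: sum_subtractf Int_def)
  finally have "real n * degree_cdf n (d n) j = real n - real (card {i\<in>{1..n}. j < d n i})"
    using n by (simp add: degree_cdf_def)
  then show ?thesis by (simp add: right_diff_distrib)
qed

lemma degree_le_max: "i \<in> {1..n} \<Longrightarrow> d n i \<le> d_max n (d n)"
  unfolding d_max_def by (intro Max_ge) auto

text \<open>Passes from integer thresholds 1 \<le> j < d_max to all real t > 0. For t < 1 the count
  n is allowed, as t^(1 - \<tau>) \<ge> 1 and K \<ge> 1; from the maximal degree on nothing is left;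
  otherwise rounding t down at most halves it, which costs 2^(\<tau> - 1).\<close>

lemma degree_tail:
  obtains K where "1 \<le> K"
    "\<And>n t. 2 \<le> n \<Longrightarrow> 0 < t \<Longrightarrow> real (card {i\<in>{1..n}. t < real (d n i)}) \<le> K * real n * t powr (- (\<tau> - 1))"
proof -
  obtain K2 where K2: "0 < K2" "\<And>n j. 2 \<le> n \<Longrightarrow> 1 \<le> j \<Longrightarrow> j < d_max n (d n) \<Longrightarrow>
      1 - degree_cdf n (d n) j \<le> K2 * real j powr (1 - \<tau>)"
    using degrees by (auto simp: degree_assumption_def)
  define K where "K = max 1 (K2 * 2 powr (\<tau> - 1))"
  show thesis
  proof (rule that)
    show "1 \<le> K" by (simp add: K_def)
    fix n :: nat and t :: real assume n: "2 \<le> n" and t: "0 < t"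
    let ?c = "real (card {i\<in>{1..n}. t < real (d n i)})"
    define j where "j = nat \<lfloor>t\<rfloor>"
    have eq: "{i\<in>{1..n}. t < real (d n i)} = {i\<in>{1..n}. j < d n i}"
      using t unfolding j_def by (auto simp: nat_less_iff floor_less_iff)
    consider "t < 1" | "1 \<le> t" "d_max n (d n) \<le> j" | "1 \<le> t" "j < d_max n (d n)" by linarith
    then show "?c \<le> K * real n * t powr (- (\<tau> - 1))"
    proof cases
      case 1
      have "card {i\<in>{1..n}. t < real (d n i)} \<le> card {1..n}" by (rule card_mono) auto
      then have "?c \<le> real n" by simp
      also have "\<dots> \<le> real n * t powr (- (\<tau> - 1))"
        using 1 t params powr_mono2'[of "- (\<tau> - 1)" t 1] by (simp add: mult_le_cancel_left1)
      also have "\<dots> \<le> K * (real n * t powr (- (\<tau> - 1)))"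
        using mult_right_mono[of 1 K "real n * t powr (- (\<tau> - 1))"] by (simp add: K_def)
      finally show ?thesis by (simp add: mult.assoc)
    next
      case 2
      then have "{i\<in>{1..n}. t < real (d n i)} = {}"
        unfolding eq using degree_le_max[of _ n] by (metis (no_types, lifting) Collect_empty_eq leD le_trans)
      then have "?c = 0" by (simp only: card.empty of_nat_0)
      then show ?thesis by (simp only:) (simp add: K_def)
    next
      case 3
      then have "1 \<le> \<lfloor>t\<rfloor>" by simp
      moreover from this have "real j = real_of_int \<lfloor>t\<rfloor>" by (simp add: j_def)
      moreover have "t < real_of_int \<lfloor>t\<rfloor> + 1" by linarith
      ultimately have j: "1 \<le> j" "t / 2 \<le> real j" by linarith+
      have "?c = real n * (1 - degree_cdf n (d n) j)" unfolding eq by (rule tail_card) (use n in simp)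
      also have "\<dots> \<le> real n * (K2 * real j powr (1 - \<tau>))"
        by (intro mult_left_mono K2 n j 3) simp
      also have "\<dots> \<le> real n * (K2 * (t / 2) powr (1 - \<tau>))"
        using j t params K2(1) by (intro mult_left_mono powr_mono2') auto
      also have "\<dots> = (K2 * 2 powr (\<tau> - 1)) * (real n * t powr (- (\<tau> - 1)))"
        using t powr_minus_divide[of 2 "\<tau> - 1"] by (simp add: powr_divide)
      also have "\<dots> \<le> K * (real n * t powr (- (\<tau> - 1)))"
        by (intro mult_right_mono) (auto simp: K_def)
      finally show ?thesis by (simp add: mult.assoc)
    qed
  qed
qed

text \<open>Evaluates the tail at x sqrt L, with L \<ge> n because degrees are positive. The scale
  n^((3 - \<tau>) / 2) is n * (sqrt n)^(1 - \<tau>), the order of the number of vertices of degree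
  about sqrt n.\<close>

lemma scaled_tail:
  obtains K where "1 \<le> K"
    "\<And>n x. 2 \<le> n \<Longrightarrow> 0 < x \<Longrightarrow> real (card {i\<in>{1..n}. x < X n i}) \<le> (K * real n powr ((3 - \<tau>) / 2)) * x powr (- (\<tau> - 1))"
proof -
  obtain K where K: "1 \<le> K"
    "\<And>n t. 2 \<le> n \<Longrightarrow> 0 < t \<Longrightarrow> real (card {i\<in>{1..n}. t < real (d n i)}) \<le> K * real n * t powr (- (\<tau> - 1))"
    using degree_tail by blast
  show thesis
  proof (rule that[OF K(1)])
    fix n :: nat and x :: real assume n: "2 \<le> n" and x: "0 < x"
    have sL: "0 < sqrt (real (L n))" using L_pos[OF n] by simp
    have "{i\<in>{1..n}. x < X n i} = {i\<in>{1..n}. x * sqrt (real (L n)) < real (d n i)}"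
      using sL by (auto simp: scaled_degree_def pos_less_divide_eq)
    then have "real (card {i\<in>{1..n}. x < X n i}) \<le> K * real n * (x * sqrt (real (L n))) powr (- (\<tau> - 1))"
      using K(2)[OF n, of "x * sqrt (real (L n))"] x sL by simp
    also have "\<dots> = K * real n * x powr (- (\<tau> - 1)) * sqrt (real (L n)) powr (- (\<tau> - 1))"
      using x by (simp add: powr_mult)
    also have "\<dots> \<le> K * real n * x powr (- (\<tau> - 1)) * sqrt (real n) powr (- (\<tau> - 1))"
      using K(1) L_ge[OF n] n params by (intro mult_left_mono powr_mono2') auto
    also have "\<dots> = (K * real n powr ((3 - \<tau>) / 2)) * x powr (- (\<tau> - 1))"
    proof -
      have "sqrt (real n) powr (- (\<tau> - 1)) = real n powr ((1 - \<tau>) / 2)"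
        by (simp add: powr_half_sqrt[symmetric] powr_powr)
      moreover have "real n powr 1 * real n powr ((1 - \<tau>) / 2) = real n powr ((3 - \<tau>) / 2)"
        unfolding powr_add[symmetric] by (simp add: field_simps)
      ultimately show ?thesis by simp
    qed
    finally show "real (card {i\<in>{1..n}. x < X n i}) \<le> (K * real n powr ((3 - \<tau>) / 2)) * x powr (- (\<tau> - 1))" .
  qed
qed

lemma scaled_tail_lim:
  assumes x: "0 < x"
  shows "(\<lambda>n. real (card {i\<in>{1..n}. x < X n i}) / real n powr ((3 - \<tau>) / 2)) \<longlonglongrightarrow> C * (x * sqrt \<mu>) powr (1 - \<tau>)"
proof -
  \<comment> \<open>The assumed asymptotics concern sequences of positive integers. A degree exceeds
    x sqrt L iff it exceeds the floor; the maximum with 1 matters only for the finitely many n with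
    x sqrt L < 1.\<close>
  define j where "j = (\<lambda>n. max 1 (nat \<lfloor>x * sqrt (real (L n))\<rfloor>))"
  have Lsq: "(\<lambda>n. x * sqrt (real (L n)) / sqrt (real n)) \<longlonglongrightarrow> x * sqrt \<mu>"
    using tendsto_mult_left[OF tendsto_real_sqrt[OF L_lim], of x] by (simp add: real_sqrt_divide)
  have inv0: "(\<lambda>n. 1 / sqrt (real n)) \<longlonglongrightarrow> 0" by real_asymp
  have large: "\<forall>\<^sub>F n in sequentially. 1 \<le> x * sqrt (real (L n)) \<and> 2 \<le> n"
  proof -
    have "\<forall>\<^sub>F n in sequentially. 1 / sqrt (real n) < x"
      using order_tendstoD(2)[OF inv0 x] .
    moreover have "\<forall>\<^sub>F n::nat in sequentially. 2 \<le> n" by (rule eventually_ge_at_top)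
    ultimately show ?thesis
    proof eventually_elim
      case (elim n)
      then have "1 \<le> x * sqrt (real n)" by (simp add: field_simps)
      also have "\<dots> \<le> x * sqrt (real (L n))" using L_ge[of n] elim x by (intro mult_left_mono) auto
      finally show ?case using elim by simp
    qed
  qed
  have jlim: "(\<lambda>n. real (j n) / sqrt (real n)) \<longlonglongrightarrow> x * sqrt \<mu>"
  proof (rule tendsto_sandwich)
    show "(\<lambda>n. x * sqrt (real (L n)) / sqrt (real n) - 1 / sqrt (real n)) \<longlonglongrightarrow> x * sqrt \<mu>"
      using tendsto_diff[OF Lsq inv0] by simp
    show "\<forall>\<^sub>F n in sequentially. x * sqrt (real (L n)) / sqrt (real n) - 1 / sqrt (real n) \<le> real (j n) / sqrt (real n)"
      using large
    proof eventually_elim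
      case (elim n)
      have "x * sqrt (real (L n)) - 1 \<le> real (j n)" unfolding j_def by linarith
      then show ?case by (metis diff_divide_distrib divide_right_mono real_sqrt_ge_zero of_nat_0_le_iff)
    qed
    show "\<forall>\<^sub>F n in sequentially. real (j n) / sqrt (real n) \<le> x * sqrt (real (L n)) / sqrt (real n)"
      using large
    proof eventually_elim
      case (elim n)
      then have "real (j n) \<le> x * sqrt (real (L n))" unfolding j_def by linarith
      then show ?case by (simp add: divide_right_mono)
    qed
  qed (rule Lsq)
  have "(\<lambda>n. real (j n)) \<in> O(\<lambda>n. sqrt (real n))"
    by (rule bigoI_tendsto[OF jlim]) (use eventually_gt_at_top[of 0] in \<open>auto elim: eventually_mono\<close>)
  moreover have "\<forall>n. 1 \<le> j n" by (simp add: j_def)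
  ultimately have asym: "(\<lambda>n. 1 - degree_cdf n (d n) (j n)) \<sim>[at_top] (\<lambda>n. C * real (j n) powr (1 - \<tau>))"
    using degrees by (auto simp: degree_assumption_def)
  have ratio: "(\<lambda>n. (1 - degree_cdf n (d n) (j n)) / (C * real (j n) powr (1 - \<tau>))) \<longlonglongrightarrow> 1"
    by (rule asymp_equivD_strong[OF asym]) (use params in \<open>auto simp: j_def\<close>)
  have xm: "0 < x * sqrt \<mu>" using x params by simp
  have "(\<lambda>n. (1 - degree_cdf n (d n) (j n)) / (C * real (j n) powr (1 - \<tau>)) * (C * (real (j n) / sqrt (real n)) powr (1 - \<tau>)))
      \<longlonglongrightarrow> 1 * (C * (x * sqrt \<mu>) powr (1 - \<tau>))"
    using xm by (intro tendsto_intros ratio jlim) auto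
  moreover have "\<forall>\<^sub>F n in sequentially. (1 - degree_cdf n (d n) (j n)) / (C * real (j n) powr (1 - \<tau>)) * (C * (real (j n) / sqrt (real n)) powr (1 - \<tau>))
     = real (card {i\<in>{1..n}. x < X n i}) / real n powr ((3 - \<tau>) / 2)"
    using large
  proof eventually_elim
    case (elim n)
    then have n: "0 < real n" by simp
    have sL: "0 < sqrt (real (L n))" using L_pos[of n] elim by simp
    have "{i\<in>{1..n}. x < X n i} = {i\<in>{1..n}. x * sqrt (real (L n)) < real (d n i)}"
      using sL by (auto simp: scaled_degree_def pos_less_divide_eq)
    also have "\<dots> = {i\<in>{1..n}. j n < d n i}"
    proof -
      have "j n = nat \<lfloor>x * sqrt (real (L n))\<rfloor>" using elim unfolding j_def by linarith
      then show ?thesis using elim by (auto simp: nat_less_iff floor_less_iff)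
    qed
    finally have c: "real (card {i\<in>{1..n}. x < X n i}) = real n * (1 - degree_cdf n (d n) (j n))"
      using tail_card[of n "j n"] n by simp
    have jp: "0 < real (j n) powr (1 - \<tau>)" by (simp add: j_def)
    have "(real (j n) / sqrt (real n)) powr (1 - \<tau>) = real (j n) powr (1 - \<tau>) / real n powr ((1 - \<tau>) / 2)"
      by (simp add: powr_divide powr_half_sqrt[symmetric] powr_powr)
    moreover have "real n powr ((3 - \<tau>) / 2) = real n * real n powr ((1 - \<tau>) / 2)"
    proof -
      have "real n powr ((3 - \<tau>) / 2) = real n powr (1 + (1 - \<tau>) / 2)" by (simp add: field_simps)
      then show ?thesis using n by (simp add: powr_add)
    qed
    ultimately show ?case unfolding c using jp n params by simp
  qed
  ultimately show ?thesis by (simp add: tendsto_cong)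
qed

text \<open>Neighbours are split at degree n^\<gamma>. Those below contribute at most d_max *
  n^\<gamma>, those above at most the sum of all degrees above n^\<gamma>, which is o(n) since
  \<tau> > 2. Neither part depends on the graph.\<close>

lemma two_path_bounds:
  obtains S :: "nat \<Rightarrow> nat" and \<Delta> :: "nat \<Rightarrow> nat" where
    "\<And>n. 2 \<le> n \<Longrightarrow> two_path_bound n (d n) (\<Delta> n) (S n)"
    "(\<lambda>n. real (\<Delta> n) / real n) \<longlonglongrightarrow> 0" "(\<lambda>n. real (S n) / real n) \<longlonglongrightarrow> 0"
proof -
  obtain K where K: "1 \<le> K"
    "\<And>n t. 2 \<le> n \<Longrightarrow> 0 < t \<Longrightarrow> real (card {i\<in>{1..n}. t < real (d n i)}) \<le> K * real n * t powr (- (\<tau> - 1))"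
    using degree_tail by blast
  define \<beta> where "\<beta> = 1 / (\<tau> - 1)"
  have \<beta>: "0 < \<beta>" "\<beta> < 1" using params by (auto simp: \<beta>_def field_simps)
  define M where "M = 2 * K powr \<beta>"
  define Q where "Q = K * 2 powr 1 / (1 - 2 powr (1 - (\<tau> - 1)))"
  \<comment> \<open>As d_max is O(n^\<beta>), low neighbours give n^(\<beta> + \<gamma>); this
    \<gamma> places the exponent halfway between \<beta> and 1 and is positive, so both error terms
    are o(n).\<close>
  define \<gamma> where "\<gamma> = (1 - \<beta>) / 2"
  define b where "b = (\<lambda>n. M * real n powr ((1 + \<beta>) / 2) + Q * real n powr (1 + \<gamma> * (2 - \<tau>)))"
  define S where "S = (\<lambda>n. nat \<lceil>b n\<rceil>)"
  define \<Delta> where "\<Delta> = (\<lambda>n. d_max n (d n))"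
  have \<gamma>: "0 < \<gamma>" using \<beta> by (simp add: \<gamma>_def)
  have D: "real (\<Delta> n) \<le> M * real n powr \<beta>" if n: "2 \<le> n" for n
  proof -
    have "\<Delta> n \<in> d n ` {1..n}" unfolding \<Delta>_def d_max_def by (rule Max_in) (use n in auto)
    then obtain i where i: "i \<in> {1..n}" "d n i = \<Delta> n" by auto
    have Dp: "0 < \<Delta> n" using degree_pos[OF n i(1)] i by simp
    \<comment> \<open>A vertex of maximal degree is itself counted in the tail at half that degree,
      so the tail bound there is at least 1; this bounds the maximal degree by O(n^\<beta>).\<close>
    have "i \<in> {i\<in>{1..n}. real (\<Delta> n) / 2 < real (d n i)}" using i Dp by simp
    moreover have "finite {i\<in>{1..n}. real (\<Delta> n) / 2 < real (d n i)}" by simp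
    ultimately have "1 \<le> card {i\<in>{1..n}. real (\<Delta> n) / 2 < real (d n i)}"
      unfolding One_nat_def Suc_le_eq card_gt_0_iff by blast
    then have "1 \<le> K * real n * (real (\<Delta> n) / 2) powr (- (\<tau> - 1))"
      using K(2)[OF n, of "real (\<Delta> n) / 2"] Dp by simp
    then have "(real (\<Delta> n) / 2) powr (\<tau> - 1) \<le> K * real n"
      using Dp powr_minus_divide[of "real (\<Delta> n) / 2" "\<tau> - 1"] by (simp add: pos_le_divide_eq)
    then have "((real (\<Delta> n) / 2) powr (\<tau> - 1)) powr \<beta> \<le> (K * real n) powr \<beta>"
      using \<beta> by (intro powr_mono2) auto
    then have "real (\<Delta> n) / 2 \<le> K powr \<beta> * real n powr \<beta>"
      using params K Dp by (simp add: powr_powr \<beta>_def powr_mult)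
    then show ?thesis by (simp add: M_def)
  qed
  show thesis
  proof (rule that)
    fix n :: nat assume n: "2 \<le> n"
    show "two_path_bound n (d n) (\<Delta> n) (S n)"
    proof
      show "d n i \<le> \<Delta> n" if "i \<in> {1..n}" for i unfolding \<Delta>_def by (rule degree_le_max[OF that])
      fix G w assume G: "G \<in> graphs_with_degrees n (d n)"
      note sg = graphs_with_degreesD(1)[OF G]
      have N: "nbrs G w \<subseteq> {1..n}" "finite (nbrs G w)" using nbrs_subset[OF sg] finite_nbrs[OF sg] by auto
      have cN: "real (card (nbrs G w)) \<le> real (\<Delta> n)"
      proof (cases "w \<in> {1..n}")
        case True
        then show ?thesis using card_nbrs[OF sg, of w] graphs_with_degreesD(2)[OF G True] degree_le_max[OF True]
          by (simp add: \<Delta>_def)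
      next
        case False
        then have "nbrs G w = {}" using sg by (auto simp: nbrs_def dest: simple_graph_edgeD)
        then show ?thesis by simp
      qed
      let ?T = "real n powr \<gamma>"
      have T: "0 < ?T" using n by simp
      have "real (\<Sum>x\<in>nbrs G w. d n x) \<le> (\<Sum>x\<in>nbrs G w. ?T + (if ?T < real (d n x) then real (d n x) else 0))"
        unfolding of_nat_sum using T by (intro sum_mono) auto
      also have "\<dots> = real (card (nbrs G w)) * ?T + (\<Sum>x\<in>nbrs G w. if ?T < real (d n x) then real (d n x) else 0)"
        by (simp add: sum.distrib)
      finally have 1: "real (\<Sum>x\<in>nbrs G w. d n x) \<le> real (card (nbrs G w)) * ?T + (\<Sum>x\<in>nbrs G w. if ?T < real (d n x) then real (d n x) else 0)" .
      have "(\<Sum>x\<in>nbrs G w. if ?T < real (d n x) then real (d n x) else 0) \<le> (\<Sum>x\<in>{1..n}. if ?T < real (d n x) then real (d n x) else 0)"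
        using N by (intro sum_mono2) auto
      also have "\<dots> = (\<Sum>x\<in>{i\<in>{1..n}. ?T < real (d n i)}. real (d n x) powr 1)"
        unfolding sum.inter_filter[OF finite_atLeastAtMost] by (intro sum.cong) auto
      also have "\<dots> \<le> (K * real n) * 2 powr 1 * ?T powr (1 - (\<tau> - 1)) / (1 - 2 powr (1 - (\<tau> - 1)))"
        using K(1) params degree_pos[OF n] T by (intro tail_sum_powr K(2)[OF n]) auto
      also have "\<dots> = Q * real n powr (1 + \<gamma> * (2 - \<tau>))"
      proof -
        have "?T powr (1 - (\<tau> - 1)) = real n powr (\<gamma> * (2 - \<tau>))" by (simp add: powr_powr)
        moreover have "real n powr (1 + \<gamma> * (2 - \<tau>)) = real n * real n powr (\<gamma> * (2 - \<tau>))"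
          using n by (simp add: powr_add)
        ultimately show ?thesis by (simp add: Q_def)
      qed
      finally have 2: "(\<Sum>x\<in>nbrs G w. if ?T < real (d n x) then real (d n x) else 0) \<le> Q * real n powr (1 + \<gamma> * (2 - \<tau>))" .
      have "real (card (nbrs G w)) * ?T \<le> (M * real n powr \<beta>) * ?T"
        using cN D[OF n] by (intro mult_right_mono) auto
      also have "(M * real n powr \<beta>) * ?T = M * real n powr ((1 + \<beta>) / 2)"
      proof -
        have "\<beta> + \<gamma> = (1 + \<beta>) / 2" by (simp add: \<gamma>_def field_simps)
        then show ?thesis by (metis mult.assoc powr_add)
      qed
      finally have "real (\<Sum>x\<in>nbrs G w. d n x) \<le> b n" unfolding b_def using 1 2 by linarith
      then show "(\<Sum>x\<in>nbrs G w. d n x) \<le> S n" unfolding S_def by linarith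
    qed
  next
    show "(\<lambda>n. real (\<Delta> n) / real n) \<longlonglongrightarrow> 0"
    proof (rule tendsto_sandwich[of "\<lambda>_. 0" _ _ "\<lambda>n. M * real n powr \<beta> / real n"])
      show "\<forall>\<^sub>F n in sequentially. real (\<Delta> n) / real n \<le> M * real n powr \<beta> / real n"
        using eventually_ge_at_top[of 2] by eventually_elim (intro divide_right_mono D; simp)
      show "(\<lambda>n. M * real n powr \<beta> / real n) \<longlonglongrightarrow> 0" using \<beta> by real_asymp
    qed auto
    have e1: "(1 + \<beta>) / 2 < 1" using \<beta> by simp
    have e2: "1 + \<gamma> * (2 - \<tau>) < 1" using \<gamma> params by (simp add: mult_pos_neg)
    show "(\<lambda>n. real (S n) / real n) \<longlonglongrightarrow> 0"
    proof (rule tendsto_sandwich[of "\<lambda>_. 0" _ _ "\<lambda>n. (\<bar>b n\<bar> + 1) / real n"])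
      show "\<forall>\<^sub>F n in sequentially. real (S n) / real n \<le> (\<bar>b n\<bar> + 1) / real n"
      proof (intro always_eventually allI divide_right_mono)
        fix n show "real (S n) \<le> \<bar>b n\<bar> + 1" unfolding S_def by linarith
      qed simp
      have p1: "(\<lambda>n. M * real n powr ((1 + \<beta>) / 2) / real n) \<longlonglongrightarrow> 0"
        using e1 by real_asymp
      have p2: "(\<lambda>n. Q * real n powr (1 + \<gamma> * (2 - \<tau>)) / real n) \<longlonglongrightarrow> 0"
      proof -
        define e where "e = 1 + \<gamma> * (2 - \<tau>)"
        have "e < 1" using e2 by (simp add: e_def)
        then have "(\<lambda>n. Q * real n powr e / real n) \<longlonglongrightarrow> 0" by real_asymp
        then show ?thesis by (simp add: e_def)
      qed
      have "(\<lambda>n. b n / real n) \<longlonglongrightarrow> 0"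
        using tendsto_add[OF p1 p2] by (simp add: b_def add_divide_distrib)
      from tendsto_add[OF tendsto_rabs_zero[OF this] lim_1_over_n]
      show "(\<lambda>n. (\<bar>b n\<bar> + 1) / real n) \<longlonglongrightarrow> 0"
        by (simp add: add_divide_distrib)
    qed auto
  qed
qed

end

section \<open>Limits of sums over tuples\<close>

lemma PiM_density:
  fixes N :: "'i \<Rightarrow> 'a measure" and f :: "'i \<Rightarrow> 'a \<Rightarrow> ennreal"
  assumes I: "finite I" and sf: "\<And>i. sigma_finite_measure (N i)" "\<And>i. sigma_finite_measure (density (N i) (f i))"
    and f: "\<And>i. f i \<in> borel_measurable (N i)"
  shows "PiM I (\<lambda>i. density (N i) (f i)) = density (PiM I N) (\<lambda>x. \<Prod>i\<in>I. f i (x i))"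
proof -
  interpret N: product_sigma_finite N by (simp add: product_sigma_finite_def sf)
  interpret D: product_sigma_finite "\<lambda>i. density (N i) (f i)" by (simp add: product_sigma_finite_def sf)
  have meas: "(\<lambda>x. \<Prod>i\<in>I. f i (x i)) \<in> borel_measurable (PiM I N)"
  proof (rule borel_measurable_prod_ennreal)
    fix i assume "i \<in> I"
    show "(\<lambda>x. f i (x i)) \<in> borel_measurable (PiM I N)"
      by (rule measurable_compose[OF measurable_component_singleton[OF \<open>i \<in> I\<close>, of N]]) (rule f)
  qed
  show ?thesis
  proof (rule D.PiM_eqI[OF I, symmetric])
    show "sets (density (PiM I N) (\<lambda>x. \<Prod>i\<in>I. f i (x i))) = sets (PiM I (\<lambda>i. density (N i) (f i)))"
      by (simp cong: sets_PiM_cong)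
    fix A assume "\<And>i. i \<in> I \<Longrightarrow> A i \<in> sets (density (N i) (f i))"
    then have A: "\<And>i. i \<in> I \<Longrightarrow> A i \<in> sets (N i)" by simp
    have "emeasure (density (PiM I N) (\<lambda>x. \<Prod>i\<in>I. f i (x i))) (Pi\<^sub>E I A)
        = (\<integral>\<^sup>+x. (\<Prod>i\<in>I. f i (x i)) * indicator (Pi\<^sub>E I A) x \<partial>PiM I N)"
      by (intro emeasure_density meas sets_PiM_I_finite I A)
    also have "\<dots> = (\<integral>\<^sup>+x. (\<Prod>i\<in>I. f i (x i) * indicator (A i) (x i)) \<partial>PiM I N)"
    proof (rule nn_integral_cong)
      fix x assume "x \<in> space (PiM I N)"
      then have x: "x \<in> extensional I" by (simp add: space_PiM PiE_def)
      have "indicator (Pi\<^sub>E I A) x = (\<Prod>i\<in>I. indicator (A i) (x i) :: ennreal)"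
        using x I by (auto simp: indicator_def PiE_def Pi_def prod_zero_iff)
      then show "(\<Prod>i\<in>I. f i (x i)) * indicator (Pi\<^sub>E I A) x = (\<Prod>i\<in>I. f i (x i) * indicator (A i) (x i))"
        by (simp add: prod.distrib)
    qed
    also have "\<dots> = (\<Prod>i\<in>I. \<integral>\<^sup>+y. f i y * indicator (A i) y \<partial>N i)"
      using A f by (intro N.product_nn_integral_prod I) auto
    also have "\<dots> = (\<Prod>i\<in>I. emeasure (density (N i) (f i)) (A i))"
      using A f by (intro prod.cong refl emeasure_density[symmetric]) auto
    finally show "emeasure (density (PiM I N) (\<lambda>x. \<Prod>i\<in>I. f i (x i))) (Pi\<^sub>E I A)
        = (\<Prod>i\<in>I. emeasure (density (N i) (f i)) (A i))" .
  qed
qed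

text \<open>A Skorohod coupling of the one-dimensional laws, applied in every coordinate of the
  product of its probability space, realises the product laws by variables that converge pointwise;
  bounded convergence then passes to the limit under g.\<close>

lemma weak_conv_PiM:
  fixes g :: "('i \<Rightarrow> real) \<Rightarrow> real"
  assumes I: "finite I" and \<mu>: "\<And>n. real_distribution (\<mu> n)" and M: "real_distribution M"
    and wc: "weak_conv_m \<mu> M"
    and g: "g \<in> borel_measurable (PiM I (\<lambda>_. borel))" "\<And>y. \<bar>g y\<bar> \<le> B"
    and cont: "\<And>y y0. (\<And>i. i \<in> I \<Longrightarrow> (\<lambda>n. y n i) \<longlonglongrightarrow> y0 i) \<Longrightarrow> (\<lambda>n. g (y n)) \<longlonglongrightarrow> g y0"
  shows "(\<lambda>n. \<integral>x. g x \<partial>PiM I (\<lambda>_. \<mu> n)) \<longlonglongrightarrow> (\<integral>x. g x \<partial>PiM I (\<lambda>_. M))"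
proof -
  obtain \<Omega> :: "real measure" and Yn Y where *: "prob_space \<Omega> \<and> (\<forall>n. Yn n \<in> measurable \<Omega> borel) \<and>
    (\<forall>n. distr \<Omega> borel (Yn n) = \<mu> n) \<and> Y \<in> measurable \<Omega> lborel \<and> distr \<Omega> borel Y = M \<and>
    (\<forall>x\<in>space \<Omega>. (\<lambda>n. Yn n x) \<longlonglongrightarrow> Y x)"
    using Skorohod[OF \<mu> M wc] by blast
  then have \<Omega>: "prob_space \<Omega>"
    and Yn: "\<And>n. Yn n \<in> measurable \<Omega> borel" "\<And>n. distr \<Omega> borel (Yn n) = \<mu> n"
    and Y: "Y \<in> measurable \<Omega> lborel" "distr \<Omega> borel Y = M"
    and conv: "\<And>\<omega>. \<omega> \<in> space \<Omega> \<Longrightarrow> (\<lambda>n. Yn n \<omega>) \<longlonglongrightarrow> Y \<omega>"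
    by blast+
  interpret P: prob_space "PiM I (\<lambda>_. \<Omega>)" by (intro prob_space_PiM \<Omega>)
  have transfer: "(\<integral>x. g x \<partial>PiM I (\<lambda>_. Q)) = (\<integral>\<omega>. g (compose I Z \<omega>) \<partial>PiM I (\<lambda>_. \<Omega>))"
    and meas: "(\<lambda>\<omega>. g (compose I Z \<omega>)) \<in> borel_measurable (PiM I (\<lambda>_. \<Omega>))"
    if Q: "real_distribution Q" and Z: "Z \<in> measurable \<Omega> borel" "distr \<Omega> borel Z = Q" for Q Z
  proof -
    interpret Q: real_distribution Q by fact
    have Z': "Z \<in> measurable \<Omega> Q" using Z(1) by (simp add: Q.events_eq_borel cong: measurable_cong_sets)
    have "PiM I (\<lambda>_. Q) = PiM I (\<lambda>_. distr \<Omega> Q Z)"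
      using Z(2) by (simp add: Q.events_eq_borel cong: distr_cong)
    also have "\<dots> = distr (PiM I (\<lambda>_. \<Omega>)) (PiM I (\<lambda>_. Q)) (compose I Z)"
      by (intro distr_PiM_finite_prob_space'[symmetric] I \<Omega> Z') (rule Q.prob_space_axioms)
    finally have eq: "PiM I (\<lambda>_. Q) = distr (PiM I (\<lambda>_. \<Omega>)) (PiM I (\<lambda>_. Q)) (compose I Z)" .
    have gQ: "g \<in> borel_measurable (PiM I (\<lambda>_. Q))"
      using g(1) by (simp add: Q.events_eq_borel cong: measurable_cong_sets sets_PiM_cong)
    have cZ: "compose I Z \<in> measurable (PiM I (\<lambda>_. \<Omega>)) (PiM I (\<lambda>_. Q))"
      unfolding compose_def
    proof (rule measurable_restrict)
      fix i assume "i \<in> I"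
      show "(\<lambda>x. Z (x i)) \<in> measurable (PiM I (\<lambda>_. \<Omega>)) Q"
        by (rule measurable_compose[OF measurable_component_singleton[OF \<open>i \<in> I\<close>]]) (rule Z')
    qed
    show "(\<lambda>\<omega>. g (compose I Z \<omega>)) \<in> borel_measurable (PiM I (\<lambda>_. \<Omega>))"
      by (rule measurable_compose[OF cZ gQ])
    show "(\<integral>x. g x \<partial>PiM I (\<lambda>_. Q)) = (\<integral>\<omega>. g (compose I Z \<omega>) \<partial>PiM I (\<lambda>_. \<Omega>))"
      by (subst eq) (rule integral_distr[OF cZ gQ])
  qed
  have Yb: "Y \<in> measurable \<Omega> borel" using Y(1) by simp
  show ?thesis
    unfolding transfer[OF \<mu> Yn] transfer[OF M Yb Y(2)]
  proof (rule integral_dominated_convergence[where w = "\<lambda>_. B"])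
    show "AE \<omega> in PiM I (\<lambda>_. \<Omega>). (\<lambda>n. g (compose I (Yn n) \<omega>)) \<longlonglongrightarrow> g (compose I Y \<omega>)"
    proof (rule AE_I2)
      fix \<omega> assume "\<omega> \<in> space (PiM I (\<lambda>_. \<Omega>))"
      then have "\<omega> i \<in> space \<Omega>" if "i \<in> I" for i using that by (auto simp: space_PiM)
      then show "(\<lambda>n. g (compose I (Yn n) \<omega>)) \<longlonglongrightarrow> g (compose I Y \<omega>)"
        by (intro cont) (simp add: compose_def conv)
    qed
  qed (use g(2) meas[OF \<mu> Yn] meas[OF M Yb Y(2)] in auto)
qed

text \<open>Turns a sum over tuples of vertices into an integral against a power of the empirical
  law of x, to which weak convergence applies.\<close>

lemma integral_PiM_uniform_count:
  fixes g :: "('i \<Rightarrow> real) \<Rightarrow> real" and x :: "'a \<Rightarrow> real"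
  assumes I: "finite I" and J: "finite J" "J \<noteq> {}"
    and g: "g \<in> borel_measurable (PiM I (\<lambda>_. borel))"
  shows "(\<integral>y. g y \<partial>PiM I (\<lambda>_. distr (uniform_count_measure J) borel x))
    = (\<Sum>v\<in>I \<rightarrow>\<^sub>E J. g (compose I x v)) / real (card J) ^ card I"
proof -
  let ?U = "uniform_count_measure J" and ?c = "\<lambda>_::'a. ennreal (1 / real (card J))"
  have U: "prob_space ?U" by (rule prob_space_uniform_count_measure[OF J])
  interpret U: prob_space ?U by (rule U)
  have x: "x \<in> measurable ?U borel" by simp
  interpret Q: prob_space "distr ?U borel x" by (rule U.prob_space_distr[OF x])
  have UD: "?U = density (count_space J) ?c" by (simp add: uniform_count_measure_def point_measure_def)
  have "PiM I (\<lambda>_. distr ?U borel x) = PiM I (\<lambda>_. distr ?U (distr ?U borel x) x)"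
    by (simp cong: distr_cong)
  also have "\<dots> = distr (PiM I (\<lambda>_. ?U)) (PiM I (\<lambda>_. distr ?U borel x)) (compose I x)"
    by (intro distr_PiM_finite_prob_space'[symmetric] I U Q.prob_space_axioms) simp
  finally have eq: "PiM I (\<lambda>_. distr ?U borel x) = distr (PiM I (\<lambda>_. ?U)) (PiM I (\<lambda>_. distr ?U borel x)) (compose I x)" .
  have gQ: "g \<in> borel_measurable (PiM I (\<lambda>_. distr ?U borel x))"
    using g by (simp cong: measurable_cong_sets sets_PiM_cong)
  have cx: "compose I x \<in> measurable (PiM I (\<lambda>_. ?U)) (PiM I (\<lambda>_. distr ?U borel x))"
    unfolding compose_def
    by (intro measurable_restrict measurable_compose[OF measurable_component_singleton]) simp_all
  have "PiM I (\<lambda>_. ?U) = density (PiM I (\<lambda>_. count_space J)) (\<lambda>v. \<Prod>i\<in>I. ?c (v i))"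
    unfolding UD
  proof (rule PiM_density[OF I])
    show "sigma_finite_measure (count_space J)"
      using J by (intro sigma_finite_measure_count_space_countable countable_finite)
    show "sigma_finite_measure (density (count_space J) ?c)"
      unfolding UD[symmetric] by (rule U.sigma_finite_measure_axioms)
  qed simp
  also have "PiM I (\<lambda>_. count_space J) = count_space (I \<rightarrow>\<^sub>E J)"
    using I J by (intro count_space_PiM_finite) (auto simp: countable_finite)
  finally have PU: "PiM I (\<lambda>_. ?U) = density (count_space (I \<rightarrow>\<^sub>E J)) (\<lambda>_. ennreal ((1 / real (card J)) ^ card I))"
    by (simp add: ennreal_power)
  have "(\<integral>y. g y \<partial>PiM I (\<lambda>_. distr ?U borel x)) = (\<integral>v. g (compose I x v) \<partial>PiM I (\<lambda>_. ?U))"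
    by (subst eq) (rule integral_distr[OF cx gQ])
  also have "\<dots> = (\<integral>v. (1 / real (card J)) ^ card I * g (compose I x v) \<partial>count_space (I \<rightarrow>\<^sub>E J))"
    unfolding PU by (subst integral_density) auto
  also have "\<dots> = (\<Sum>v\<in>I \<rightarrow>\<^sub>E J. (1 / real (card J)) ^ card I * g (compose I x v))"
    using I J by (intro lebesgue_integral_count_space_finite finite_PiE) auto
  finally show ?thesis by (simp add: sum_divide_distrib power_divide)
qed

text \<open>Clamping the coordinates from below makes the profile continuous everywhere.\<close>

definition clamped_profile :: "real \<Rightarrow> nat set set \<Rightarrow> nat set set \<Rightarrow> (nat \<Rightarrow> real) \<Rightarrow> real" where
  "clamped_profile a E F y = profile (\<lambda>i. max a (y i)) E F"

lemma profile_cong: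
  assumes "\<And>i. i \<in> V \<Longrightarrow> x i = y i" "E \<subseteq> Pow V" "F \<subseteq> Pow V"
  shows "profile x E F = profile y E F"
proof -
  have "edge_weight x e = edge_weight y e" if "e \<subseteq> V" for e
    unfolding edge_weight_def using that assms(1) by (intro prod.cong) auto
  then show ?thesis unfolding profile_def using assms(2,3)
    by (intro arg_cong2[where f = "(*)"] prod.cong) auto
qed

lemma profile_le_1:
  assumes "\<And>i. 0 \<le> x i"
  shows "profile x E F \<le> 1"
proof -
  have w: "0 \<le> edge_weight x e" for e by (rule edge_weight_nonneg[OF assms])
  have "(\<Prod>e\<in>E. edge_weight x e / (1 + edge_weight x e)) \<le> 1"
    using w by (intro prod_le_1) (auto intro!: divide_nonneg_nonneg add_nonneg_nonneg simp: divide_le_eq_1 add_nonneg_pos add_pos_nonneg)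
  moreover have "(\<Prod>e\<in>F. 1 / (1 + edge_weight x e)) \<le> 1"
    using w by (intro prod_le_1) (auto intro!: divide_nonneg_nonneg add_nonneg_nonneg simp: divide_le_eq_1 add_nonneg_pos add_pos_nonneg)
  moreover have "0 \<le> (\<Prod>e\<in>F. 1 / (1 + edge_weight x e))"
    using w by (intro prod_nonneg) (simp add: add_nonneg_nonneg)
  moreover have "0 \<le> (\<Prod>e\<in>E. edge_weight x e / (1 + edge_weight x e))"
    using w by (intro prod_nonneg) (simp add: add_nonneg_nonneg)
  ultimately show ?thesis unfolding profile_def by (intro mult_le_one)
qed

lemma clamped_profile_bound:
  assumes "0 < a"
  shows "0 \<le> clamped_profile a E F y" "clamped_profile a E F y \<le> 1"
proof -
  have "0 \<le> max a (y i)" for i using assms by (simp add: le_max_iff_disj)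
  then show "0 \<le> clamped_profile a E F y" "clamped_profile a E F y \<le> 1"
    unfolding clamped_profile_def by (intro profile_nonneg profile_le_1; simp)+
qed

lemma clamped_profile_tendsto:
  assumes "0 < a" "finite V" "E \<subseteq> Pow V" "F \<subseteq> Pow V" and y: "\<And>i. i \<in> V \<Longrightarrow> (\<lambda>n. y n i) \<longlonglongrightarrow> y0 i"
  shows "(\<lambda>n. clamped_profile a E F (y n)) \<longlonglongrightarrow> clamped_profile a E F y0"
proof -
  have w: "(\<lambda>n. edge_weight (\<lambda>i. max a (y n i)) e) \<longlonglongrightarrow> edge_weight (\<lambda>i. max a (y0 i)) e" if "e \<subseteq> V" for e
    unfolding edge_weight_def using that by (intro tendsto_prod tendsto_max tendsto_const y) auto
  have nz: "1 + edge_weight (\<lambda>i. max a (y0 i)) e \<noteq> 0" for e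
  proof -
    have "0 \<le> edge_weight (\<lambda>i. max a (y0 i)) e"
      using assms(1) by (intro edge_weight_nonneg) (simp add: le_max_iff_disj)
    then show ?thesis by linarith
  qed
  show ?thesis unfolding clamped_profile_def profile_def
    using assms nz by (intro tendsto_mult tendsto_prod tendsto_divide tendsto_add tendsto_const w) auto
qed

lemma clamped_profile_measurable:
  assumes "E \<subseteq> Pow V" "F \<subseteq> Pow V"
  shows "clamped_profile a E F \<in> borel_measurable (PiM V (\<lambda>_. borel))"
proof -
  have w: "(\<lambda>y. edge_weight (\<lambda>i. max a (y i)) e) \<in> borel_measurable (PiM V (\<lambda>_. borel))" if "e \<subseteq> V" for e
    unfolding edge_weight_def using that
    by (intro borel_measurable_prod borel_measurable_max measurable_const measurable_component_singleton) auto
  show ?thesis unfolding clamped_profile_def[abs_def] profile_def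
    using assms by (intro borel_measurable_times borel_measurable_prod borel_measurable_divide borel_measurable_add borel_measurable_const w) auto
qed

lemma profile_measurable:
  assumes "E \<subseteq> Pow V" "F \<subseteq> Pow V"
  shows "(\<lambda>x. profile x E F) \<in> borel_measurable (PiM V (\<lambda>_. lborel))"
proof -
  have w: "(\<lambda>y. edge_weight y e) \<in> borel_measurable (PiM V (\<lambda>_. lborel))" if "e \<subseteq> V" for e
    unfolding edge_weight_def using that by (intro borel_measurable_prod) (auto intro!: measurable_component_singleton simp flip: measurable_lborel1)
  show ?thesis unfolding profile_def
    using assms by (intro borel_measurable_times borel_measurable_prod borel_measurable_divide borel_measurable_add borel_measurable_const w) auto
qed

section \<open>Truncated power laws\<close>

lemma power_integral:
  fixes a b s :: real
  assumes "0 < a" "a \<le> b" "s \<noteq> 1"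
  shows "(\<integral>\<^sup>+t. ennreal (t powr (- s)) * indicator {a..b} t \<partial>lborel) = ennreal ((a powr (1 - s) - b powr (1 - s)) / (s - 1))"
proof -
  let ?F = "\<lambda>t. - (t powr (1 - s)) / (s - 1)"
  have "(\<integral>\<^sup>+t. ennreal (t powr (- s)) * indicator {a..b} t \<partial>lborel) = ennreal (?F b - ?F a)"
  proof (rule nn_integral_FTC_Icc[OF _ _ _ assms(2)])
    fix t assume t: "t \<in> {a..b}"
    then have "0 < t" using assms by simp
    have "(?F has_real_derivative - ((1 - s) * t powr (1 - s - 1)) / (s - 1)) (at t)"
      by (intro DERIV_cdivide DERIV_minus has_real_derivative_powr \<open>0 < t\<close>)
    moreover have "- ((1 - s) * t powr (1 - s - 1)) / (s - 1) = t powr (- s)"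
      using assms by (simp add: field_simps)
    ultimately show "(?F has_real_derivative t powr (- s)) (at t)" by simp
  qed auto
  also have "?F b - ?F a = (a powr (1 - s) - b powr (1 - s)) / (s - 1)"
    by (simp add: diff_divide_distrib)
  finally show ?thesis .
qed

lemma A_integrand_profile:
  "A_integrand \<tau> k E x = (\<Prod>i\<in>{1..k}. x i) powr (- \<tau>) * profile x E ([{1..k}]\<^bsup>2\<^esup> - E)"
  by (simp add: A_integrand_def profile_def edge_weight_def mult.assoc)

definition truncated_integral :: "real \<Rightarrow> nat \<Rightarrow> nat set set \<Rightarrow> real \<Rightarrow> real \<Rightarrow> ennreal" where
  "truncated_integral \<tau> k E a b =
     (\<integral>\<^sup>+ x. ennreal (A_integrand \<tau> k E x) * indicator ({1..k} \<rightarrow>\<^sub>E {a..b}) x \<partial>(Pi\<^sub>M {1..k} (\<lambda>_. lborel)))"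

text \<open>The power law of exponent \<tau> conditioned on [a, b]. It arises as the limit law of
  the scaled degree of a uniformly chosen vertex among those with scaled degree in (a, b].\<close>

definition pareto :: "real \<Rightarrow> real \<Rightarrow> real \<Rightarrow> real measure" where
  "pareto \<tau> a b = density lborel (\<lambda>t. ennreal ((\<tau> - 1) / (a powr (1 - \<tau>) - b powr (1 - \<tau>)) * t powr (- \<tau>)) * indicator {a..b} t)"

lemma pareto_mass_pos:
  assumes "0 < a" "a < b" "1 < (\<tau> :: real)"
  shows "0 < a powr (1 - \<tau>) - b powr (1 - \<tau>)"
  using powr_less_mono2_neg[of "1 - \<tau>" a b] assms by simp

lemma emeasure_pareto:
  assumes "0 < a" "a < b" "1 < \<tau>" "a \<le> x"
  shows "emeasure (pareto \<tau> a b) {..x} =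
    ennreal ((a powr (1 - \<tau>) - (min b x) powr (1 - \<tau>)) / (a powr (1 - \<tau>) - b powr (1 - \<tau>)))"
proof -
  let ?h = "a powr (1 - \<tau>) - b powr (1 - \<tau>)"
  have h: "0 < ?h" by (rule pareto_mass_pos) (use assms in auto)
  have "emeasure (pareto \<tau> a b) {..x} = (\<integral>\<^sup>+t. ennreal ((\<tau> - 1) / ?h * t powr (- \<tau>)) * indicator {a..b} t * indicator {..x} t \<partial>lborel)"
    unfolding pareto_def by (intro emeasure_density) auto
  also have "\<dots> = (\<integral>\<^sup>+t. ennreal ((\<tau> - 1) / ?h) * (ennreal (t powr (- \<tau>)) * indicator {a..min b x} t) \<partial>lborel)"
    using h assms by (intro nn_integral_cong) (auto simp: indicator_def ennreal_mult[symmetric])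
  also have "\<dots> = ennreal ((\<tau> - 1) / ?h) * ennreal ((a powr (1 - \<tau>) - (min b x) powr (1 - \<tau>)) / (\<tau> - 1))"
    using assms by (subst nn_integral_cmult) (auto simp: power_integral)
  also have "\<dots> = ennreal ((\<tau> - 1) / ?h * ((a powr (1 - \<tau>) - (min b x) powr (1 - \<tau>)) / (\<tau> - 1)))"
    using h assms by (intro ennreal_mult[symmetric]) (auto intro!: divide_nonneg_nonneg powr_mono2')
  also have "(\<tau> - 1) / ?h * ((a powr (1 - \<tau>) - (min b x) powr (1 - \<tau>)) / (\<tau> - 1)) = (a powr (1 - \<tau>) - (min b x) powr (1 - \<tau>)) / ?h"
    using assms by simp
  finally show ?thesis .
qed

lemma emeasure_pareto_below:
  assumes "x < a"
  shows "emeasure (pareto \<tau> a b) {..x} = 0"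
proof -
  have "emeasure (pareto \<tau> a b) {..x} = (\<integral>\<^sup>+t. ennreal ((\<tau> - 1) / (a powr (1 - \<tau>) - b powr (1 - \<tau>)) * t powr (- \<tau>)) * indicator {a..b} t * indicator {..x} t \<partial>lborel)"
    unfolding pareto_def by (intro emeasure_density) auto
  also have "\<dots> = (\<integral>\<^sup>+t. 0 \<partial>(lborel :: real measure))"
    using assms by (intro nn_integral_cong) (auto simp: indicator_def)
  finally show ?thesis by simp
qed

lemma real_distribution_pareto:
  assumes "0 < a" "a < b" "1 < \<tau>"
  shows "real_distribution (pareto \<tau> a b)"
proof (intro real_distribution.intro real_distribution_axioms.intro prob_spaceI)
  have h: "0 < a powr (1 - \<tau>) - b powr (1 - \<tau>)" by (rule pareto_mass_pos) (use assms in auto)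
  have "emeasure (pareto \<tau> a b) (space (pareto \<tau> a b)) =
    (\<integral>\<^sup>+t. ennreal ((\<tau> - 1) / (a powr (1 - \<tau>) - b powr (1 - \<tau>)) * t powr (- \<tau>)) * indicator {a..b} t * indicator UNIV t \<partial>lborel)"
    unfolding pareto_def by (subst emeasure_density) auto
  also have "\<dots> = (\<integral>\<^sup>+t. ennreal ((\<tau> - 1) / (a powr (1 - \<tau>) - b powr (1 - \<tau>)) * t powr (- \<tau>)) * indicator {a..b} t * indicator {..b} t \<partial>lborel)"
    by (intro nn_integral_cong) (auto simp: indicator_def)
  also have "\<dots> = emeasure (pareto \<tau> a b) {..b}"
    unfolding pareto_def by (intro emeasure_density[symmetric]) auto
  also have "\<dots> = 1" using emeasure_pareto[OF assms, of b] assms h by simp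
  finally show "emeasure (pareto \<tau> a b) (space (pareto \<tau> a b)) = 1" .
qed (simp_all add: pareto_def)

text \<open>The product of the densities supplies the factor (x1 ... xk)^(-\<tau>) of the integrand,
  and on [a, b] clamping from below at a changes nothing.\<close>

lemma integral_PiM_pareto:
  assumes ab: "0 < a" "a < b" "1 < \<tau>" and E: "E \<subseteq> [{1..k}]\<^bsup>2\<^esup>"
  shows "(\<integral>x. clamped_profile a E ([{1..k}]\<^bsup>2\<^esup> - E) x \<partial>PiM {1..k} (\<lambda>_. pareto \<tau> a b))
    = ((\<tau> - 1) / (a powr (1 - \<tau>) - b powr (1 - \<tau>))) ^ k * enn2real (truncated_integral \<tau> k E a b)"
proof -
  let ?V = "{1..k}" and ?h = "a powr (1 - \<tau>) - b powr (1 - \<tau>)"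
  let ?F = "[?V]\<^bsup>2\<^esup> - E"
  let ?g = "clamped_profile a E ?F"
  let ?f = "\<lambda>t. ennreal ((\<tau> - 1) / ?h * t powr (- \<tau>)) * indicator {a..b} t"
  have h: "0 < ?h" by (rule pareto_mass_pos) (use ab in auto)
  interpret R: real_distribution "pareto \<tau> a b" by (rule real_distribution_pareto[OF ab])
  have EF: "E \<subseteq> Pow ?V" "?F \<subseteq> Pow ?V" using E by (auto simp: nsets_def)
  have gb: "?g \<in> borel_measurable (PiM ?V (\<lambda>_. borel))" by (rule clamped_profile_measurable[OF EF])
  then have gm: "?g \<in> borel_measurable (PiM ?V (\<lambda>_. pareto \<tau> a b))" and gl: "?g \<in> borel_measurable (PiM ?V (\<lambda>_. lborel))"
    by (simp_all add: R.events_eq_borel cong: measurable_cong_sets sets_PiM_cong)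
  have PM: "PiM ?V (\<lambda>_. pareto \<tau> a b) = density (PiM ?V (\<lambda>_. lborel)) (\<lambda>x. \<Prod>i\<in>?V. ?f (x i))"
    unfolding pareto_def
  proof (rule PiM_density)
    show "sigma_finite_measure (density lborel ?f)"
      using R.sigma_finite_measure_axioms by (simp add: pareto_def)
  qed (auto intro: lborel.sigma_finite_measure_axioms)
  have "(\<integral>x. ?g x \<partial>PiM ?V (\<lambda>_. pareto \<tau> a b)) = enn2real (\<integral>\<^sup>+x. ennreal (?g x) \<partial>PiM ?V (\<lambda>_. pareto \<tau> a b))"
    using clamped_profile_bound(1)[OF ab(1)] by (intro integral_eq_nn_integral gm) auto
  also have "(\<integral>\<^sup>+x. ennreal (?g x) \<partial>PiM ?V (\<lambda>_. pareto \<tau> a b)) = (\<integral>\<^sup>+x. (\<Prod>i\<in>?V. ?f (x i)) * ennreal (?g x) \<partial>PiM ?V (\<lambda>_. lborel))"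
    unfolding PM
  proof (rule nn_integral_density)
    show "(\<lambda>x. \<Prod>i\<in>?V. ?f (x i)) \<in> borel_measurable (PiM ?V (\<lambda>_. lborel))"
    proof (rule borel_measurable_prod_ennreal)
      fix i assume "i \<in> ?V"
      show "(\<lambda>x. ?f (x i)) \<in> borel_measurable (PiM ?V (\<lambda>_. lborel))"
        by (rule measurable_compose[OF measurable_component_singleton[OF \<open>i \<in> ?V\<close>]]) measurable
    qed
  qed (use gl in measurable)
  also have "\<dots> = (\<integral>\<^sup>+x. ennreal (((\<tau> - 1) / ?h) ^ k) * (ennreal (A_integrand \<tau> k E x) * indicator (?V \<rightarrow>\<^sub>E {a..b}) x) \<partial>PiM ?V (\<lambda>_. lborel))"
  proof (rule nn_integral_cong)
    fix x assume "x \<in> space (PiM ?V (\<lambda>_. lborel :: real measure))"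
    then have x: "x \<in> extensional ?V" by (simp add: space_PiM PiE_def)
    show "(\<Prod>i\<in>?V. ?f (x i)) * ennreal (?g x) = ennreal (((\<tau> - 1) / ?h) ^ k) * (ennreal (A_integrand \<tau> k E x) * indicator (?V \<rightarrow>\<^sub>E {a..b}) x)"
    proof (cases "\<forall>i\<in>?V. x i \<in> {a..b}")
      case True
      then have xin: "x \<in> ?V \<rightarrow>\<^sub>E {a..b}" using x by (auto simp: PiE_def)
      have xp: "0 \<le> x i" "max a (x i) = x i" if "i \<in> ?V" for i
      proof -
        have "a \<le> x i" using True that by auto
        then show "0 \<le> x i" "max a (x i) = x i" using ab by auto
      qed
      have g: "?g x = profile x E ?F"
        unfolding clamped_profile_def by (rule profile_cong[OF _ EF]) (rule xp)
      have "(\<Prod>i\<in>?V. ?f (x i)) = (\<Prod>i\<in>?V. ennreal ((\<tau> - 1) / ?h * x i powr (- \<tau>)))"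
        using True by (intro prod.cong refl) simp
      also have "\<dots> = ennreal (\<Prod>i\<in>?V. (\<tau> - 1) / ?h * x i powr (- \<tau>))"
        using h ab by (intro prod_ennreal) auto
      also have "(\<Prod>i\<in>?V. (\<tau> - 1) / ?h * x i powr (- \<tau>)) = ((\<tau> - 1) / ?h) ^ k * (\<Prod>i\<in>?V. x i) powr (- \<tau>)"
        unfolding prod.distrib prod_powr_distrib by simp
      finally have "(\<Prod>i\<in>?V. ?f (x i)) * ennreal (?g x) = ennreal (((\<tau> - 1) / ?h) ^ k * (\<Prod>i\<in>?V. x i) powr (- \<tau>) * profile x E ?F)"
        using clamped_profile_bound(1)[OF ab(1), of E ?F x] h ab unfolding g
        by (simp add: ennreal_mult[symmetric])
      also have "\<dots> = ennreal (((\<tau> - 1) / ?h) ^ k) * ennreal (A_integrand \<tau> k E x)"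
        using clamped_profile_bound(1)[OF ab(1), of E ?F x] h ab unfolding g
        by (simp add: ennreal_mult[symmetric] A_integrand_profile mult.assoc)
      finally show ?thesis using xin by simp
    next
      case False
      then obtain i where i: "i \<in> ?V" "x i \<notin> {a..b}" by auto
      then have "(\<Prod>i\<in>?V. ?f (x i)) = 0" by (intro prod_zero) (auto intro!: bexI[of _ i])
      moreover have "x \<notin> ?V \<rightarrow>\<^sub>E {a..b}" using i by auto
      ultimately show ?thesis by simp
    qed
  qed
  also have "\<dots> = ennreal (((\<tau> - 1) / ?h) ^ k) * truncated_integral \<tau> k E a b"
    unfolding truncated_integral_def
  proof (rule nn_integral_cmult)
    have "(\<lambda>x. (\<Prod>i\<in>?V. x i) powr (- \<tau>)) \<in> borel_measurable (PiM ?V (\<lambda>_. lborel))"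
      by measurable
    moreover have "(\<lambda>x. profile x E ?F) \<in> borel_measurable (PiM ?V (\<lambda>_. lborel))"
      by (rule profile_measurable[OF EF])
    ultimately have "A_integrand \<tau> k E \<in> borel_measurable (PiM ?V (\<lambda>_. lborel))"
      unfolding A_integrand_profile[abs_def] by (intro borel_measurable_times)
    moreover have "?V \<rightarrow>\<^sub>E {a..b} \<in> sets (PiM ?V (\<lambda>_. lborel))"
      by (intro sets_PiM_I_finite) auto
    ultimately show "(\<lambda>x. ennreal (A_integrand \<tau> k E x) * indicator (?V \<rightarrow>\<^sub>E {a..b}) x) \<in> borel_measurable (PiM ?V (\<lambda>_. lborel))"
      by measurable
  qed
  finally show ?thesis using h ab by (simp add: enn2real_mult)
qed

section \<open>Tuples of vertices of degree about sqrt n\<close>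

context power_law_degrees
begin

text \<open>Half-open, so that its size is a difference of two strict tail counts and its complement
  consists of a strict upper tail and a closed lower one.\<close>

definition core :: "nat \<Rightarrow> real \<Rightarrow> real \<Rightarrow> nat set" where
  "core n a b = {i\<in>{1..n}. a < X n i \<and> X n i \<le> b}"

text \<open>In units of \<open>z n\<close>, the scaled degrees have limiting density \<kappa>
  t^(-\<tau>): minus the derivative of the limiting tail C (t sqrt \<mu>)^(1 - \<tau>).\<close>

definition \<kappa> :: real where "\<kappa> = C * (\<tau> - 1) / \<mu> powr ((\<tau> - 1) / 2)"

abbreviation "z n \<equiv> real n powr ((3 - \<tau>) / 2)"

lemma \<kappa>_pos: "0 < \<kappa>" using params by (simp add: \<kappa>_def)

lemma finite_core [simp]: "finite (core n a b)" by (simp add: core_def)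

lemma core_tail_lim:
  assumes "0 < a" "a \<le> t" "t \<le> b"
  shows "(\<lambda>n. real (card {i \<in> core n a b. t < X n i}) / z n) \<longlonglongrightarrow> \<kappa> * ((t powr (1 - \<tau>) - b powr (1 - \<tau>)) / (\<tau> - 1))"
proof -
  have lim: "(\<lambda>n. real (card {i\<in>{1..n}. x < X n i}) / z n) \<longlonglongrightarrow> \<kappa> * (x powr (1 - \<tau>) / (\<tau> - 1))" if "0 < x" for x
  proof -
    have "sqrt \<mu> powr (1 - \<tau>) = \<mu> powr ((1 - \<tau>) / 2)"
      using params by (simp add: powr_half_sqrt[symmetric] powr_powr)
    also have "(1 - \<tau>) / 2 = - ((\<tau> - 1) / 2)" by (metis minus_diff_eq minus_divide_left)
    also have "\<mu> powr (- ((\<tau> - 1) / 2)) = 1 / \<mu> powr ((\<tau> - 1) / 2)" by (rule powr_minus_divide)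
    finally have sq: "sqrt \<mu> powr (1 - \<tau>) = 1 / \<mu> powr ((\<tau> - 1) / 2)" .
    have "(x * sqrt \<mu>) powr (1 - \<tau>) = x powr (1 - \<tau>) * sqrt \<mu> powr (1 - \<tau>)"
      using that params by (simp add: powr_mult)
    then have "C * (x * sqrt \<mu>) powr (1 - \<tau>) = \<kappa> * (x powr (1 - \<tau>) / (\<tau> - 1))"
      unfolding sq \<kappa>_def using params by simp
    then show ?thesis using scaled_tail_lim[OF that] by simp
  qed
  have "real (card {i \<in> core n a b. t < X n i}) = real (card {i\<in>{1..n}. t < X n i}) - real (card {i\<in>{1..n}. b < X n i})" for n
  proof -
    have "{i \<in> core n a b. t < X n i} = {i\<in>{1..n}. t < X n i} - {i\<in>{1..n}. b < X n i}"
      using assms by (auto simp: core_def)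
    moreover have "{i\<in>{1..n}. b < X n i} \<subseteq> {i\<in>{1..n}. t < X n i}" using assms by auto
    ultimately show ?thesis by (simp add: card_Diff_subset card_mono of_nat_diff)
  qed
  then have "(\<lambda>n. real (card {i \<in> core n a b. t < X n i}) / z n)
     = (\<lambda>n. real (card {i\<in>{1..n}. t < X n i}) / z n - real (card {i\<in>{1..n}. b < X n i}) / z n)"
    by (simp add: diff_divide_distrib)
  also have "\<dots> \<longlonglongrightarrow> \<kappa> * (t powr (1 - \<tau>) / (\<tau> - 1)) - \<kappa> * (b powr (1 - \<tau>) / (\<tau> - 1))"
    using assms by (intro tendsto_diff lim) auto
  finally show ?thesis by (simp add: diff_divide_distrib right_diff_distrib)
qed

lemma core_card_lim:
  assumes "0 < a" "a \<le> b"
  shows "(\<lambda>n. real (card (core n a b)) / z n) \<longlonglongrightarrow> \<kappa> * ((a powr (1 - \<tau>) - b powr (1 - \<tau>)) / (\<tau> - 1))"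
proof -
  have "{i \<in> core n a b. a < X n i} = core n a b" for n by (auto simp: core_def)
  then show ?thesis using core_tail_lim[of a a b] assms by simp
qed

text \<open>The sum is the k-th power of the core size times the mean of the profile over k
  independent uniform core vertices. The size is asymptotic to \<kappa> h / (\<tau> - 1) times
  \<open>z n\<close>, and the mean tends to an integral against \<open>pareto\<close>, whose
  normalisation (\<tau> - 1) / h cancels all but \<kappa>.\<close>

lemma core_sum_lim:
  assumes ab: "0 < a" "a < b" and E: "E \<subseteq> [{1..k}]\<^bsup>2\<^esup>"
  shows "(\<lambda>n. (\<Sum>v\<in>{1..k} \<rightarrow>\<^sub>E core n a b. profile (\<lambda>i. X n (v i)) E ([{1..k}]\<^bsup>2\<^esup> - E)) / z n ^ k)
     \<longlonglongrightarrow> \<kappa> ^ k * enn2real (truncated_integral \<tau> k E a b)"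
proof -
  let ?V = "{1..k}"
  let ?F = "[?V]\<^bsup>2\<^esup> - E"
  let ?g = "clamped_profile a E ?F"
  define h where "h = a powr (1 - \<tau>) - b powr (1 - \<tau>)"
  have \<tau>: "1 < \<tau>" using params by simp
  have h: "0 < h" unfolding h_def by (rule pareto_mass_pos[OF ab \<tau>])
  have EF: "E \<subseteq> Pow ?V" "?F \<subseteq> Pow ?V" using E by (auto simp: nsets_def)
  let ?H = "\<kappa> * (h / (\<tau> - 1))"
  have H: "0 < ?H" using \<kappa>_pos h \<tau> by simp
  have clim: "(\<lambda>n. real (card (core n a b)) / z n) \<longlonglongrightarrow> ?H"
    using core_card_lim[of a b] ab by (simp add: h_def)
  obtain n0 where n0: "\<And>n. n0 \<le> n \<Longrightarrow> core n a b \<noteq> {}"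
  proof -
    have "\<forall>\<^sub>F n in sequentially. 0 < real (card (core n a b)) / z n"
      using order_tendstoD(1)[OF clim H] .
    then obtain n0 where "\<And>n. n0 \<le> n \<Longrightarrow> 0 < real (card (core n a b)) / z n"
      by (auto simp: eventually_sequentially)
    then have "core n a b \<noteq> {}" if "n0 \<le> n" for n using that by fastforce
    then show thesis by (rule that)
  qed
  \<comment> \<open>Shifted past the indices with empty core, since the coupling asks for a
    probability measure at every index.\<close>
  define m where "m = (\<lambda>n. n + n0)"
  define \<nu> where "\<nu> = (\<lambda>n. distr (uniform_count_measure (core (m n) a b)) borel (X (m n)))"
  have ne: "core (m n) a b \<noteq> {}" for n by (rule n0) (simp add: m_def)
  have \<nu>: "real_distribution (\<nu> n)" for n
    unfolding \<nu>_def
    by (intro prob_space.real_distribution_distr prob_space_uniform_count_measure finite_core ne) simp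
  have cdf\<nu>: "cdf (\<nu> n) x = real (card {i \<in> core (m n) a b. X (m n) i \<le> x}) / real (card (core (m n) a b))" for n x
  proof -
    have "cdf (\<nu> n) x = measure (uniform_count_measure (core (m n) a b)) (X (m n) -` {..x} \<inter> core (m n) a b)"
      unfolding cdf_def \<nu>_def by (subst measure_distr) (auto simp: space_uniform_count_measure)
    also have "X (m n) -` {..x} \<inter> core (m n) a b = {i \<in> core (m n) a b. X (m n) i \<le> x}" by auto
    also have "measure (uniform_count_measure (core (m n) a b)) \<dots> = real (card {i \<in> core (m n) a b. X (m n) i \<le> x}) / real (card (core (m n) a b))"
      by (rule measure_uniform_count_measure) auto
    finally show ?thesis .
  qed
  have wc: "weak_conv_m \<nu> (pareto \<tau> a b)"
    unfolding weak_conv_m_def weak_conv_def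
  proof (intro allI impI)
    fix x
    show "(\<lambda>n. cdf (\<nu> n) x) \<longlonglongrightarrow> cdf (pareto \<tau> a b) x"
    proof (cases "a \<le> x")
      case False
      have "{i \<in> core (m n) a b. X (m n) i \<le> x} = {}" for n using False by (auto simp: core_def)
      then have "cdf (\<nu> n) x = 0" for n by (simp add: cdf\<nu> del: Collect_empty_eq)
      moreover have "cdf (pareto \<tau> a b) x = 0"
        using emeasure_pareto_below[of x a \<tau> b] False by (simp add: cdf_def measure_def)
      ultimately show ?thesis by simp
    next
      case True
      \<comment> \<open>Beyond b both distribution functions are 1, as at b.\<close>
      let ?y = "min b x"
      have y: "a \<le> ?y" "?y \<le> b" using True ab by auto
      have "cdf (\<nu> n) x = 1 - (real (card {i \<in> core (m n) a b. ?y < X (m n) i}) / z (m n)) / (real (card (core (m n) a b)) / z (m n))" for n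
      proof -
        have "{i \<in> core (m n) a b. X (m n) i \<le> x} = core (m n) a b - {i \<in> core (m n) a b. ?y < X (m n) i}"
          by (auto simp: core_def)
        then have "real (card {i \<in> core (m n) a b. X (m n) i \<le> x}) = real (card (core (m n) a b)) - real (card {i \<in> core (m n) a b. ?y < X (m n) i})"
          by (simp only:) (subst card_Diff_subset, auto intro!: of_nat_diff card_mono)
        moreover have "0 < card (core (m n) a b)" using ne[of n] by (simp add: card_gt_0_iff)
        moreover have "0 < z (m n)"
        proof -
          have "m n \<noteq> 0" using ne[of n] by (auto simp: core_def)
          then show ?thesis by simp
        qed
        ultimately show ?thesis using ne[of n] by (simp add: cdf\<nu> diff_divide_distrib)
      qed
      moreover have "(\<lambda>n. 1 - (real (card {i \<in> core (m n) a b. ?y < X (m n) i}) / z (m n)) / (real (card (core (m n) a b)) / z (m n)))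
         \<longlonglongrightarrow> 1 - \<kappa> * ((?y powr (1 - \<tau>) - b powr (1 - \<tau>)) / (\<tau> - 1)) / ?H"
        unfolding m_def using H
        by (intro tendsto_diff tendsto_const tendsto_divide
              LIMSEQ_ignore_initial_segment[OF core_tail_lim[OF ab(1) y]] LIMSEQ_ignore_initial_segment[OF clim]) auto
      moreover have "1 - \<kappa> * ((?y powr (1 - \<tau>) - b powr (1 - \<tau>)) / (\<tau> - 1)) / ?H = cdf (pareto \<tau> a b) x"
      proof -
        have "cdf (pareto \<tau> a b) x = (a powr (1 - \<tau>) - ?y powr (1 - \<tau>)) / h"
          using emeasure_pareto[OF ab \<tau> True] h y ab \<tau> unfolding h_def[symmetric]
          by (simp add: cdf_def measure_def powr_mono2')
        also have "\<dots> = 1 - (?y powr (1 - \<tau>) - b powr (1 - \<tau>)) / h"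
          using h by (simp add: field_simps) (simp add: h_def)
        also have "\<dots> = 1 - \<kappa> * ((?y powr (1 - \<tau>) - b powr (1 - \<tau>)) / (\<tau> - 1)) / ?H"
          using \<kappa>_pos h \<tau> by simp
        finally show ?thesis by simp
      qed
      ultimately show ?thesis by simp
    qed
  qed
  have gm: "?g \<in> borel_measurable (PiM ?V (\<lambda>_. borel))" by (rule clamped_profile_measurable[OF EF])
  have "(\<lambda>n. \<integral>y. ?g y \<partial>PiM ?V (\<lambda>_. \<nu> n)) \<longlonglongrightarrow> (\<integral>y. ?g y \<partial>PiM ?V (\<lambda>_. pareto \<tau> a b))"
  proof (rule weak_conv_PiM[OF _ \<nu> real_distribution_pareto[OF ab \<tau>] wc gm])
    show "\<bar>?g y\<bar> \<le> 1" for y using clamped_profile_bound[OF ab(1), of E ?F y] by simp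
    show "(\<lambda>n. ?g (y n)) \<longlonglongrightarrow> ?g y0" if "\<And>i. i \<in> ?V \<Longrightarrow> (\<lambda>n. y n i) \<longlonglongrightarrow> y0 i" for y y0
      by (rule clamped_profile_tendsto[OF ab(1) _ EF that]) auto
  qed auto
  then have "(\<lambda>n. (real (card (core (m n) a b)) / z (m n)) ^ k * (\<integral>y. ?g y \<partial>PiM ?V (\<lambda>_. \<nu> n)))
      \<longlonglongrightarrow> ?H ^ k * (\<integral>y. ?g y \<partial>PiM ?V (\<lambda>_. pareto \<tau> a b))"
    unfolding m_def by (intro tendsto_mult tendsto_power LIMSEQ_ignore_initial_segment[OF clim])
  also have "?H ^ k * (\<integral>y. ?g y \<partial>PiM ?V (\<lambda>_. pareto \<tau> a b)) = \<kappa> ^ k * enn2real (truncated_integral \<tau> k E a b)"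
  proof -
    have "?H ^ k * ((\<tau> - 1) / h) ^ k = \<kappa> ^ k"
      unfolding power_mult_distrib[symmetric] using h \<tau> by simp
    then show ?thesis unfolding integral_PiM_pareto[OF ab \<tau> E] h_def[symmetric] by (simp add: mult.assoc[symmetric])
  qed
  also have "(\<lambda>n. (real (card (core (m n) a b)) / z (m n)) ^ k * (\<integral>y. ?g y \<partial>PiM ?V (\<lambda>_. \<nu> n)))
    = (\<lambda>n. (\<Sum>v\<in>?V \<rightarrow>\<^sub>E core (m n) a b. profile (\<lambda>i. X (m n) (v i)) E ?F) / z (m n) ^ k)"
  proof
    fix n
    have "(\<integral>y. ?g y \<partial>PiM ?V (\<lambda>_. \<nu> n)) = (\<Sum>v\<in>?V \<rightarrow>\<^sub>E core (m n) a b. ?g (compose ?V (X (m n)) v)) / real (card (core (m n) a b)) ^ card ?V"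
      unfolding \<nu>_def by (intro integral_PiM_uniform_count finite_core ne gm) simp
    also have "(\<Sum>v\<in>?V \<rightarrow>\<^sub>E core (m n) a b. ?g (compose ?V (X (m n)) v)) = (\<Sum>v\<in>?V \<rightarrow>\<^sub>E core (m n) a b. profile (\<lambda>i. X (m n) (v i)) E ?F)"
    proof (rule sum.cong[OF refl])
      fix v assume v: "v \<in> ?V \<rightarrow>\<^sub>E core (m n) a b"
      show "?g (compose ?V (X (m n)) v) = profile (\<lambda>i. X (m n) (v i)) E ?F"
        unfolding clamped_profile_def
      proof (rule profile_cong[OF _ EF])
        fix i assume "i \<in> ?V"
        then have "v i \<in> core (m n) a b" using v by auto
        then show "max a (compose ?V (X (m n)) v i) = X (m n) (v i)"
          using \<open>i \<in> ?V\<close> by (simp add: compose_def core_def)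
      qed
    qed
    finally have eq: "(\<integral>y. ?g y \<partial>PiM ?V (\<lambda>_. \<nu> n)) = (\<Sum>v\<in>?V \<rightarrow>\<^sub>E core (m n) a b. profile (\<lambda>i. X (m n) (v i)) E ?F) / real (card (core (m n) a b)) ^ k"
      by simp
    have "0 < card (core (m n) a b)" using ne[of n] by (simp add: card_gt_0_iff)
    then show "(real (card (core (m n) a b)) / z (m n)) ^ k * (\<integral>y. ?g y \<partial>PiM ?V (\<lambda>_. \<nu> n))
       = (\<Sum>v\<in>?V \<rightarrow>\<^sub>E core (m n) a b. profile (\<lambda>i. X (m n) (v i)) E ?F) / z (m n) ^ k"
      unfolding eq using ne[of n] by (simp add: power_divide)
  qed
  finally show ?thesis unfolding m_def by (rule LIMSEQ_offset)
qed

end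

section \<open>Integrability and the contribution of extreme degrees\<close>

lemma dominator_le_1:
  assumes "0 < t" "t \<le> 1"
  shows "dominator \<tau> c t = t powr (\<tau> - 1 + c)"
  using assms by (simp add: dominator_def powr_def exp_add[symmetric] algebra_simps)

lemma dominator_ge_1:
  assumes "1 \<le> t"
  shows "dominator \<tau> c t = t powr (\<tau> - 1 - c)"
  using assms by (simp add: dominator_def powr_def exp_add[symmetric] algebra_simps)

lemma dominator_nonneg: "0 \<le> dominator \<tau> c t"
  by (simp add: dominator_def)

lemma dominator_measurable [measurable]: "dominator \<tau> c \<in> borel_measurable borel"
  unfolding dominator_def[abs_def] by measurable

text \<open>Against t^(-\<tau>) the dominator becomes t^(c - 1) below 1 and t^(-1 - c) above 1; each
  side integrates to at most 1 / c, whatever a and b are.\<close>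

lemma dominator_integral:
  assumes c: "0 < c" and ab: "0 < a" "a \<le> 1" "1 \<le> b"
  shows "(\<integral>\<^sup>+t. ennreal (t powr (- \<tau>) * dominator \<tau> c t) * indicator {a..b} t \<partial>lborel) \<le> ennreal (2 / c)"
proof -
  have "(\<integral>\<^sup>+t. ennreal (t powr (- \<tau>) * dominator \<tau> c t) * indicator {a..b} t \<partial>lborel)
    \<le> (\<integral>\<^sup>+t. ennreal (t powr (- (1 - c))) * indicator {a..1} t + ennreal (t powr (- (1 + c))) * indicator {1..b} t \<partial>lborel)"
  proof (rule nn_integral_mono)
    fix t :: real
    have "t powr (- \<tau>) * dominator \<tau> c t = t powr (- (1 - c))" if "0 < t" "t \<le> 1"
      unfolding dominator_le_1[OF that] powr_add[symmetric] by simp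
    moreover have "t powr (- \<tau>) * dominator \<tau> c t = t powr (- (1 + c))" if "1 \<le> t"
      unfolding dominator_ge_1[OF that] powr_add[symmetric] by simp
    ultimately show "ennreal (t powr (- \<tau>) * dominator \<tau> c t) * indicator {a..b} t
      \<le> ennreal (t powr (- (1 - c))) * indicator {a..1} t + ennreal (t powr (- (1 + c))) * indicator {1..b} t"
      using ab by (cases "t \<le> 1") (auto simp: indicator_def)
  qed
  also have "\<dots> = ennreal ((a powr (1 - (1 - c)) - 1 powr (1 - (1 - c))) / (1 - c - 1)) + ennreal ((1 powr (1 - (1 + c)) - b powr (1 - (1 + c))) / (1 + c - 1))"
  proof (subst nn_integral_add)
    have s: "1 - c \<noteq> 1" "1 + c \<noteq> 1" "(0::real) < 1" using c by auto
    show "(\<integral>\<^sup>+t. ennreal (t powr (- (1 - c))) * indicator {a..1} t \<partial>lborel) + (\<integral>\<^sup>+t. ennreal (t powr (- (1 + c))) * indicator {1..b} t \<partial>lborel)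
      = ennreal ((a powr (1 - (1 - c)) - 1 powr (1 - (1 - c))) / (1 - c - 1)) + ennreal ((1 powr (1 - (1 + c)) - b powr (1 - (1 + c))) / (1 + c - 1))"
      by (simp only: power_integral[OF ab(1,2) s(1)] power_integral[OF s(3) ab(3) s(2)])
  qed auto
  also have "\<dots> \<le> ennreal (1 / c) + ennreal (1 / c)"
  proof (intro add_mono ennreal_leI)
    show "(a powr (1 - (1 - c)) - 1 powr (1 - (1 - c))) / (1 - c - 1) \<le> 1 / c"
      using c by (simp add: field_simps)
    show "(1 powr (1 - (1 + c)) - b powr (1 - (1 + c))) / (1 + c - 1) \<le> 1 / c"
      using c by (simp add: field_simps)
  qed
  also have "\<dots> = ennreal (2 / c)" using c by (simp add: ennreal_plus[symmetric] del: ennreal_plus)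
  finally show ?thesis .
qed

text \<open>From here on the optimization problem is represented by its consequence, the linear
  decay of \<open>exponent\<close>.\<close>

locale optimal_pattern = power_law_degrees +
  fixes k :: nat and E :: "nat set set"
  assumes k_pos: "0 < k" and E: "E \<subseteq> [{1..k}]\<^bsup>2\<^esup>"
    and decay: "\<exists>c>0. \<forall>y. exponent \<tau> {1..k} E y \<le> - c * (\<Sum>i\<in>{1..k}. \<bar>y i\<bar>)"
begin

abbreviation "V \<equiv> {1..k}"
abbreviation "F \<equiv> [{1..k}]\<^bsup>2\<^esup> - E"

definition full_integral :: ennreal where
  "full_integral = (\<integral>\<^sup>+ x. ennreal (A_integrand \<tau> k E x) * indicator (V \<rightarrow>\<^sub>E {0<..}) x \<partial>(Pi\<^sub>M V (\<lambda>_. lborel)))"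

lemma A_const_eq: "A_const \<tau> C \<mu> k E = ennreal (\<kappa> ^ k) * full_integral"
  by (simp add: A_const_def full_integral_def \<kappa>_def)

lemma EF: "E \<subseteq> Pow V" "F \<subseteq> Pow V"
  using E by (auto simp: nsets_def)

lemma domination:
  obtains c where "0 < c" "c < \<tau> - 1"
    "\<And>x. (\<And>i. i \<in> V \<Longrightarrow> 0 < x i) \<Longrightarrow> profile x E F \<le> (\<Prod>i\<in>V. dominator \<tau> c (x i))"
proof -
  from decay obtain c0 where c0: "0 < c0" "\<And>y. exponent \<tau> V E y \<le> - c0 * (\<Sum>i\<in>V. \<bar>y i\<bar>)" by blast
  \<comment> \<open>A smaller c is still admissible. Keeping it below \<tau> - 1 makes the power
    \<tau> - 1 - c of the dominator above 1 positive, as the dyadic estimate for large degrees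
    requires.\<close>
  define c where "c = min c0 ((\<tau> - 1) / 2)"
  have c: "0 < c" "c < \<tau> - 1" "c \<le> c0" using c0 params by (auto simp: c_def min_def)
  have dec: "exponent \<tau> V E y \<le> - c * (\<Sum>i\<in>V. \<bar>y i\<bar>)" for y
  proof -
    have "c * (\<Sum>i\<in>V. \<bar>y i\<bar>) \<le> c0 * (\<Sum>i\<in>V. \<bar>y i\<bar>)" using c by (intro mult_right_mono sum_nonneg) auto
    then show ?thesis using c0(2)[of y] by simp
  qed
  show thesis
    by (rule that[OF c(1,2)]) (rule profile_le_dominator[OF finite_atLeastAtMost E dec], simp)
qed

lemma A_integrand_measurable: "A_integrand \<tau> k E \<in> borel_measurable (PiM V (\<lambda>_. lborel))"
proof -
  have "(\<lambda>x. (\<Prod>i\<in>V. x i) powr (- \<tau>)) \<in> borel_measurable (PiM V (\<lambda>_. lborel))"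
    by measurable
  then show ?thesis
    unfolding A_integrand_profile[abs_def] by (intro borel_measurable_times profile_measurable EF)
qed

text \<open>The domination by a product separates the variables, so by Tonelli the bound is the k-th
  power of a one-dimensional one and is uniform in the truncation.\<close>

lemma truncated_integral_bound:
  obtains B where "\<And>a b. \<lbrakk>0 < a; a \<le> 1; 1 \<le> b\<rbrakk> \<Longrightarrow> truncated_integral \<tau> k E a b \<le> ennreal B"
proof -
  obtain c where c: "0 < c" "c < \<tau> - 1"
    "\<And>x. (\<And>i. i \<in> V \<Longrightarrow> 0 < x i) \<Longrightarrow> profile x E F \<le> (\<Prod>i\<in>V. dominator \<tau> c (x i))"
    using domination by blast
  interpret L: product_sigma_finite "\<lambda>_::nat. lborel :: real measure" by standard
  show thesis
  proof (rule that[of "(2 / c) ^ k"])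
    fix a b :: real assume ab: "0 < a" "a \<le> 1" "1 \<le> b"
    let ?f = "\<lambda>t. ennreal (t powr (- \<tau>) * dominator \<tau> c t) * indicator {a..b} t"
    have "truncated_integral \<tau> k E a b \<le> (\<integral>\<^sup>+x. (\<Prod>i\<in>V. ?f (x i)) \<partial>PiM V (\<lambda>_. lborel))"
      unfolding truncated_integral_def
    proof (rule nn_integral_mono)
      fix x :: "nat \<Rightarrow> real"
      show "ennreal (A_integrand \<tau> k E x) * indicator (V \<rightarrow>\<^sub>E {a..b}) x \<le> (\<Prod>i\<in>V. ?f (x i))"
      proof (cases "x \<in> V \<rightarrow>\<^sub>E {a..b}")
        case True
        then have xi: "x i \<in> {a..b}" if "i \<in> V" for i using that by auto
        then have xp: "0 < x i" if "i \<in> V" for i using ab that by force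
        have "A_integrand \<tau> k E x \<le> (\<Prod>i\<in>V. x i) powr (- \<tau>) * (\<Prod>i\<in>V. dominator \<tau> c (x i))"
          unfolding A_integrand_profile by (intro mult_left_mono c(3) xp) auto
        also have "\<dots> = (\<Prod>i\<in>V. x i powr (- \<tau>) * dominator \<tau> c (x i))"
          unfolding prod.distrib prod_powr_distrib ..
        finally have "ennreal (A_integrand \<tau> k E x) \<le> ennreal (\<Prod>i\<in>V. x i powr (- \<tau>) * dominator \<tau> c (x i))"
          by (rule ennreal_leI)
        also have "\<dots> = (\<Prod>i\<in>V. ennreal (x i powr (- \<tau>) * dominator \<tau> c (x i)))"
          by (intro prod_ennreal[symmetric] mult_nonneg_nonneg dominator_nonneg) auto
        also have "\<dots> = (\<Prod>i\<in>V. ?f (x i))" using xi by (intro prod.cong) auto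
        finally show ?thesis using True by simp
      qed simp
    qed
    also have "\<dots> = (\<Prod>i\<in>V. integral\<^sup>N lborel ?f)"
      by (intro L.product_nn_integral_prod) auto
    also have "\<dots> \<le> (\<Prod>i\<in>V. ennreal (2 / c))"
      by (intro prod_mono_ennreal dominator_integral c ab)
    also have "\<dots> = ennreal ((2 / c) ^ k)" using c by (simp add: ennreal_power)
    finally show "truncated_integral \<tau> k E a b \<le> ennreal ((2 / c) ^ k)" .
  qed
qed

text \<open>Monotone convergence along boxes exhausting the positive orthant. The offset 2 makes
  every interval proper, with 1 inside, from m = 0 on.\<close>

lemma truncated_integral_lim:
  "(\<lambda>m. truncated_integral \<tau> k E (1 / (real m + 2)) (real m + 2)) \<longlonglongrightarrow> full_integral"
  unfolding truncated_integral_def full_integral_def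
proof (rule nn_integral_LIMSEQ)
  let ?S = "\<lambda>m. {1 / (real m + 2)..real m + 2}"
  have mono: "V \<rightarrow>\<^sub>E ?S m \<subseteq> V \<rightarrow>\<^sub>E ?S m'" if "m \<le> m'" for m m'
  proof (rule PiE_mono)
    have "1 / (real m' + 2) \<le> 1 / (real m + 2)" using that by (intro divide_left_mono) auto
    then show "?S m \<subseteq> ?S m'" using that by auto
  qed
  show "incseq (\<lambda>m x. ennreal (A_integrand \<tau> k E x) * indicator (V \<rightarrow>\<^sub>E ?S m) x)"
  proof (intro incseq_SucI le_funI)
    fix m x
    show "ennreal (A_integrand \<tau> k E x) * indicator (V \<rightarrow>\<^sub>E ?S m) x \<le> ennreal (A_integrand \<tau> k E x) * indicator (V \<rightarrow>\<^sub>E ?S (Suc m)) x"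
      using mono[of m "Suc m"] by (cases "x \<in> V \<rightarrow>\<^sub>E ?S m") (simp_all add: subset_iff)
  qed
  show "(\<lambda>x. ennreal (A_integrand \<tau> k E x) * indicator (V \<rightarrow>\<^sub>E ?S m) x) \<in> borel_measurable (PiM V (\<lambda>_. lborel))" for m
  proof -
    have "V \<rightarrow>\<^sub>E ?S m \<in> sets (PiM V (\<lambda>_. lborel))" by (intro sets_PiM_I_finite) auto
    then show ?thesis using A_integrand_measurable by measurable
  qed
  fix x
  show "(\<lambda>m. ennreal (A_integrand \<tau> k E x) * indicator (V \<rightarrow>\<^sub>E ?S m) x) \<longlonglongrightarrow> ennreal (A_integrand \<tau> k E x) * indicator (V \<rightarrow>\<^sub>E {0<..}) x"
  proof (rule tendsto_eventually)
    show "\<forall>\<^sub>F m in sequentially. ennreal (A_integrand \<tau> k E x) * indicator (V \<rightarrow>\<^sub>E ?S m) x = ennreal (A_integrand \<tau> k E x) * indicator (V \<rightarrow>\<^sub>E {0<..}) x"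
    proof (cases "x \<in> V \<rightarrow>\<^sub>E {0<..}")
      case True
      have "\<forall>\<^sub>F m in sequentially. \<forall>i\<in>V. x i \<in> ?S m"
      proof (intro eventually_ball_finite ballI)
        fix i assume "i \<in> V"
        then have xi: "0 < x i" using True by auto
        have "\<forall>\<^sub>F m in sequentially. 1 / (real m + 2) < x i"
          by (rule order_tendstoD(2)[OF _ xi]) real_asymp
        moreover have "\<forall>\<^sub>F m in sequentially. x i < real m + 2"
          using eventually_gt_at_top[of "nat \<lceil>x i\<rceil>"] by eventually_elim linarith
        ultimately show "\<forall>\<^sub>F m in sequentially. x i \<in> ?S m" by eventually_elim auto
      qed auto
      then show ?thesis
      proof eventually_elim
        case (elim m)
        then have "x \<in> V \<rightarrow>\<^sub>E ?S m" using True by (auto simp: PiE_def)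
        then show ?case using True by simp
      qed
    next
      case False
      have "x \<notin> V \<rightarrow>\<^sub>E ?S m" for m
      proof
        assume x: "x \<in> V \<rightarrow>\<^sub>E ?S m"
        have "?S m \<subseteq> {0<..}"
        proof
          fix t assume "t \<in> ?S m"
          then have "1 / (real m + 2) \<le> t" by simp
          from order_less_le_trans[OF _ this] show "t \<in> {0<..}" by simp
        qed
        then have "x \<in> V \<rightarrow>\<^sub>E {0<..}" using x PiE_mono[of V "\<lambda>_. ?S m" "\<lambda>_. {0<..}"] by blast
        with False show False ..
      qed
      then show ?thesis using False by simp
    qed
  qed
qed

lemma full_integral_finite: "full_integral < \<infinity>"
proof -
  obtain B where B: "\<And>a b. \<lbrakk>0 < a; a \<le> 1; 1 \<le> b\<rbrakk> \<Longrightarrow> truncated_integral \<tau> k E a b \<le> ennreal B"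
    using truncated_integral_bound by blast
  have "full_integral \<le> ennreal B"
    by (rule LIMSEQ_le_const2[OF truncated_integral_lim]) (auto intro!: exI[of _ 0] B)
  also have "\<dots> < \<infinity>" by simp
  finally show ?thesis .
qed

lemma A_const_finite: "A_const \<tau> C \<mu> k E < \<infinity>"
  using full_integral_finite by (simp add: A_const_eq ennreal_mult_less_top)

lemma truncated_A_lim:
  "(\<lambda>m. \<kappa> ^ k * enn2real (truncated_integral \<tau> k E (1 / (real m + 2)) (real m + 2))) \<longlonglongrightarrow> enn2real (A_const \<tau> C \<mu> k E)"
proof -
  have "(\<lambda>m. enn2real (truncated_integral \<tau> k E (1 / (real m + 2)) (real m + 2))) \<longlonglongrightarrow> enn2real full_integral"
  proof (rule tendsto_enn2real)
    show "(\<lambda>m. truncated_integral \<tau> k E (1 / (real m + 2)) (real m + 2)) \<longlonglongrightarrow> ennreal (enn2real full_integral)"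
      using truncated_integral_lim full_integral_finite by simp
  qed simp
  then show ?thesis using \<kappa>_pos by (simp add: A_const_eq enn2real_mult tendsto_mult_left)
qed

text \<open>The tail exponent is \<tau> - 1. Above R the dominator has the smaller power \<tau> - 1
  - c and below 1 / R the larger power \<tau> - 1 + c, so the two dyadic estimates each leave
  R^(-c).\<close>

lemma outer_dominator_sum:
  assumes c: "0 < c" "c < \<tau> - 1"
  obtains Q where "0 \<le> Q" "\<And>n R. \<lbrakk>2 \<le> n; 1 \<le> R\<rbrakk> \<Longrightarrow>
    (\<Sum>i\<in>{1..n} - core n (1 / R) R. dominator \<tau> c (X n i)) \<le> Q * z n * R powr (- c)"
proof -
  obtain K where K: "1 \<le> K"
    "\<And>n x. 2 \<le> n \<Longrightarrow> 0 < x \<Longrightarrow> real (card {i\<in>{1..n}. x < X n i}) \<le> (K * z n) * x powr (- (\<tau> - 1))"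
    using scaled_tail by blast
  define Q where "Q = K * 2 powr (\<tau> - 1 - c) / (1 - 2 powr (- c)) + K * 2 powr (\<tau> - 1) / (1 - 2 powr (- c))"
  have q: "0 < 1 - 2 powr (- c)" using c by (simp add: powr_less_one)
  show thesis
  proof (rule that)
    show "0 \<le> Q" using q K by (simp add: Q_def)
    fix n :: nat and R :: real assume n: "2 \<le> n" and R: "1 \<le> R"
    let ?A = "{i\<in>{1..n}. R < X n i}" and ?B = "{i\<in>{1..n}. X n i \<le> 1 / R}"
    have Kz: "0 \<le> K * z n" using K by simp
    have R1: "1 / R \<le> 1" "0 < 1 / R" using R by auto
    have "{1..n} - core n (1 / R) R = ?A \<union> ?B" by (auto simp: core_def)
    moreover have "?A \<inter> ?B = {}"
    proof -
      have "1 / R \<le> R" using R R1 by linarith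
      then show ?thesis by fastforce
    qed
    ultimately have "(\<Sum>i\<in>{1..n} - core n (1 / R) R. dominator \<tau> c (X n i)) = (\<Sum>i\<in>?A. dominator \<tau> c (X n i)) + (\<Sum>i\<in>?B. dominator \<tau> c (X n i))"
      by (simp add: sum.union_disjoint)
    moreover have "(\<Sum>i\<in>?A. dominator \<tau> c (X n i)) \<le> K * 2 powr (\<tau> - 1 - c) / (1 - 2 powr (- c)) * z n * R powr (- c)"
    proof -
      have "(\<Sum>i\<in>?A. dominator \<tau> c (X n i)) = (\<Sum>i\<in>?A. X n i powr (\<tau> - 1 - c))"
        using R by (intro sum.cong refl dominator_ge_1) auto
      also have "\<dots> \<le> (K * z n) * 2 powr (\<tau> - 1 - c) * R powr (\<tau> - 1 - c - (\<tau> - 1)) / (1 - 2 powr (\<tau> - 1 - c - (\<tau> - 1)))"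
        using c R by (intro tail_sum_powr K(2) Kz X_pos n) auto
      finally show ?thesis by (simp add: mult_ac)
    qed
    moreover have "(\<Sum>i\<in>?B. dominator \<tau> c (X n i)) \<le> K * 2 powr (\<tau> - 1) / (1 - 2 powr (- c)) * z n * R powr (- c)"
    proof -
      have "(\<Sum>i\<in>?B. dominator \<tau> c (X n i)) = (\<Sum>i\<in>?B. X n i powr (\<tau> - 1 + c))"
      proof (intro sum.cong refl dominator_le_1)
        fix i assume "i \<in> ?B"
        then have "i \<in> {1..n}" "X n i \<le> 1 / R" by auto
        then show "0 < X n i" "X n i \<le> 1" using X_pos[OF n] order_trans[OF _ R1(1)] by auto
      qed
      also have "\<dots> \<le> (K * z n) * 2 powr (\<tau> - 1) * (1 / R) powr (\<tau> - 1 + c - (\<tau> - 1)) / (1 - 2 powr (\<tau> - 1 - (\<tau> - 1 + c)))"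
        using c R1 params by (intro head_sum_powr K(2) Kz X_pos n) auto
      also have "(1 / R) powr (\<tau> - 1 + c - (\<tau> - 1)) = R powr (- c)"
        using R by (simp add: powr_divide powr_minus_divide)
      finally show ?thesis by (simp add: mult_ac)
    qed
    ultimately show "(\<Sum>i\<in>{1..n} - core n (1 / R) R. dominator \<tau> c (X n i)) \<le> Q * z n * R powr (- c)"
      by (simp add: Q_def algebra_simps)
  qed
qed

text \<open>A tuple outside the core has some coordinate outside it. For each such coordinate the
  dominating product separates: that coordinate yields R^(-c), the other k - 1 are summed over all
  vertices.\<close>

lemma outer_profile_sum:
  obtains Q c where "0 \<le> Q" "0 < c" "\<And>n R. \<lbrakk>2 \<le> n; 1 \<le> R\<rbrakk> \<Longrightarrow>
    (\<Sum>v\<in>(V \<rightarrow>\<^sub>E {1..n}) - (V \<rightarrow>\<^sub>E core n (1 / R) R). profile (\<lambda>i. X n (v i)) E F) \<le> Q * z n ^ k * R powr (- c)"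
proof -
  obtain c where c: "0 < c" "c < \<tau> - 1"
    "\<And>x. (\<And>i. i \<in> V \<Longrightarrow> 0 < x i) \<Longrightarrow> profile x E F \<le> (\<Prod>i\<in>V. dominator \<tau> c (x i))"
    using domination by blast
  obtain Q where Q: "0 \<le> Q" "\<And>n R. \<lbrakk>2 \<le> n; 1 \<le> R\<rbrakk> \<Longrightarrow>
    (\<Sum>i\<in>{1..n} - core n (1 / R) R. dominator \<tau> c (X n i)) \<le> Q * z n * R powr (- c)"
    using outer_dominator_sum[OF c(1,2)] by blast
  show thesis
  proof (rule that)
    show "0 \<le> real k * Q ^ k" "0 < c" using Q c by auto
    fix n :: nat and R :: real assume n: "2 \<le> n" and R: "1 \<le> R"
    let ?h = "\<lambda>u. dominator \<tau> c (X n u)" and ?core = "core n (1 / R) R"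
    let ?O = "(V \<rightarrow>\<^sub>E {1..n}) - (V \<rightarrow>\<^sub>E ?core)"
    \<comment> \<open>For R = 1 the core (1, 1] is empty, so the estimate for outer vertices covers
      all vertices.\<close>
    have all: "(\<Sum>u\<in>{1..n}. ?h u) \<le> Q * z n"
    proof -
      have "core n (1 / 1) 1 = {}" by (auto simp: core_def)
      then show ?thesis using Q(2)[OF n, of 1] by simp
    qed
    have fin: "finite (V \<rightarrow>\<^sub>E {1..n})" by (intro finite_PiE) auto
    have one: "(\<Sum>v\<in>V \<rightarrow>\<^sub>E {1..n}. of_bool (v i \<notin> ?core) * (\<Prod>j\<in>V. ?h (v j))) \<le> Q ^ k * z n ^ k * R powr (- c)" if i: "i \<in> V" for i
    proof -
      \<comment> \<open>Attaching the indicator to the i-th factor keeps the summand a product over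
        coordinates.\<close>
      let ?g = "\<lambda>j u. (if j = i then of_bool (u \<notin> ?core) else 1) * ?h u"
      have "(\<Sum>v\<in>V \<rightarrow>\<^sub>E {1..n}. of_bool (v i \<notin> ?core) * (\<Prod>j\<in>V. ?h (v j))) = (\<Sum>v\<in>V \<rightarrow>\<^sub>E {1..n}. \<Prod>j\<in>V. ?g j (v j))"
        using i by (simp add: prod.distrib prod.delta)
      also have "\<dots> = (\<Prod>j\<in>V. \<Sum>u\<in>{1..n}. ?g j u)"
        by (rule prod_sum_PiE[symmetric]) auto
      also have "\<dots> = (\<Sum>u\<in>{1..n}. ?g i u) * (\<Prod>j\<in>V - {i}. \<Sum>u\<in>{1..n}. ?g j u)"
        using i by (intro prod.remove) auto
      also have "(\<Prod>j\<in>V - {i}. \<Sum>u\<in>{1..n}. ?g j u) = (\<Sum>u\<in>{1..n}. ?h u) ^ (k - 1)"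
        using i by simp
      also have "(\<Sum>u\<in>{1..n}. ?g i u) = (\<Sum>u\<in>{1..n} - ?core. ?h u)"
        by (intro sum.mono_neutral_cong_right) auto
      also have "(\<Sum>u\<in>{1..n} - ?core. ?h u) * (\<Sum>u\<in>{1..n}. ?h u) ^ (k - 1) \<le> (Q * z n * R powr (- c)) * (Q * z n) ^ (k - 1)"
        using Q(1) by (intro mult_mono Q(2) n R power_mono all sum_nonneg zero_le_power dominator_nonneg) auto
      also have "\<dots> = (Q * z n) ^ Suc (k - 1) * R powr (- c)" by simp
      also have "Suc (k - 1) = k" using i by simp
      finally show ?thesis by (simp add: power_mult_distrib)
    qed
    have "(\<Sum>v\<in>?O. profile (\<lambda>i. X n (v i)) E F) \<le> (\<Sum>v\<in>?O. \<Sum>i\<in>V. of_bool (v i \<notin> ?core) * (\<Prod>j\<in>V. ?h (v j)))"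
    proof (rule sum_mono)
      fix v assume v: "v \<in> ?O"
      then obtain i where i: "i \<in> V" "v i \<notin> ?core" by (auto simp: PiE_def Pi_def)
      have "profile (\<lambda>i. X n (v i)) E F \<le> (\<Prod>j\<in>V. ?h (v j))"
      proof (rule c(3))
        fix j assume "j \<in> V"
        then have "v j \<in> {1..n}" using v by auto
        then show "0 < X n (v j)" by (rule X_pos[OF n])
      qed
      also have "\<dots> = of_bool (v i \<notin> ?core) * (\<Prod>j\<in>V. ?h (v j))" using i by simp
      also have "\<dots> \<le> (\<Sum>i\<in>V. of_bool (v i \<notin> ?core) * (\<Prod>j\<in>V. ?h (v j)))"
        using i by (intro member_le_sum mult_nonneg_nonneg prod_nonneg ballI dominator_nonneg) auto
      finally show "profile (\<lambda>i. X n (v i)) E F \<le> (\<Sum>i\<in>V. of_bool (v i \<notin> ?core) * (\<Prod>j\<in>V. ?h (v j)))" .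
    qed
    also have "\<dots> \<le> (\<Sum>v\<in>V \<rightarrow>\<^sub>E {1..n}. \<Sum>i\<in>V. of_bool (v i \<notin> ?core) * (\<Prod>j\<in>V. ?h (v j)))"
      using fin by (intro sum_mono2 sum_nonneg mult_nonneg_nonneg prod_nonneg ballI dominator_nonneg) auto
    also have "\<dots> = (\<Sum>i\<in>V. \<Sum>v\<in>V \<rightarrow>\<^sub>E {1..n}. of_bool (v i \<notin> ?core) * (\<Prod>j\<in>V. ?h (v j)))"
      by (rule sum.swap)
    also have "\<dots> \<le> (\<Sum>i\<in>V. Q ^ k * z n ^ k * R powr (- c))" by (intro sum_mono one)
    finally show "(\<Sum>v\<in>?O. profile (\<lambda>i. X n (v i)) E F) \<le> real k * Q ^ k * z n ^ k * R powr (- c)"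
      by (simp add: mult.assoc)
  qed
qed

end

section \<open>Induced embeddings\<close>

text \<open>A coordinate forced by the others costs one power of |S|. A repetition within a tuple
  and a vertex shared with a fixed tuple are both of this kind.\<close>

lemma card_PiE_determined:
  assumes V: "finite V" "j \<in> V" and S: "finite S" and A: "A \<subseteq> V \<rightarrow>\<^sub>E S"
    and det: "\<And>v. v \<in> A \<Longrightarrow> v j = f (restrict v (V - {j}))"
  shows "card A \<le> card S ^ (card V - 1)"
proof -
  have "card A \<le> card ((V - {j}) \<rightarrow>\<^sub>E S)"
  proof (rule card_inj_on_le[where f = "\<lambda>v. restrict v (V - {j})"])
    show "inj_on (\<lambda>v. restrict v (V - {j})) A"
    proof (rule inj_onI)
      fix v w assume vw: "v \<in> A" "w \<in> A" "restrict v (V - {j}) = restrict w (V - {j})"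
      then have "v j = w j" using det[of v] det[of w] by simp
      moreover have "v i = w i" if "i \<in> V - {j}" for i
        using fun_cong[OF vw(3), of i] that by simp
      ultimately show "v = w"
        using vw(1,2) A by (intro PiE_ext[of v V "\<lambda>_. S" w]) auto
    qed
    show "(\<lambda>v. restrict v (V - {j})) ` A \<subseteq> (V - {j}) \<rightarrow>\<^sub>E S"
    proof (intro image_subsetI)
      fix v assume "v \<in> A"
      then have "v \<in> V \<rightarrow>\<^sub>E S" using A by blast
      then show "restrict v (V - {j}) \<in> (V - {j}) \<rightarrow>\<^sub>E S" by (auto simp: restrict_PiE_iff)
    qed
    show "finite ((V - {j}) \<rightarrow>\<^sub>E S)" using V S by (intro finite_PiE) auto
  qed
  also have "\<dots> = card S ^ (card V - 1)" using V by (simp add: card_PiE)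
  finally show ?thesis .
qed

lemma card_not_inj_PiE:
  assumes V: "finite V" and S: "finite S"
  shows "card {v \<in> V \<rightarrow>\<^sub>E S. \<not> inj_on v V} \<le> (card V)\<^sup>2 * card S ^ (card V - 1)"
proof -
  let ?P = "{(i, j). i \<in> V \<and> j \<in> V \<and> i \<noteq> j}"
  have P: "?P \<subseteq> V \<times> V" by auto
  then have fP: "finite ?P" by (rule finite_subset) (use V in simp)
  have "card ?P \<le> card (V \<times> V)" by (rule card_mono[OF _ P]) (use V in simp)
  then have cP: "card ?P \<le> (card V)\<^sup>2" by (simp add: card_cartesian_product power2_eq_square)
  have "{v \<in> V \<rightarrow>\<^sub>E S. \<not> inj_on v V} \<subseteq> (\<Union>p\<in>?P. {v \<in> V \<rightarrow>\<^sub>E S. v (snd p) = v (fst p)})"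
    by (auto simp: inj_on_def)
  then have "card {v \<in> V \<rightarrow>\<^sub>E S. \<not> inj_on v V} \<le> card (\<Union>p\<in>?P. {v \<in> V \<rightarrow>\<^sub>E S. v (snd p) = v (fst p)})"
    using V S fP by (intro card_mono) (auto intro!: finite_PiE)
  also have "\<dots> \<le> (\<Sum>p\<in>?P. card {v \<in> V \<rightarrow>\<^sub>E S. v (snd p) = v (fst p)})"
    by (rule card_UN_le[OF fP])
  also have "\<dots> \<le> (\<Sum>p\<in>?P. card S ^ (card V - 1))"
  proof (rule sum_mono)
    fix p assume p: "p \<in> ?P"
    show "card {v \<in> V \<rightarrow>\<^sub>E S. v (snd p) = v (fst p)} \<le> card S ^ (card V - 1)"
      by (rule card_PiE_determined[of V "snd p" S _ "\<lambda>r. r (fst p)"]) (use p V S in auto)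
  qed
  also have "\<dots> = card ?P * card S ^ (card V - 1)" by simp
  also have "\<dots> \<le> (card V)\<^sup>2 * card S ^ (card V - 1)" by (rule mult_right_mono[OF cP]) simp
  finally show ?thesis .
qed

lemma card_meeting_PiE:
  assumes V: "finite V" and S: "finite S"
  shows "card {w \<in> V \<rightarrow>\<^sub>E S. v ` V \<inter> w ` V \<noteq> {}} \<le> (card V)\<^sup>2 * card S ^ (card V - 1)"
proof -
  let ?P = "V \<times> V"
  have fP: "finite ?P" using V by simp
  have "{w \<in> V \<rightarrow>\<^sub>E S. v ` V \<inter> w ` V \<noteq> {}} \<subseteq> (\<Union>p\<in>?P. {w \<in> V \<rightarrow>\<^sub>E S. w (snd p) = v (fst p)})"
    by force
  then have "card {w \<in> V \<rightarrow>\<^sub>E S. v ` V \<inter> w ` V \<noteq> {}} \<le> card (\<Union>p\<in>?P. {w \<in> V \<rightarrow>\<^sub>E S. w (snd p) = v (fst p)})"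
    using V S fP by (intro card_mono) (auto intro!: finite_PiE)
  also have "\<dots> \<le> (\<Sum>p\<in>?P. card {w \<in> V \<rightarrow>\<^sub>E S. w (snd p) = v (fst p)})"
    by (rule card_UN_le[OF fP])
  also have "\<dots> \<le> (\<Sum>p\<in>?P. card S ^ (card V - 1))"
  proof (rule sum_mono)
    fix p assume p: "p \<in> ?P"
    show "card {w \<in> V \<rightarrow>\<^sub>E S. w (snd p) = v (fst p)} \<le> card S ^ (card V - 1)"
      by (rule card_PiE_determined[of V "snd p" S _ "\<lambda>r. v (fst p)"]) (use p V S in auto)
  qed
  also have "\<dots> = (card V)\<^sup>2 * card S ^ (card V - 1)"
    using V by (simp add: card_cartesian_product power2_eq_square)
  finally show ?thesis .
qed

lemma nsets2_obtain:
  assumes "e \<in> [A]\<^bsup>2\<^esup>"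
  obtains i j where "e = {i, j}" "i \<noteq> j" "i \<in> A" "j \<in> A"
  using assms by (auto simp: nsets_def card_2_iff)

lemma edge_weight_image: "inj_on v e \<Longrightarrow> edge_weight x (v ` e) = edge_weight (\<lambda>i. x (v i)) e"
  by (simp add: edge_weight_def prod.reindex)

lemma profile_image:
  assumes v: "inj_on v V" and EF: "E \<subseteq> Pow V" "F \<subseteq> Pow V"
  shows "profile x ((`) v ` E) ((`) v ` F) = profile (\<lambda>i. x (v i)) E F"
proof -
  have inj: "inj_on ((`) v) E" "inj_on ((`) v) F"
    using inj_on_image_Pow[OF v] EF by (auto intro: inj_on_subset)
  have "edge_weight x (v ` e) = edge_weight (\<lambda>i. x (v i)) e" if "e \<subseteq> V" for e
    by (rule edge_weight_image) (use v that in \<open>auto intro: inj_on_subset\<close>)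
  then show ?thesis unfolding profile_def prod.reindex[OF inj(1)] prod.reindex[OF inj(2)] o_def
    using EF by (intro arg_cong2[where f = "(*)"] prod.cong) auto
qed

lemma profile_Un:
  assumes "finite A" "finite A'" "finite B" "finite B'" "A \<inter> A' = {}" "B \<inter> B' = {}"
  shows "profile x (A \<union> A') (B \<union> B') = profile x A B * profile x A' B'"
  using assms by (simp add: profile_def prod.union_disjoint)

section \<open>Induced copies as prescribed edges and non-edges\<close>

context optimal_pattern
begin

abbreviation "graphs n \<equiv> graphs_with_degrees n (d n)"

definition embeddings :: "nat set \<Rightarrow> (nat \<Rightarrow> nat) set" where
  "embeddings S = {v \<in> V \<rightarrow>\<^sub>E S. inj_on v V}"

definition induced :: "(nat \<Rightarrow> nat) \<Rightarrow> nat set set \<Rightarrow> bool" where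
  "induced v G \<longleftrightarrow> (\<forall>i\<in>V. \<forall>j\<in>V. i \<noteq> j \<longrightarrow> ({v i, v j} \<in> G \<longleftrightarrow> {i, j} \<in> E))"

text \<open>A quotient of numbers of graphs is the form in which switchings yield their estimates;
  \<open>URG_prob\<close> identifies it with the law of the random graph for n \<ge> 2.\<close>

definition prob :: "nat \<Rightarrow> (nat set set \<Rightarrow> bool) \<Rightarrow> real" where
  "prob n P = real (card {G \<in> graphs n. P G}) / real (card (graphs n))"

definition weight :: "nat \<Rightarrow> (nat \<Rightarrow> nat) \<Rightarrow> real" where
  "weight n v = profile (\<lambda>i. X n (v i)) E F"

lemma weight_nonneg: "0 \<le> weight n v"
  unfolding weight_def by (rule profile_nonneg) simp

lemma weight_le_1: "weight n v \<le> 1"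
  unfolding weight_def by (rule profile_le_1) simp

lemma finite_embeddings: "finite S \<Longrightarrow> finite (embeddings S)"
  unfolding embeddings_def by (rule finite_subset[of _ "V \<rightarrow>\<^sub>E S"]) (blast, simp add: finite_PiE)

lemma finite_EF: "finite E" "finite F"
  using E by (auto intro: finite_subset simp: finite_imp_finite_nsets)

lemma induced_count_eq: "induced_count k E n G = card {v \<in> embeddings {1..n}. induced v G}"
  unfolding induced_count_def embeddings_def induced_def by (rule arg_cong[where f = card]) auto

lemma card_graphs_pos: "2 \<le> n \<Longrightarrow> 0 < card (graphs n)"
  using graphs_nonempty finite_graphs_with_degrees by (simp add: card_gt_0_iff)

lemma induced_iff:
  assumes "inj_on v V"
  shows "induced v G \<longleftrightarrow> (`) v ` E \<subseteq> G \<and> G \<inter> (`) v ` F = {}"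
proof
  assume ind: "induced v G"
  have "v ` e \<in> G \<longleftrightarrow> e \<in> E" if "e \<in> [V]\<^bsup>2\<^esup>" for e
  proof -
    from that obtain i j where e: "e = {i, j}" "i \<noteq> j" "i \<in> V" "j \<in> V" by (rule nsets2_obtain)
    then have "{v i, v j} \<in> G \<longleftrightarrow> {i, j} \<in> E" using ind unfolding induced_def by blast
    then show ?thesis using e(1) by simp
  qed
  then show "(`) v ` E \<subseteq> G \<and> G \<inter> (`) v ` F = {}" using E by blast
next
  assume R: "(`) v ` E \<subseteq> G \<and> G \<inter> (`) v ` F = {}"
  show "induced v G"
    unfolding induced_def
  proof (intro ballI impI)
    fix i j assume ij: "i \<in> V" "j \<in> V" "i \<noteq> j"
    then have e: "{i, j} \<in> [V]\<^bsup>2\<^esup>" by (simp add: nsets_def)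
    show "{v i, v j} \<in> G \<longleftrightarrow> {i, j} \<in> E"
    proof (cases "{i, j} \<in> E")
      case True
      then have "v ` {i, j} \<in> G" using R by (meson imageI subsetD)
      then show ?thesis using True by simp
    next
      case False
      with e have "v ` {i, j} \<in> (`) v ` F" by (intro imageI DiffI)
      moreover have "G \<inter> (`) v ` F = {}" using R by (rule conjunct2)
      ultimately have "v ` {i, j} \<notin> G" unfolding disjoint_iff by iprover
      then show ?thesis using False by simp
    qed
  qed
qed

lemma embedding_image:
  assumes "v \<in> embeddings {1..n}"
  shows "(`) v ` [V]\<^bsup>2\<^esup> \<subseteq> [{1..n}]\<^bsup>2\<^esup>" "(`) v ` E \<inter> (`) v ` F = {}"
    "card ((`) v ` E) \<le> card ([V]\<^bsup>2\<^esup>)" "card ((`) v ` F) \<le> card ([V]\<^bsup>2\<^esup>)"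
proof -
  have v: "v \<in> V \<rightarrow>\<^sub>E {1..n}" "inj_on v V" using assms by (auto simp: embeddings_def)
  show "(`) v ` [V]\<^bsup>2\<^esup> \<subseteq> [{1..n}]\<^bsup>2\<^esup>"
  proof
    fix e' assume "e' \<in> (`) v ` [V]\<^bsup>2\<^esup>"
    then obtain e where e: "e' = v ` e" "e \<subseteq> V" "card e = 2" "finite e" by (auto simp: nsets_def)
    moreover have "card (v ` e) = card e" using v(2) e(2) by (intro card_image) (rule inj_on_subset)
    ultimately show "e' \<in> [{1..n}]\<^bsup>2\<^esup>" using v(1) by (auto simp: nsets_def)
  qed
  have "E \<inter> F = {}" by auto
  then show "(`) v ` E \<inter> (`) v ` F = {}"
    using inj_on_image_Int[OF inj_on_image_Pow[OF v(2)] EF] by simp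
  have f2: "finite ([V]\<^bsup>2\<^esup>)" by (simp add: finite_imp_finite_nsets)
  show "card ((`) v ` E) \<le> card ([V]\<^bsup>2\<^esup>)"
    by (rule order_trans[OF card_image_le[OF finite_EF(1)] card_mono[OF f2 E]])
  show "card ((`) v ` F) \<le> card ([V]\<^bsup>2\<^esup>)"
    by (rule order_trans[OF card_image_le[OF finite_EF(2)] card_mono[OF f2 Diff_subset]])
qed

lemma profile_embedding:
  assumes "v \<in> embeddings S"
  shows "profile (X n) ((`) v ` E) ((`) v ` F) = weight n v"
  unfolding weight_def by (rule profile_image[OF _ EF]) (use assms in \<open>simp add: embeddings_def\<close>)

lemma prob_induced:
  assumes "v \<in> embeddings S"
  shows "{G \<in> graphs n. induced v G} = graphs_between n (d n) ((`) v ` E) ((`) v ` F)"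
  using assms induced_iff[of v] by (auto simp: graphs_between_def embeddings_def)

lemma prob_induced2:
  assumes "v \<in> embeddings S" "w \<in> embeddings S"
  shows "{G \<in> graphs n. induced v G \<and> induced w G}
    = graphs_between n (d n) ((`) v ` E \<union> (`) w ` E) ((`) v ` F \<union> (`) w ` F)"
  using assms induced_iff[of v] induced_iff[of w] by (auto simp: graphs_between_def embeddings_def)

lemma embeddings_disjoint_images:
  assumes "v ` V \<inter> w ` V = {}" "A \<subseteq> [V]\<^bsup>2\<^esup>" "B \<subseteq> [V]\<^bsup>2\<^esup>"
  shows "(`) v ` A \<inter> (`) w ` B = {}"
proof (rule ccontr)
  assume "(`) v ` A \<inter> (`) w ` B \<noteq> {}"
  then obtain e e' where e: "e \<in> A" "e' \<in> B" "v ` e = w ` e'" by auto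
  then have "e \<in> [V]\<^bsup>2\<^esup>" "e' \<in> [V]\<^bsup>2\<^esup>" using assms by blast+
  then have "e \<noteq> {}" "e \<subseteq> V" "e' \<subseteq> V" by (auto simp only: nsets_def mem_Collect_eq card.empty)
  then have ne: "v ` e \<noteq> {}" and sub: "v ` e \<subseteq> v ` V" "w ` e' \<subseteq> w ` V"
    by (simp_all add: image_mono)
  have "v ` e \<subseteq> v ` V \<inter> w ` V" using Int_greatest[OF sub(1)] sub(2) unfolding e(3) by simp
  then show False using ne unfolding assms(1) subset_empty by contradiction
qed

text \<open>What the moment computations draw from the switchings, with one \<delta> for all tuples.
  Pairs of tuples are disjoint, which makes their profile a product, and are bounded from above; a
  single tuple is bounded from both sides, from below if its degrees are at least m /
  \<eta>.\<close>

definition error_bound :: "(nat \<Rightarrow> real) \<Rightarrow> nat \<Rightarrow> bool" where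
  "error_bound \<delta> m \<longleftrightarrow> \<delta> \<longlonglongrightarrow> 0 \<and> (\<forall>n. 0 \<le> \<delta> n) \<and>
    (\<forall>n v. 2 \<le> n \<longrightarrow> \<delta> n < 1 \<longrightarrow> v \<in> embeddings {1..n} \<longrightarrow>
      (1 - \<delta> n) ^ (2 * m) * prob n (induced v) \<le> weight n v) \<and>
    (\<forall>n v w. 2 \<le> n \<longrightarrow> \<delta> n < 1 \<longrightarrow> v \<in> embeddings {1..n} \<longrightarrow> w \<in> embeddings {1..n} \<longrightarrow> v ` V \<inter> w ` V = {} \<longrightarrow>
      (1 - \<delta> n) ^ (2 * m) * prob n (\<lambda>G. induced v G \<and> induced w G) \<le> weight n v * weight n w) \<and>
    (\<forall>n v \<eta>. 2 \<le> n \<longrightarrow> \<delta> n < 1 \<longrightarrow> v \<in> embeddings {1..n} \<longrightarrow> 0 \<le> \<eta> \<longrightarrow> \<eta> \<le> 1 \<longrightarrow>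
      (\<forall>i\<in>V. real m \<le> \<eta> * real (d n (v i))) \<longrightarrow>
      (1 - \<delta> n) ^ (2 * m) * (1 - \<eta>) ^ (2 * m) * weight n v \<le> prob n (induced v))"

lemma error_boundD:
  assumes "error_bound \<delta> m"
  shows "\<delta> \<longlonglongrightarrow> 0" "0 \<le> \<delta> n"
    "\<lbrakk>2 \<le> n; \<delta> n < 1; v \<in> embeddings {1..n}\<rbrakk> \<Longrightarrow> (1 - \<delta> n) ^ (2 * m) * prob n (induced v) \<le> weight n v"
    "\<lbrakk>2 \<le> n; \<delta> n < 1; v \<in> embeddings {1..n}; w \<in> embeddings {1..n}; v ` V \<inter> w ` V = {}\<rbrakk> \<Longrightarrow>
      (1 - \<delta> n) ^ (2 * m) * prob n (\<lambda>G. induced v G \<and> induced w G) \<le> weight n v * weight n w"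
    "\<lbrakk>2 \<le> n; \<delta> n < 1; v \<in> embeddings {1..n}; 0 \<le> \<eta>; \<eta> \<le> 1; \<And>i. i \<in> V \<Longrightarrow> real m \<le> \<eta> * real (d n (v i))\<rbrakk> \<Longrightarrow>
      (1 - \<delta> n) ^ (2 * m) * (1 - \<eta>) ^ (2 * m) * weight n v \<le> prob n (induced v)"
proof -
  note eb = assms[unfolded error_bound_def]
  note r1 = conjunct2[OF eb]
  note r2 = conjunct2[OF r1]
  note r3 = conjunct2[OF r2]
  note h3 = conjunct1[OF r2] and h4 = conjunct1[OF r3] and h5 = conjunct2[OF r3]
  show "\<delta> \<longlonglongrightarrow> 0" by (rule conjunct1[OF eb])
  show "0 \<le> \<delta> n" by (rule conjunct1[OF r1, THEN spec])
  assume n: "2 \<le> n" "\<delta> n < 1" and v: "v \<in> embeddings {1..n}"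
  show "(1 - \<delta> n) ^ (2 * m) * prob n (induced v) \<le> weight n v"
    by (rule h3[rule_format, OF n v])
  show "(1 - \<delta> n) ^ (2 * m) * prob n (\<lambda>G. induced v G \<and> induced w G) \<le> weight n v * weight n w"
    if "w \<in> embeddings {1..n}" "v ` V \<inter> w ` V = {}"
    by (rule h4[rule_format, OF n v that])
  show "(1 - \<delta> n) ^ (2 * m) * (1 - \<eta>) ^ (2 * m) * weight n v \<le> prob n (induced v)"
    if "0 \<le> \<eta>" "\<eta> \<le> 1" "\<And>i. i \<in> V \<Longrightarrow> real m \<le> \<eta> * real (d n (v i))"
    by (rule h5[rule_format, OF n v that])
qed

lemma error_bound_exists:
  obtains \<delta> m where "error_bound \<delta> m"
proof -
  obtain \<Delta> S :: "nat \<Rightarrow> nat" where tpb: "\<And>n. 2 \<le> n \<Longrightarrow> two_path_bound n (d n) (\<Delta> n) (S n)"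
    and lim: "(\<lambda>n. real (\<Delta> n) / real n) \<longlonglongrightarrow> 0" "(\<lambda>n. real (S n) / real n) \<longlonglongrightarrow> 0"
    using two_path_bounds by blast
  \<comment> \<open>Two disjoint copies together prescribe at most twice as many pairs as there are
    in V.\<close>
  define m where "m = 2 * card ([V]\<^bsup>2\<^esup>)"
  \<comment> \<open>Twice the switching loss relative to n; since n \<le> L this also bounds it
    relative to L.\<close>
  define \<delta> where "\<delta> = (\<lambda>n. 2 * real (2 * S n + 2 * (4 + 4 * m) * \<Delta> n) / real n)"
  have cond: "2 * real (2 * S n + 2 * (4 + 4 * m) * \<Delta> n) \<le> \<delta> n * real (L n)" if n: "2 \<le> n" for n
  proof -
    have "2 * real (2 * S n + 2 * (4 + 4 * m) * \<Delta> n) = \<delta> n * real n" using n by (simp add: \<delta>_def)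
    also have "\<dots> \<le> \<delta> n * real (L n)" using L_ge[OF n] by (intro mult_left_mono) (auto simp: \<delta>_def)
    finally show ?thesis .
  qed
  have d0: "0 \<le> \<delta> n" for n by (simp add: \<delta>_def)
  have up: "(1 - \<delta> n) ^ (2 * m) * (real (card (graphs_between n (d n) A B)) / real (card (graphs n))) \<le> profile (X n) A B"
    if n: "2 \<le> n" "\<delta> n < 1" and AB: "A \<subseteq> [{1..n}]\<^bsup>2\<^esup>" "B \<subseteq> [{1..n}]\<^bsup>2\<^esup>" "A \<inter> B = {}" "card A \<le> m" "card B \<le> m" for n A B
  proof -
    interpret two_path_bound n "d n" "\<Delta> n" "S n" by (rule tpb[OF n(1)])
    show ?thesis
      using graphs_between_bounds(1)[OF L_pos[OF n(1)] cond[OF n(1)] d0 n(2) AB] card_graphs_pos[OF n(1)]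
      by (simp add: pos_divide_le_eq)
  qed
  have "error_bound \<delta> m"
    unfolding error_bound_def
  proof (intro conjI allI impI)
    show "\<delta> \<longlonglongrightarrow> 0"
    proof -
      have "\<delta> = (\<lambda>n. 4 * (real (S n) / real n) + 4 * real (4 + 4 * m) * (real (\<Delta> n) / real n))"
        by (auto simp: \<delta>_def add_divide_distrib fun_eq_iff)
      moreover have "\<dots> \<longlonglongrightarrow> 4 * 0 + 4 * real (4 + 4 * m) * 0"
        by (intro tendsto_add tendsto_mult tendsto_const lim)
      ultimately show ?thesis by simp
    qed
    show "0 \<le> \<delta> n" for n by (rule d0)
    fix n v assume n: "2 \<le> n" "\<delta> n < 1" and v: "v \<in> embeddings {1..n}"
    note vi = embedding_image[OF v]
    have vE: "(`) v ` E \<subseteq> [{1..n}]\<^bsup>2\<^esup>" "(`) v ` F \<subseteq> [{1..n}]\<^bsup>2\<^esup>" by (rule order_trans[OF image_mono[OF E] vi(1)], rule order_trans[OF image_mono[OF Diff_subset] vi(1)])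
    have cm: "card ((`) v ` E) \<le> m" "card ((`) v ` F) \<le> m" using vi unfolding m_def by linarith+
    show "(1 - \<delta> n) ^ (2 * m) * prob n (induced v) \<le> weight n v"
      unfolding prob_def prob_induced[OF v] profile_embedding[OF v, symmetric]
      by (rule up[OF n vE vi(2) cm])
    show "(1 - \<delta> n) ^ (2 * m) * (1 - \<eta>) ^ (2 * m) * weight n v \<le> prob n (induced v)"
      if \<eta>: "0 \<le> \<eta>" "\<eta> \<le> 1" "\<forall>i\<in>V. real m \<le> \<eta> * real (d n (v i))" for \<eta>
    proof -
      interpret two_path_bound n "d n" "\<Delta> n" "S n" by (rule tpb[OF n(1)])
      have "real m \<le> \<eta> * real (d n i)" if "i \<in> \<Union> ((`) v ` E)" for i
      proof -
        from that obtain e j where "e \<in> E" "j \<in> e" "i = v j" by blast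
        then show ?thesis using EF(1) bspec[OF \<eta>(3), of j] by blast
      qed
      from graphs_between_bounds(2)[OF L_pos[OF n(1)] cond[OF n(1)] d0 n(2) vE vi(2) cm \<eta>(1,2) this]
      show ?thesis unfolding prob_def prob_induced[OF v] profile_embedding[OF v, symmetric]
        using card_graphs_pos[OF n(1)] by (simp add: pos_le_divide_eq mult.assoc)
    qed
    fix w assume w: "w \<in> embeddings {1..n}" and disj: "v ` V \<inter> w ` V = {}"
    note wi = embedding_image[OF w]
    have wE: "(`) w ` E \<subseteq> [{1..n}]\<^bsup>2\<^esup>" "(`) w ` F \<subseteq> [{1..n}]\<^bsup>2\<^esup>" by (rule order_trans[OF image_mono[OF E] wi(1)], rule order_trans[OF image_mono[OF Diff_subset] wi(1)])
    have F2: "F \<subseteq> [V]\<^bsup>2\<^esup>" by (rule Diff_subset)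
    note dj = embeddings_disjoint_images[OF disj]
    have disj2: "((`) v ` E \<union> (`) w ` E) \<inter> ((`) v ` F \<union> (`) w ` F) = {}"
      using dj[OF F2 E]
      by (simp only: Int_Un_distrib Int_Un_distrib2 vi(2) wi(2) dj[OF E F2] Int_commute[of "(`) w ` E" "(`) v ` F"] Un_empty_left)
    have c2: "card ((`) v ` E \<union> (`) w ` E) \<le> m" "card ((`) v ` F \<union> (`) w ` F) \<le> m"
      using card_Un_le[of "(`) v ` E" "(`) w ` E"] card_Un_le[of "(`) v ` F" "(`) w ` F"] vi wi unfolding m_def by linarith+
    have pr: "profile (X n) ((`) v ` E \<union> (`) w ` E) ((`) v ` F \<union> (`) w ` F) = weight n v * weight n w"
      unfolding profile_embedding[OF v, symmetric] profile_embedding[OF w, symmetric]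
      by (rule profile_Un[OF finite_imageI[OF finite_EF(1)] finite_imageI[OF finite_EF(1)]
            finite_imageI[OF finite_EF(2)] finite_imageI[OF finite_EF(2)] dj[OF E E] dj[OF F2 F2]])
    show "(1 - \<delta> n) ^ (2 * m) * prob n (\<lambda>G. induced v G \<and> induced w G) \<le> weight n v * weight n w"
      unfolding prob_def prob_induced2[OF v w] pr[symmetric]
      by (rule up[OF n Un_least[OF vE(1) wE(1)] Un_least[OF vE(2) wE(2)] disj2 c2])
  qed
  then show thesis by (rule that)
qed

end

section \<open>Second moment method\<close>

context optimal_pattern
begin

abbreviation "core_embeddings n a b \<equiv> embeddings (core n a b)"

definition avg :: "nat \<Rightarrow> (nat set set \<Rightarrow> real) \<Rightarrow> real" where
  "avg n f = (\<Sum>G\<in>graphs n. f G) / real (card (graphs n))"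

definition count :: "(nat \<Rightarrow> nat) set \<Rightarrow> nat set set \<Rightarrow> real" where
  "count T G = (\<Sum>v\<in>T. of_bool (induced v G))"

lemma avg_mono: "(\<And>G. G \<in> graphs n \<Longrightarrow> f G \<le> g G) \<Longrightarrow> avg n f \<le> avg n g"
  unfolding avg_def by (intro divide_right_mono sum_mono) auto

lemma avg_nonneg: "(\<And>G. 0 \<le> f G) \<Longrightarrow> 0 \<le> avg n f"
  unfolding avg_def by (intro divide_nonneg_nonneg sum_nonneg) auto

lemma avg_cmult: "avg n (\<lambda>G. c * f G) = c * avg n f"
  by (simp add: avg_def sum_distrib_left)

lemma avg_sum: "avg n (\<lambda>G. \<Sum>v\<in>T. f v G) = (\<Sum>v\<in>T. avg n (f v))"
  unfolding avg_def sum_divide_distrib[symmetric] by (subst sum.swap) simp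

lemma prob_avg: "prob n P = avg n (\<lambda>G. of_bool (P G))"
  by (simp add: prob_def avg_def finite_graphs_with_degrees Int_def)

lemma prob_le_1: "prob n P \<le> 1"
proof -
  have "card {G \<in> graphs n. P G} \<le> card (graphs n)"
    by (rule card_mono) (auto simp: finite_graphs_with_degrees)
  then show ?thesis by (auto simp: prob_def divide_le_eq_1)
qed

lemma prob_markov:
  assumes "0 < t" "\<And>G. 0 \<le> f G"
  shows "prob n (\<lambda>G. t \<le> f G) \<le> avg n f / t"
proof -
  have "prob n (\<lambda>G. t \<le> f G) \<le> avg n (\<lambda>G. (1 / t) * f G)"
    unfolding prob_avg using assms by (intro avg_mono) auto
  then show ?thesis unfolding avg_cmult by simp
qed

lemma prob_union_bound:
  assumes "\<And>G. P G \<Longrightarrow> Q G \<or> R G"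
  shows "prob n P \<le> prob n Q + prob n R"
proof -
  have "prob n P \<le> avg n (\<lambda>G. of_bool (Q G) + of_bool (R G))"
    unfolding prob_avg using assms by (intro avg_mono) (auto simp: of_bool_def)
  also have "\<dots> = prob n Q + prob n R"
    unfolding prob_avg by (simp add: avg_def sum.distrib add_divide_distrib)
  finally show ?thesis .
qed

lemma avg_count: "avg n (count T) = (\<Sum>v\<in>T. prob n (induced v))"
  unfolding count_def[abs_def] avg_sum prob_avg ..

lemma avg_count_square: "avg n (\<lambda>G. (count T G)\<^sup>2) = (\<Sum>v\<in>T. \<Sum>w\<in>T. prob n (\<lambda>G. induced v G \<and> induced w G))"
proof -
  have "(count T G)\<^sup>2 = (\<Sum>v\<in>T. \<Sum>w\<in>T. of_bool (induced v G \<and> induced w G))" for G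
    unfolding power2_eq_square count_def sum_product by (simp add: of_bool_conj)
  then show ?thesis by (simp only: avg_sum prob_avg)
qed

lemma avg_const: "2 \<le> n \<Longrightarrow> avg n (\<lambda>G. c) = c"
  using card_graphs_pos[of n] by (simp add: avg_def)

lemma embeddings_mono: "S \<subseteq> S' \<Longrightarrow> embeddings S \<subseteq> embeddings S'"
  unfolding embeddings_def using PiE_mono[of V "\<lambda>_. S" "\<lambda>_. S'"] by blast

lemma core_subset: "core n a b \<subseteq> {1..n}"
  by (auto simp: core_def)

lemma z_inverse_lim: "(\<lambda>n. 1 / z n) \<longlonglongrightarrow> 0"
proof -
  define s where "s = (3 - \<tau>) / 2"
  have "0 < s" using params by (simp add: s_def)
  then have "(\<lambda>n. 1 / real n powr s) \<longlonglongrightarrow> 0" by real_asymp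
  then show ?thesis by (simp add: s_def)
qed

text \<open>The switching approximation to the mean number of core copies; being an explicit sum
  over degrees, it has a known limit and serves as the centre for the second moment.\<close>

definition core_weight :: "nat \<Rightarrow> real \<Rightarrow> real \<Rightarrow> real" where
  "core_weight n a b = (\<Sum>v\<in>core_embeddings n a b. weight n v)"

text \<open>The sum over all core tuples is already known to converge; the non-injective ones number
  O(|core|^(k - 1)), have weight at most 1, and vanish against \<open>z n ^ k\<close>.\<close>

lemma core_weight_lim:
  assumes ab: "0 < a" "a < b"
  shows "(\<lambda>n. core_weight n a b / z n ^ k) \<longlonglongrightarrow> \<kappa> ^ k * enn2real (truncated_integral \<tau> k E a b)"
proof -
  define g where "g = (\<lambda>n. \<Sum>v\<in>V \<rightarrow>\<^sub>E core n a b. weight n v)"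
  define M where "M = (\<lambda>n. real (card (core n a b)))"
  have glim: "(\<lambda>n. g n / z n ^ k) \<longlonglongrightarrow> \<kappa> ^ k * enn2real (truncated_integral \<tau> k E a b)"
    using core_sum_lim[OF ab E] by (simp only: g_def weight_def)
  obtain H where Mlim: "(\<lambda>n. M n / z n) \<longlonglongrightarrow> H"
    using core_card_lim[of a b] ab by (auto simp: M_def)
  have diff: "g n - core_weight n a b \<in> {0..(real k)\<^sup>2 * M n ^ (k - 1)}" for n
  proof -
    let ?N = "{v \<in> V \<rightarrow>\<^sub>E core n a b. \<not> inj_on v V}"
    have fin: "finite (V \<rightarrow>\<^sub>E core n a b)" by (intro finite_PiE) auto
    have "core_embeddings n a b = (V \<rightarrow>\<^sub>E core n a b) - ?N" unfolding embeddings_def by blast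
    then have "g n - core_weight n a b = (\<Sum>v\<in>?N. weight n v)"
      unfolding g_def core_weight_def using sum.subset_diff[of ?N "V \<rightarrow>\<^sub>E core n a b" "weight n"] fin by simp
    moreover have "0 \<le> (\<Sum>v\<in>?N. weight n v)" by (intro sum_nonneg weight_nonneg)
    moreover have "(\<Sum>v\<in>?N. weight n v) \<le> (\<Sum>v\<in>?N. 1)" by (intro sum_mono weight_le_1)
    moreover have "(\<Sum>v\<in>?N. 1) = real (card ?N)" by simp
    moreover have "real (card ?N) \<le> real (k\<^sup>2 * card (core n a b) ^ (k - 1))"
      using card_not_inj_PiE[of V "core n a b"] by (intro of_nat_mono) simp
    ultimately show ?thesis by (simp add: M_def)
  qed
  have "(\<lambda>n. (g n - core_weight n a b) / z n ^ k) \<longlonglongrightarrow> 0"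
  proof (rule tendsto_sandwich[where f = "\<lambda>_. 0"])
    have "(\<lambda>n. (real k)\<^sup>2 * (M n / z n) ^ (k - 1) * (1 / z n)) \<longlonglongrightarrow> (real k)\<^sup>2 * H ^ (k - 1) * 0"
      by (intro tendsto_mult tendsto_const tendsto_power Mlim z_inverse_lim)
    then show "(\<lambda>n. (real k)\<^sup>2 * (M n / z n) ^ (k - 1) * (1 / z n)) \<longlonglongrightarrow> 0" by simp
    show "\<forall>\<^sub>F n in sequentially. (g n - core_weight n a b) / z n ^ k \<le> (real k)\<^sup>2 * (M n / z n) ^ (k - 1) * (1 / z n)"
    proof (intro always_eventually allI)
      fix n
      have "z n ^ k = z n ^ (k - 1) * z n" using k_pos by (metis power_minus_mult)
      then have "(real k)\<^sup>2 * (M n / z n) ^ (k - 1) * (1 / z n) = (real k)\<^sup>2 * M n ^ (k - 1) / z n ^ k"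
        by (simp add: power_divide)
      moreover have "(g n - core_weight n a b) / z n ^ k \<le> (real k)\<^sup>2 * M n ^ (k - 1) / z n ^ k"
        using diff[of n] by (intro divide_right_mono) auto
      ultimately show "(g n - core_weight n a b) / z n ^ k \<le> (real k)\<^sup>2 * (M n / z n) ^ (k - 1) * (1 / z n)" by simp
    qed
    show "\<forall>\<^sub>F n in sequentially. 0 \<le> (g n - core_weight n a b) / z n ^ k"
      using diff by (intro always_eventually allI divide_nonneg_nonneg) auto
  qed simp
  from tendsto_diff[OF glim this] show ?thesis by (simp add: diff_divide_distrib)
qed

lemma meeting_pairs:
  "real (card {(v, w) \<in> core_embeddings n a b \<times> core_embeddings n a b. v ` V \<inter> w ` V \<noteq> {}})
    \<le> real (card (core n a b)) ^ k * ((real k)\<^sup>2 * real (card (core n a b)) ^ (k - 1))"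
proof -
  let ?T = "core_embeddings n a b" and ?P = "V \<rightarrow>\<^sub>E core n a b"
  have fin: "finite ?P" by (intro finite_PiE) auto
  have TP: "?T \<subseteq> ?P" unfolding embeddings_def by blast
  have "{(v, w) \<in> ?T \<times> ?T. v ` V \<inter> w ` V \<noteq> {}} \<subseteq> (SIGMA v:?P. {w \<in> ?P. v ` V \<inter> w ` V \<noteq> {}})"
    using TP by blast
  then have "card {(v, w) \<in> ?T \<times> ?T. v ` V \<inter> w ` V \<noteq> {}} \<le> card (SIGMA v:?P. {w \<in> ?P. v ` V \<inter> w ` V \<noteq> {}})"
    using fin by (intro card_mono finite_SigmaI) auto
  moreover have "real (card (SIGMA v:?P. {w \<in> ?P. v ` V \<inter> w ` V \<noteq> {}})) \<le> real (card ?P) * real (k\<^sup>2 * card (core n a b) ^ (k - 1))"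
  proof (rule card_Sigma_le[OF fin])
    fix v
    show "finite {w \<in> ?P. v ` V \<inter> w ` V \<noteq> {}}" using fin by simp
    show "real (card {w \<in> ?P. v ` V \<inter> w ` V \<noteq> {}}) \<le> real (k\<^sup>2 * card (core n a b) ^ (k - 1))"
      using card_meeting_PiE[of V "core n a b" v] by (intro of_nat_mono) simp
  qed
  moreover have "card ?P = card (core n a b) ^ k" by (simp add: card_PiE)
  ultimately show ?thesis by simp
qed

text \<open>Centred at \<open>core_weight\<close>, the expanded square contains joint probabilities
  with a plus sign and single ones with a minus sign, so upper bounds for disjoint pairs and lower
  bounds for single tuples suffice; 1 / c - 2 * c' + 1 vanishes as c and c' tend to 1. Pairs that
  share a vertex are merely counted, each with probability at most 1.\<close>

lemma second_moment_bound:
  assumes n: "2 \<le> n" and c: "0 < c"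
    and pair: "\<And>v w. \<lbrakk>v \<in> core_embeddings n a b; w \<in> core_embeddings n a b; v ` V \<inter> w ` V = {}\<rbrakk> \<Longrightarrow>
      c * prob n (\<lambda>G. induced v G \<and> induced w G) \<le> weight n v * weight n w"
    and single: "\<And>v. v \<in> core_embeddings n a b \<Longrightarrow> c' * weight n v \<le> prob n (induced v)"
  shows "avg n (\<lambda>G. (count (core_embeddings n a b) G - core_weight n a b)\<^sup>2)
    \<le> (core_weight n a b)\<^sup>2 * (1 / c - 2 * c' + 1)
      + real (card (core n a b)) ^ k * ((real k)\<^sup>2 * real (card (core n a b)) ^ (k - 1))"
proof -
  let ?T = "core_embeddings n a b"
  let ?W = "core_weight n a b"
  let ?M = "{(v, w) \<in> ?T \<times> ?T. v ` V \<inter> w ` V \<noteq> {}}"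
  let ?p = "\<lambda>v w. prob n (\<lambda>G. induced v G \<and> induced w G)"
  have fT: "finite ?T" by (rule finite_embeddings) simp
  have W0: "0 \<le> ?W" unfolding core_weight_def by (intro sum_nonneg weight_nonneg)
  have "(\<Sum>v\<in>?T. \<Sum>w\<in>?T. ?p v w) \<le> (\<Sum>v\<in>?T. \<Sum>w\<in>?T. weight n v * weight n w / c + of_bool (v ` V \<inter> w ` V \<noteq> {}))"
  proof (intro sum_mono)
    fix v w assume vw: "v \<in> ?T" "w \<in> ?T"
    show "?p v w \<le> weight n v * weight n w / c + of_bool (v ` V \<inter> w ` V \<noteq> {})"
    proof (cases "v ` V \<inter> w ` V = {}")
      case True
      then show ?thesis using pair[OF vw True] c by (simp add: pos_le_divide_eq mult.commute)
    next
      case False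
      have "0 \<le> weight n v * weight n w / c" using c by (intro divide_nonneg_nonneg mult_nonneg_nonneg weight_nonneg) simp
      then show ?thesis using False prob_le_1[of n "\<lambda>G. induced v G \<and> induced w G"] by simp
    qed
  qed
  also have "\<dots> = ?W * ?W / c + (\<Sum>v\<in>?T. \<Sum>w\<in>?T. of_bool (v ` V \<inter> w ` V \<noteq> {}))"
    unfolding sum.distrib core_weight_def sum_product sum_divide_distrib ..
  also have "(\<Sum>v\<in>?T. \<Sum>w\<in>?T. of_bool (v ` V \<inter> w ` V \<noteq> {})) = real (card ?M)"
  proof -
    have "(\<Sum>v\<in>?T. \<Sum>w\<in>?T. of_bool (v ` V \<inter> w ` V \<noteq> {}) :: real) = (\<Sum>p\<in>?T \<times> ?T. of_bool (fst p ` V \<inter> snd p ` V \<noteq> {}))"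
      unfolding sum.cartesian_product by (simp add: case_prod_beta)
    also have "\<dots> = real (card {p \<in> ?T \<times> ?T. fst p ` V \<inter> snd p ` V \<noteq> {}})"
      using fT by (simp add: Int_def)
    also have "{p \<in> ?T \<times> ?T. fst p ` V \<inter> snd p ` V \<noteq> {}} = ?M" by (auto simp: case_prod_beta)
    finally show ?thesis .
  qed
  finally have sq: "avg n (\<lambda>G. (count ?T G)\<^sup>2) \<le> ?W * ?W / c + real (card ?M)"
    unfolding avg_count_square .
  have "c' * ?W = (\<Sum>v\<in>?T. c' * weight n v)" unfolding core_weight_def sum_distrib_left ..
  also have "\<dots> \<le> avg n (count ?T)" unfolding avg_count by (intro sum_mono single)
  finally have lin: "c' * ?W \<le> avg n (count ?T)" .
  have "avg n (\<lambda>G. (count ?T G - ?W)\<^sup>2) = avg n (\<lambda>G. (count ?T G)\<^sup>2) - 2 * ?W * avg n (count ?T) + ?W\<^sup>2"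
  proof -
    have "avg n (\<lambda>G. (count ?T G - ?W)\<^sup>2) = avg n (\<lambda>G. (count ?T G)\<^sup>2) - avg n (\<lambda>G. (2 * ?W) * count ?T G) + avg n (\<lambda>G. ?W\<^sup>2)"
      unfolding avg_def diff_divide_distrib[symmetric] add_divide_distrib[symmetric] sum_subtractf[symmetric] sum.distrib[symmetric]
      by (intro arg_cong2[where f = "(/)"] sum.cong refl) (simp add: power2_diff)
    then show ?thesis unfolding avg_cmult avg_const[OF n] .
  qed
  also have "\<dots> \<le> (?W * ?W / c + real (card ?M)) - 2 * ?W * (c' * ?W) + ?W\<^sup>2"
    using sq lin W0 by (intro add_mono diff_mono mult_left_mono) auto
  also have "\<dots> = ?W\<^sup>2 * (1 / c - 2 * c' + 1) + real (card ?M)"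
    by (simp add: power2_eq_square algebra_simps)
  finally show ?thesis using meeting_pairs[of n a b] by linarith
qed

lemma core_concentration:
  assumes ab: "0 < a" "a < b"
  shows "(\<lambda>n. avg n (\<lambda>G. (count (core_embeddings n a b) G - core_weight n a b)\<^sup>2) / (z n ^ k)\<^sup>2) \<longlonglongrightarrow> 0"
proof -
  obtain \<delta> m where eb: "error_bound \<delta> m" by (rule error_bound_exists)
  note \<delta> = error_boundD(1,2)[OF eb] and up = error_boundD(3)[OF eb]
    and pair = error_boundD(4)[OF eb] and single = error_boundD(5)[OF eb]
  \<comment> \<open>Core vertices have degree above a sqrt L \<ge> a sqrt n, so m prescribed edges
    are at most this fraction of it.\<close>
  define \<eta> where "\<eta> = (\<lambda>n. real m / a * (1 / sqrt (real n)))"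
  define c where "c = (\<lambda>n. (1 - \<delta> n) ^ (2 * m))"
  define c' where "c' = (\<lambda>n. (1 - \<delta> n) ^ (2 * m) * (1 - \<eta> n) ^ (2 * m))"
  define M where "M = (\<lambda>n. real (card (core n a b)))"
  have inv: "(\<lambda>n. 1 / sqrt (real n)) \<longlonglongrightarrow> 0" by real_asymp
  have \<eta>lim: "\<eta> \<longlonglongrightarrow> 0" using tendsto_mult_left[OF inv, of "real m / a"] by (simp add: \<eta>_def)
  have \<eta>0: "0 \<le> \<eta> n" for n using ab by (simp add: \<eta>_def)
  have clim: "c \<longlonglongrightarrow> 1"
    using tendsto_power[OF tendsto_diff[OF tendsto_const \<delta>(1)], of 1 "2 * m"] by (simp add: c_def)
  have c'lim: "c' \<longlonglongrightarrow> 1"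
    using tendsto_mult[OF clim tendsto_power[OF tendsto_diff[OF tendsto_const \<eta>lim], of 1 "2 * m"]] by (simp add: c'_def c_def)
  obtain H where Mlim: "(\<lambda>n. M n / z n) \<longlonglongrightarrow> H"
    using core_card_lim[of a b] ab by (auto simp: M_def)
  let ?u = "\<lambda>n. (core_weight n a b / z n ^ k)\<^sup>2 * (1 / c n - 2 * c' n + 1) + (M n / z n) ^ k * ((real k)\<^sup>2 * (M n / z n) ^ (k - 1)) * (1 / z n)"
  show ?thesis
  proof (rule tendsto_sandwich[where f = "\<lambda>_. 0"])
    have "?u \<longlonglongrightarrow> (\<kappa> ^ k * enn2real (truncated_integral \<tau> k E a b))\<^sup>2 * (1 / 1 - 2 * 1 + 1) + H ^ k * ((real k)\<^sup>2 * H ^ (k - 1)) * 0"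
      by (intro tendsto_add tendsto_mult tendsto_diff tendsto_divide tendsto_const tendsto_power core_weight_lim[OF ab] clim c'lim Mlim z_inverse_lim) simp
    then show "?u \<longlonglongrightarrow> 0" by simp
    show "\<forall>\<^sub>F n in sequentially. 0 \<le> avg n (\<lambda>G. (count (core_embeddings n a b) G - core_weight n a b)\<^sup>2) / (z n ^ k)\<^sup>2"
      by (intro always_eventually allI divide_nonneg_nonneg avg_nonneg) auto
    have "\<forall>\<^sub>F n in sequentially. \<delta> n < 1" using order_tendstoD(2)[OF \<delta>(1), of 1] by simp
    moreover have "\<forall>\<^sub>F n in sequentially. \<eta> n < 1" using order_tendstoD(2)[OF \<eta>lim, of 1] by simp
    moreover have "\<forall>\<^sub>F n in sequentially. (2::nat) \<le> n" by (rule eventually_ge_at_top)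
    ultimately show "\<forall>\<^sub>F n in sequentially. avg n (\<lambda>G. (count (core_embeddings n a b) G - core_weight n a b)\<^sup>2) / (z n ^ k)\<^sup>2 \<le> ?u n"
    proof eventually_elim
      case (elim n)
      note sub = subsetD[OF embeddings_mono[OF core_subset]]
      have "avg n (\<lambda>G. (count (core_embeddings n a b) G - core_weight n a b)\<^sup>2)
        \<le> (core_weight n a b)\<^sup>2 * (1 / c n - 2 * c' n + 1) + M n ^ k * ((real k)\<^sup>2 * M n ^ (k - 1))"
        unfolding M_def
      proof (rule second_moment_bound[OF elim(3)])
        show "0 < c n" using elim by (simp add: c_def)
        show "c n * prob n (\<lambda>G. induced v G \<and> induced w G) \<le> weight n v * weight n w"
          if "v \<in> core_embeddings n a b" "w \<in> core_embeddings n a b" "v ` V \<inter> w ` V = {}" for v w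
          unfolding c_def by (rule pair[OF elim(3,1) sub[OF that(1)] sub[OF that(2)] that(3)])
        fix v assume v: "v \<in> core_embeddings n a b"
        show "c' n * weight n v \<le> prob n (induced v)"
          unfolding c'_def
        proof (rule single[OF elim(3,1) sub[OF v] \<eta>0])
          show "\<eta> n \<le> 1" using elim by simp
          fix i assume "i \<in> V"
          then have "v i \<in> core n a b" using v unfolding embeddings_def by blast
          then have "a < X n (v i)" by (simp add: core_def)
          then have "a * sqrt (real (L n)) < real (d n (v i))"
            using L_pos[OF elim(3)] by (simp add: scaled_degree_def pos_less_divide_eq)
          moreover have "sqrt (real n) \<le> sqrt (real (L n))" using L_ge[OF elim(3)] by simp
          ultimately have "a * sqrt (real n) \<le> real (d n (v i))"
            using ab by (smt (verit) mult_left_mono)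
          then have "\<eta> n * (a * sqrt (real n)) \<le> \<eta> n * real (d n (v i))" by (rule mult_left_mono) (rule \<eta>0)
          moreover have "\<eta> n * (a * sqrt (real n)) = real m" using ab elim(3) by (simp add: \<eta>_def)
          ultimately show "real m \<le> \<eta> n * real (d n (v i))" by simp
        qed
      qed
      then have "avg n (\<lambda>G. (count (core_embeddings n a b) G - core_weight n a b)\<^sup>2) / (z n ^ k)\<^sup>2
        \<le> ((core_weight n a b)\<^sup>2 * (1 / c n - 2 * c' n + 1) + M n ^ k * ((real k)\<^sup>2 * M n ^ (k - 1))) / (z n ^ k)\<^sup>2"
        by (rule divide_right_mono) simp
      also have "\<dots> = ?u n"
      proof -
        have zk: "z n ^ k = z n ^ (k - 1) * z n" using k_pos by (metis power_minus_mult)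
        have "(z n ^ k)\<^sup>2 = z n ^ k * (z n ^ (k - 1) * z n)" unfolding power2_eq_square by (simp only: zk[symmetric])
        then have "M n ^ k * ((real k)\<^sup>2 * M n ^ (k - 1)) / (z n ^ k)\<^sup>2 = (M n / z n) ^ k * ((real k)\<^sup>2 * (M n / z n) ^ (k - 1)) * (1 / z n)"
          by (simp add: power_divide)
        then show ?thesis by (simp add: add_divide_distrib power_divide)
      qed
      finally show ?case .
    qed
  qed simp
qed

text \<open>Uses the upper bound on a single tuple, which asks nothing of its degrees; the factor 2
  in the constant absorbs (1 - \<delta>)^(-2 m) for large n.\<close>

lemma outer_expectation:
  obtains Q c0 where "0 < c0" "\<And>R. 1 \<le> R \<Longrightarrow> \<forall>\<^sub>F n in sequentially.
      avg n (count (embeddings {1..n} - core_embeddings n (1 / R) R)) \<le> Q * z n ^ k * R powr (- c0)"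
proof -
  obtain \<delta> m where eb: "error_bound \<delta> m" by (rule error_bound_exists)
  note \<delta> = error_boundD(1,2)[OF eb] and up = error_boundD(3)[OF eb]
    and pair = error_boundD(4)[OF eb] and single = error_boundD(5)[OF eb]
  obtain Q c0 where Q: "0 \<le> Q" "0 < c0" "\<And>n R. \<lbrakk>2 \<le> n; 1 \<le> R\<rbrakk> \<Longrightarrow>
    (\<Sum>v\<in>(V \<rightarrow>\<^sub>E {1..n}) - (V \<rightarrow>\<^sub>E core n (1 / R) R). profile (\<lambda>i. X n (v i)) E F) \<le> Q * z n ^ k * R powr (- c0)"
    using outer_profile_sum by blast
  show thesis
  proof (rule that[of c0 "2 * Q"])
    show "0 < c0" by (rule Q(2))
    fix R :: real assume R: "1 \<le> R"
    have "(\<lambda>n. (1 - \<delta> n) ^ (2 * m)) \<longlonglongrightarrow> (1 - 0) ^ (2 * m)"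
      by (intro tendsto_diff tendsto_power tendsto_const \<delta>)
    then have "\<forall>\<^sub>F n in sequentially. 1 / 2 < (1 - \<delta> n) ^ (2 * m)"
      by (intro order_tendstoD(1)[where y = 1]) auto
    moreover have "\<forall>\<^sub>F n in sequentially. \<delta> n < 1" using order_tendstoD(2)[OF \<delta>(1), of 1] by simp
    moreover have "\<forall>\<^sub>F n in sequentially. (2::nat) \<le> n" by (rule eventually_ge_at_top)
    ultimately show "\<forall>\<^sub>F n in sequentially.
      avg n (count (embeddings {1..n} - core_embeddings n (1 / R) R)) \<le> 2 * Q * z n ^ k * R powr (- c0)"
    proof eventually_elim
      case (elim n)
      let ?T = "embeddings {1..n} - core_embeddings n (1 / R) R"
      let ?O = "(V \<rightarrow>\<^sub>E {1..n}) - (V \<rightarrow>\<^sub>E core n (1 / R) R)"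
      have TO: "?T \<subseteq> ?O" unfolding embeddings_def by blast
      have fO: "finite ?O" by (intro finite_Diff finite_PiE) auto
      have le: "prob n (induced v) \<le> 2 * weight n v" if "v \<in> ?T" for v
      proof -
        have "v \<in> embeddings {1..n}" using that by blast
        note up[OF elim(3,2) this]
        moreover have "1 / 2 * prob n (induced v) \<le> (1 - \<delta> n) ^ (2 * m) * prob n (induced v)"
          using elim(1) by (intro mult_right_mono) (auto simp: prob_def)
        ultimately show ?thesis by linarith
      qed
      have "avg n (count ?T) \<le> (\<Sum>v\<in>?T. 2 * weight n v)"
        unfolding avg_count by (intro sum_mono le)
      also have "\<dots> \<le> (\<Sum>v\<in>?O. 2 * weight n v)"
        by (intro sum_mono2[OF fO TO]) (simp add: weight_nonneg)
      also have "\<dots> = 2 * (\<Sum>v\<in>?O. weight n v)" by (simp add: sum_distrib_left)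
      also have "\<dots> \<le> 2 * (Q * z n ^ k * R powr (- c0))"
        using Q(3)[OF elim(3) R] unfolding weight_def by simp
      finally show ?case by simp
    qed
  qed
qed

section \<open>Convergence in probability\<close>

lemma count_convergence:
  assumes \<epsilon>: "0 < \<epsilon>"
  shows "(\<lambda>n. prob n (\<lambda>G. \<epsilon> < \<bar>count (embeddings {1..n}) G / z n ^ k - enn2real (A_const \<tau> C \<mu> k E)\<bar>)) \<longlonglongrightarrow> 0"
proof (rule LIMSEQ_I)
  fix \<rho> :: real assume \<rho>: "0 < \<rho>"
  define A where "A = enn2real (A_const \<tau> C \<mu> k E)"
  define AR where "AR = (\<lambda>R. \<kappa> ^ k * enn2real (truncated_integral \<tau> k E (1 / R) R))"
  obtain Q c0 where c0: "0 < c0" and outer: "\<And>R. 1 \<le> R \<Longrightarrow> \<forall>\<^sub>F n in sequentially.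
      avg n (count (embeddings {1..n} - core_embeddings n (1 / R) R)) \<le> Q * z n ^ k * R powr (- c0)"
    using outer_expectation by blast
  \<comment> \<open>R is fixed before n grows. Four errors get \<epsilon> / 4 each: truncating A,
    replacing the core weight by its limit, the fluctuation of the core count (Chebyshev) and the
    outer copies (Markov). The last two get probability \<rho> / 2 each, whence \<rho> * \<epsilon>
    / 8 = (\<rho> / 2) * (\<epsilon> / 4).\<close>
  obtain R where R: "2 \<le> R" "\<bar>AR R - A\<bar> < \<epsilon> / 4" "Q * R powr (- c0) < \<rho> * \<epsilon> / 8"
  proof -
    have "\<forall>\<^sub>F m in sequentially. \<bar>AR (real m + 2) - A\<bar> < \<epsilon> / 4"
      using tendstoD[OF truncated_A_lim, of "\<epsilon> / 4"] \<epsilon> by (simp add: AR_def A_def dist_real_def)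
    moreover have "\<forall>\<^sub>F m in sequentially. Q * (real m + 2) powr (- c0) < \<rho> * \<epsilon> / 8"
    proof (rule order_tendstoD(2))
      show "(\<lambda>m. Q * (real m + 2) powr (- c0)) \<longlonglongrightarrow> 0" using c0 by real_asymp
      show "0 < \<rho> * \<epsilon> / 8" using \<rho> \<epsilon> by simp
    qed
    ultimately have "\<forall>\<^sub>F m in sequentially. \<bar>AR (real m + 2) - A\<bar> < \<epsilon> / 4 \<and> Q * (real m + 2) powr (- c0) < \<rho> * \<epsilon> / 8"
      by (rule eventually_conj)
    then obtain m where "\<bar>AR (real m + 2) - A\<bar> < \<epsilon> / 4" "Q * (real m + 2) powr (- c0) < \<rho> * \<epsilon> / 8"
      by (auto simp: eventually_sequentially)
    then show thesis by (intro that[of "real m + 2"]) auto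
  qed
  have ab: "0 < 1 / R" "1 / R < R"
  proof -
    show "0 < 1 / R" using R by simp
    have "1 / R \<le> 1 / 2" using R by (intro divide_left_mono) auto
    then show "1 / R < R" using R by linarith
  qed
  define T where "T = (\<lambda>n. core_embeddings n (1 / R) R)"
  define W where "W = (\<lambda>n. core_weight n (1 / R) R)"
  have "\<forall>\<^sub>F n in sequentially. \<bar>W n / z n ^ k - AR R\<bar> < \<epsilon> / 4"
    using tendstoD[OF core_weight_lim[OF ab], of "\<epsilon> / 4"] \<epsilon> by (simp add: W_def AR_def dist_real_def)
  moreover have "\<forall>\<^sub>F n in sequentially. avg n (\<lambda>G. (count (T n) G - W n)\<^sup>2) / (z n ^ k)\<^sup>2 < \<rho> / 2 * (\<epsilon> / 4)\<^sup>2"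
    unfolding T_def W_def by (rule order_tendstoD(2)[OF core_concentration[OF ab]]) (use \<rho> \<epsilon> in simp)
  moreover have "\<forall>\<^sub>F n in sequentially. avg n (count (embeddings {1..n} - T n)) \<le> Q * z n ^ k * R powr (- c0)"
    unfolding T_def by (rule outer) (use R in simp)
  moreover have "\<forall>\<^sub>F n in sequentially. (2::nat) \<le> n" by (rule eventually_ge_at_top)
  ultimately have "\<forall>\<^sub>F n in sequentially. prob n (\<lambda>G. \<epsilon> < \<bar>count (embeddings {1..n}) G / z n ^ k - A\<bar>) < \<rho>"
  proof eventually_elim
    case (elim n)
    define s where "s = z n ^ k"
    have s: "0 < s" using elim by (simp add: s_def)
    let ?D = "\<lambda>G. (count (T n) G - W n)\<^sup>2 / s\<^sup>2" and ?O = "\<lambda>G. count (embeddings {1..n} - T n) G / s"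
    have Tsub: "T n \<subseteq> embeddings {1..n}" unfolding T_def by (rule embeddings_mono[OF core_subset])
    have O0: "0 \<le> count U G" for U G unfolding count_def by (rule sum_nonneg) simp
    have split: "count (embeddings {1..n}) G = count (embeddings {1..n} - T n) G + count (T n) G" for G
      unfolding count_def by (rule sum.subset_diff[OF Tsub finite_embeddings]) simp
    have "prob n (\<lambda>G. \<epsilon> < \<bar>count (embeddings {1..n}) G / s - A\<bar>) \<le> prob n (\<lambda>G. (\<epsilon> / 4)\<^sup>2 \<le> ?D G) + prob n (\<lambda>G. \<epsilon> / 4 \<le> ?O G)"
    proof (rule prob_union_bound)
      fix G assume big: "\<epsilon> < \<bar>count (embeddings {1..n}) G / s - A\<bar>"
      show "(\<epsilon> / 4)\<^sup>2 \<le> ?D G \<or> \<epsilon> / 4 \<le> ?O G"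
      proof (rule ccontr)
        assume "\<not> ((\<epsilon> / 4)\<^sup>2 \<le> ?D G \<or> \<epsilon> / 4 \<le> ?O G)"
        then have D: "((count (T n) G - W n) / s)\<^sup>2 < (\<epsilon> / 4)\<^sup>2" and O: "?O G < \<epsilon> / 4" by (auto simp: power_divide)
        have "\<bar>(count (T n) G - W n) / s\<bar> < \<epsilon> / 4"
        proof (rule power2_less_imp_less)
          show "\<bar>(count (T n) G - W n) / s\<bar>\<^sup>2 < (\<epsilon> / 4)\<^sup>2" using D by (simp only: power2_abs)
          show "0 \<le> \<epsilon> / 4" using \<epsilon> by simp
        qed
        moreover have "count (embeddings {1..n}) G / s - A = (count (T n) G - W n) / s + (W n / s - AR R) + (AR R - A) + ?O G"
          unfolding split by (simp add: add_divide_distrib diff_divide_distrib)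
        moreover have "0 \<le> ?O G" using O0 s by (intro divide_nonneg_nonneg) auto
        moreover have "\<bar>W n / s - AR R\<bar> < \<epsilon> / 4" using elim(1) by (simp add: s_def)
        ultimately show False using big O R(2) by linarith
      qed
    qed
    also have "\<dots> < \<rho> / 2 + \<rho> / 2"
    proof (rule add_less_le_mono)
      have "prob n (\<lambda>G. (\<epsilon> / 4)\<^sup>2 \<le> ?D G) \<le> avg n ?D / (\<epsilon> / 4)\<^sup>2"
        using \<epsilon> by (intro prob_markov) auto
      also have "\<dots> = avg n (\<lambda>G. (count (T n) G - W n)\<^sup>2) / s\<^sup>2 / (\<epsilon> / 4)\<^sup>2"
        using avg_cmult[of n "1 / s\<^sup>2" "\<lambda>G. (count (T n) G - W n)\<^sup>2"] by simp
      also have "\<dots> < \<rho> / 2"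
        using elim(2) \<epsilon> unfolding s_def[symmetric] by (subst pos_divide_less_eq) auto
      finally show "prob n (\<lambda>G. (\<epsilon> / 4)\<^sup>2 \<le> ?D G) < \<rho> / 2" .
      have "prob n (\<lambda>G. \<epsilon> / 4 \<le> ?O G) \<le> avg n ?O / (\<epsilon> / 4)"
        using \<epsilon> O0 s by (intro prob_markov) auto
      also have "\<dots> \<le> \<rho> / 2"
      proof -
        have "avg n ?O = avg n (count (embeddings {1..n} - T n)) / s"
          using avg_cmult[of n "1 / s" "count (embeddings {1..n} - T n)"] by simp
        also have "\<dots> \<le> Q * R powr (- c0)"
          using elim(3) s unfolding s_def[symmetric] by (simp add: pos_divide_le_eq mult_ac)
        also have "\<dots> \<le> \<rho> / 2 * (\<epsilon> / 4)" using R(3) by simp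
        finally show ?thesis using \<epsilon> by (simp add: pos_divide_le_eq)
      qed
      finally show "prob n (\<lambda>G. \<epsilon> / 4 \<le> ?O G) \<le> \<rho> / 2" .
    qed
    finally show ?case by (simp add: s_def)
  qed
  then obtain N where "\<And>n. N \<le> n \<Longrightarrow> prob n (\<lambda>G. \<epsilon> < \<bar>count (embeddings {1..n}) G / z n ^ k - A\<bar>) < \<rho>"
    by (auto simp: eventually_sequentially)
  moreover have "0 \<le> prob n P" for n P by (simp add: prob_def)
  ultimately show "\<exists>N. \<forall>n\<ge>N. norm (prob n (\<lambda>G. \<epsilon> < \<bar>count (embeddings {1..n}) G / z n ^ k - enn2real (A_const \<tau> C \<mu> k E)\<bar>) - 0) < \<rho>"
    unfolding A_def by auto
qed

lemma URG_prob:
  assumes "2 \<le> n"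
  shows "measure_pmf.prob (URG n (d n)) {G. P G} = prob n P"
  unfolding URG_def using measure_pmf_of_set[OF graphs_nonempty[OF assms] finite_graphs_with_degrees]
  by (simp add: prob_def Int_def)

lemma count_eq: "count (embeddings {1..n}) G = real (induced_count k E n G)"
  unfolding induced_count_eq count_def using finite_embeddings[of "{1..n}"] by (simp add: Int_def)

lemma induced_count_convergence:
  assumes "0 < \<epsilon>"
  shows "(\<lambda>n. measure_pmf.prob (URG n (d n))
        {G. \<bar>real (induced_count k E n G) / real n powr (real k / 2 * (3 - \<tau>))
              - enn2real (A_const \<tau> C \<mu> k E)\<bar> > \<epsilon>}) \<longlonglongrightarrow> 0"
proof (rule Lim_transform_eventually[OF count_convergence[OF assms]])
  show "\<forall>\<^sub>F n in sequentially. prob n (\<lambda>G. \<epsilon> < \<bar>count (embeddings {1..n}) G / z n ^ k - enn2real (A_const \<tau> C \<mu> k E)\<bar>)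
    = measure_pmf.prob (URG n (d n)) {G. \<bar>real (induced_count k E n G) / real n powr (real k / 2 * (3 - \<tau>))
              - enn2real (A_const \<tau> C \<mu> k E)\<bar> > \<epsilon>}"
    using eventually_ge_at_top[of 2]
  proof eventually_elim
    case (elim n)
    have "z n ^ k = z n powr real k" using elim by (simp add: powr_realpow)
    also have "\<dots> = real n powr (real k / 2 * (3 - \<tau>))" by (simp add: powr_powr mult.commute)
    finally show ?case unfolding URG_prob[OF elim] count_eq by simp
  qed
qed

end

theorem theorem2p2:
  fixes \<tau> C \<mu> :: real
    and d :: "nat \<Rightarrow> nat \<Rightarrow> nat"
    and k :: nat
    and E\<^sub>H :: "nat set set"
  assumes "degree_assumption \<tau> C \<mu> d"
    and "simple_graph {1..k} E\<^sub>H"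
    and "connected_graph {1..k} E\<^sub>H"
    and "\<forall>v\<in>{1..k}. 2 \<le> degree_in E\<^sub>H v"
    and "B_unique_maximizer \<tau> {1..k} E\<^sub>H"
    and "B_value \<tau> {1..k} E\<^sub>H = 0"
  shows "A_const \<tau> C \<mu> k E\<^sub>H < \<infinity> \<and>
    (\<forall>\<epsilon>>0. (\<lambda>n. measure_pmf.prob (URG n (d n))
        {G. \<bar>real (induced_count k E\<^sub>H n G) / real n powr (real k / 2 * (3 - \<tau>))
              - enn2real (A_const \<tau> C \<mu> k E\<^sub>H)\<bar> > \<epsilon>}) \<longlonglongrightarrow> 0)"
proof -
  interpret power_law_degrees \<tau> C \<mu> d by standard (rule assms(1))
  have ne: "{1..k} \<noteq> {}" using assms(3) by (simp add: connected_graph_def)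
  have EH: "E\<^sub>H \<subseteq> [{1..k}]\<^bsup>2\<^esup>" using assms(2) by (simp add: simple_graph_def)
  have "degree_in E\<^sub>H v \<noteq> 1" if "v \<in> {1..k}" for v using assms(4) that by force
  \<comment> \<open>Minimal degree 2 empties V1, so the partitions of the optimization problem are
    partitions of all of V.\<close>
  then have "degree_one_vertices {1..k} E\<^sub>H = {}" unfolding degree_one_vertices_def by blast
  then obtain c where c: "0 < c" "\<And>y. exponent \<tau> {1..k} E\<^sub>H y \<le> - c * (\<Sum>i\<in>{1..k}. \<bar>y i\<bar>)"
    using exponent_decay[OF finite_atLeastAtMost ne EH _ _ assms(5,6)] params by auto
  interpret optimal_pattern \<tau> C \<mu> d k E\<^sub>H
  proof
    show "0 < k" using ne by simp
    show "E\<^sub>H \<subseteq> [{1..k}]\<^bsup>2\<^esup>" by (rule EH)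
    show "\<exists>c>0. \<forall>y. exponent \<tau> {1..k} E\<^sub>H y \<le> - c * (\<Sum>i\<in>{1..k}. \<bar>y i\<bar>)" using c by blast
  qed
  show ?thesis using A_const_finite induced_count_convergence by blast
qed

end
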